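(* Let $\Lambda\subset\mathbb{R}^d$ be uniformly discrete, let $S\subset\mathbb{R}^d$ be weakly uniformly discrete, and consider measures $\mu,\nu\in\mathcal{S}'(\mathbb{R}^d)$ given by $$\mu=\sum_{x\in\Lambda}a(x)\,\delta_x\quad\text{and}\quad\nu=\sum_{y\in S}b(y)\,\delta_y.$$ If $\nu$ is the distributional Fourier transform of $\mu$, then $\mu$ and $\nu$ are translation-bounded measures that are Fourier transformable as measures and, as such, satisfy $\widehat\mu=\nu$.
   Context: "Measure" means complex Radon measure. $\mathcal{S}'(\mathbb{R}^d)$ is the space of tempered distributions. The distributional Fourier transform of $\mu\in\mathcal{S}'(\mathbb{R}^d)$ is the $\nu\in\mathcal{S}'(\mathbb{R}^d)$ with $\langle\nu,\varphi\rangle=\langle\mu,\widehat\varphi\,\rangle$ for all Schwartz functions $\varphi$, where $\widehat\varphi(k)=\int_{\mathbb{R}^d}e^{-2\pi\mathrm{i}kx}\varphi(x)\,\mathrm{d}x$; also $\check\varphi(k)=\widehat\varphi(-k)$. The dual group of $\mathbb{R}^d$ is identified with $\mathbb{R}^d$ via the characters $x\mapsto e^{2\pi\mathrm{i}kx}$. $\Lambda\subseteq\mathbb{R}^d$ is uniformly discrete if there is an open neighbourhood $U$ of $0$ with $(x+U)\cap(y+U)=\varnothing$ for distinct $x,y\in\Lambda$. $S$ is weakly uniformly discrete if for each compact $K$, $\operatorname{card}(S\cap(x+K))$ is bounded, over all $x$, by a constant depending only on $K$. A measure $\mu$ is translation bounded if $\sup_x|\mu|(x+E)<\infty$ for every compact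 $E$. $\mu$ is Fourier transformable as a measure if there is a measure $\widehat\mu$ on $\mathbb{R}^d$ such that, for all $g\in\mathrm{span}_{\mathbb{C}}\{f_1*f_2:f_1,f_2\in C_{\mathsf c}(\mathbb{R}^d)\}$, one has $\check g\in L^1(|\widehat\mu|)$ and $\langle\mu,g\rangle=\langle\widehat\mu,\check g\rangle$. *)

theory Defs
  imports "HOL-Analysis.Analysis"
begin

section \<open>Discrete point sets\<close>

text \<open>Uniform discreteness is the library notion \<^const>\<open>uniform_discrete\<close>; the following lemma
  identifies it with the usual formulation by translates of a neighbourhood of the origin.\<close>

lemma uniform_discrete_iff_disjoint_translates:
  fixes \<Lambda> :: "'a::euclidean_space set"
  shows "uniform_discrete \<Lambda> \<longleftrightarrow>
    (\<exists>U. open U \<and> 0 \<in> U \<and>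
      (\<forall>x\<in>\<Lambda>. \<forall>y\<in>\<Lambda>. x \<noteq> y \<longrightarrow> (+) x ` U \<inter> (+) y ` U = {}))"
proof
  assume "uniform_discrete \<Lambda>"
  then obtain e where e: "e > 0" "\<And>x y. x \<in> \<Lambda> \<Longrightarrow> y \<in> \<Lambda> \<Longrightarrow> dist x y < e \<Longrightarrow> x = y"
    unfolding uniform_discrete_def by blast
  have "(+) x ` ball 0 (e/2) \<inter> (+) y ` ball 0 (e/2) = {}"
    if "x \<in> \<Lambda>" "y \<in> \<Lambda>" "x \<noteq> y" for x y
  proof -
    have "ball x (e/2) \<inter> ball y (e/2) = {}"
    proof (rule ccontr)
      assume "ball x (e/2) \<inter> ball y (e/2) \<noteq> {}"
      then obtain z where "dist x z < e/2" "dist y z < e/2" by auto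
      then have "dist x y < e" by (rule dist_triangle_half_l)
      with e that show False by blast
    qed
    then show ?thesis by simp
  qed
  moreover have "open (ball (0::'a) (e/2))" "(0::'a) \<in> ball 0 (e/2)" using e by auto
  ultimately show "\<exists>U. open U \<and> 0 \<in> U \<and>
      (\<forall>x\<in>\<Lambda>. \<forall>y\<in>\<Lambda>. x \<noteq> y \<longrightarrow> (+) x ` U \<inter> (+) y ` U = {})" by blast
next
  assume "\<exists>U. open U \<and> 0 \<in> U \<and>
      (\<forall>x\<in>\<Lambda>. \<forall>y\<in>\<Lambda>. x \<noteq> y \<longrightarrow> (+) x ` U \<inter> (+) y ` U = {})"
  then obtain U where U: "open U" "0 \<in> U"
    and disj: "\<And>x y. x \<in> \<Lambda> \<Longrightarrow> y \<in> \<Lambda> \<Longrightarrow> x \<noteq> y \<Longrightarrow> (+) x ` U \<inter> (+) y ` U = {}"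
    by blast
  obtain e where e: "e > 0" "ball 0 e \<subseteq> U" using U openE by blast
  have "x = y" if "x \<in> \<Lambda>" "y \<in> \<Lambda>" "dist x y < e" for x y
  proof (rule ccontr)
    assume "x \<noteq> y"
    have "y - x \<in> U" using e that by (auto simp: dist_norm norm_minus_commute)
    then have "y \<in> (+) x ` U" by (auto simp: image_iff intro!: bexI[of _ "y - x"])
    moreover have "y \<in> (+) y ` U" using U by (auto simp: image_iff intro!: bexI[of _ 0])
    ultimately show False using disj[OF that(1,2) \<open>x \<noteq> y\<close>] by blast
  qed
  with e(1) show "uniform_discrete \<Lambda>" unfolding uniform_discrete_def by blast
qed

definition weakly_uniformly_discrete :: "'a::euclidean_space set \<Rightarrow> bool" where
  "weakly_uniformly_discrete S \<longleftrightarrow>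
    (\<forall>K. compact K \<longrightarrow> (\<exists>n. \<forall>x. finite (S \<inter> (+) x ` K) \<and> card (S \<inter> (+) x ` K) \<le> n))"


section \<open>Complex Radon measures\<close>

definition tsupport :: "('a::topological_space \<Rightarrow> complex) \<Rightarrow> 'a set" where
  "tsupport f = closure {x. f x \<noteq> 0}"

definition Cc :: "('a::topological_space \<Rightarrow> complex) set" where
  "Cc = {f. continuous_on UNIV f \<and> compact (tsupport f)}"

text \<open>A complex Radon measure is a linear functional on \<^const>\<open>Cc\<close> that is continuous for the
  inductive limit topology. It is represented by a function on all of \<open>'a \<Rightarrow> complex\<close>, only whose
  values on \<^const>\<open>Cc\<close> are meaningful.\<close>

type_synonym 'a functional = "('a \<Rightarrow> complex) \<Rightarrow> complex"

definition radon_measure :: "'a::euclidean_space functional \<Rightarrow> bool" where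
  "radon_measure \<mu> \<longleftrightarrow>
    (\<forall>f\<in>Cc. \<forall>g\<in>Cc. \<mu> (\<lambda>x. f x + g x) = \<mu> f + \<mu> g) \<and>
    (\<forall>f\<in>Cc. \<forall>c. \<mu> (\<lambda>x. c * f x) = c * \<mu> f) \<and>
    (\<forall>K. compact K \<longrightarrow>
      (\<exists>C. \<forall>f\<in>Cc. tsupport f \<subseteq> K \<longrightarrow> norm (\<mu> f) \<le> C * (SUP x. norm (f x))))"

text \<open>The total variation \<open>\<bar>\<mu>\<bar>\<close> as a (positive, outer regular) Borel measure, given by the
  Riesz construction: first on open sets, then on Borel sets by outer regularity. For a Radon
  measure \<open>\<mu>\<close> the set function is countably additive on the Borel sets, so
  \<^const>\<open>measure_of\<close> does not degenerate.\<close>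

definition variation_open :: "'a::euclidean_space functional \<Rightarrow> 'a set \<Rightarrow> ennreal" where
  "variation_open \<mu> U =
    (SUP f\<in>{f \<in> Cc. tsupport f \<subseteq> U \<and> (\<forall>x. norm (f x) \<le> 1)}. ennreal (norm (\<mu> f)))"

definition variation :: "'a::euclidean_space functional \<Rightarrow> 'a measure" where
  "variation \<mu> =
    measure_of UNIV (sets borel) (\<lambda>A. INF U\<in>{U. open U \<and> A \<subseteq> U}. variation_open \<mu> U)"

definition translation_bounded :: "'a::euclidean_space functional \<Rightarrow> bool" where
  "translation_bounded \<mu> \<longleftrightarrow>
    (\<forall>E. compact E \<longrightarrow> (SUP x. emeasure (variation \<mu>) ((+) x ` E)) < \<infinity>)"

text \<open>\<open>\<langle>\<mu>, g\<rangle> = I\<close> for \<open>g \<in> L\<^sup>1(\<bar>\<mu>\<bar>)\<close>: since \<open>\<bar>\<mu> f\<bar> \<le> \<integral>\<bar>f\<bar> d\<bar>\<mu>\<bar>\<close> and \<^const>\<open>Cc\<close> is dense in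
  \<open>L\<^sup>1(\<bar>\<mu>\<bar>)\<close>, the functional extends uniquely by continuity.\<close>

definition has_radon_integral ::
    "'a::euclidean_space functional \<Rightarrow> ('a \<Rightarrow> complex) \<Rightarrow> complex \<Rightarrow> bool" where
  "has_radon_integral \<mu> g I \<longleftrightarrow>
    integrable (variation \<mu>) g \<and>
    (\<exists>f. (\<forall>n::nat. f n \<in> Cc) \<and>
      (\<lambda>n. \<integral>\<^sup>+x. ennreal (norm (g x - f n x)) \<partial>variation \<mu>) \<longlonglongrightarrow> 0 \<and>
      (\<lambda>n. \<mu> (f n)) \<longlonglongrightarrow> I)"


section \<open>Fourier transform of functions and of measures\<close>

definition fourier :: "('a::euclidean_space \<Rightarrow> complex) \<Rightarrow> 'a \<Rightarrow> complex" where
  "fourier f k = (\<integral>x. exp (- 2 * of_real pi * \<i> * of_real (k \<bullet> x)) * f x \<partial>lborel)"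

definition inv_fourier :: "('a::euclidean_space \<Rightarrow> complex) \<Rightarrow> 'a \<Rightarrow> complex" where
  "inv_fourier f k = fourier f (- k)"

definition convolve ::
    "('a::euclidean_space \<Rightarrow> complex) \<Rightarrow> ('a \<Rightarrow> complex) \<Rightarrow> 'a \<Rightarrow> complex" where
  "convolve f g x = (\<integral>y. f y * g (x - y) \<partial>lborel)"

text \<open>The complex linear span of all \<open>f * g\<close> with \<open>f, g \<in> C\<^sub>c\<close>.\<close>

definition K2 :: "('a::euclidean_space \<Rightarrow> complex) set" where
  "K2 = {(\<lambda>x. \<Sum>i<n. c i * convolve (f i) (g i) x) | (n::nat) c f g.
          \<forall>i<n. f i \<in> Cc \<and> g i \<in> Cc}"

definition has_measure_fourier :: "'a::euclidean_space functional \<Rightarrow> 'a functional \<Rightarrow> bool" where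
  "has_measure_fourier \<mu> \<nu> \<longleftrightarrow>
    radon_measure \<mu> \<and> radon_measure \<nu> \<and>
    (\<forall>g\<in>K2. integrable (variation \<nu>) (inv_fourier g) \<and>
      has_radon_integral \<nu> (inv_fourier g) (\<mu> g))"

definition fourier_transformable :: "'a::euclidean_space functional \<Rightarrow> bool" where
  "fourier_transformable \<mu> \<longleftrightarrow> (\<exists>\<nu>. has_measure_fourier \<mu> \<nu>)"


section \<open>Tempered distributions\<close>

definition dir_deriv :: "'a::euclidean_space \<Rightarrow> ('a \<Rightarrow> complex) \<Rightarrow> 'a \<Rightarrow> complex" where
  "dir_deriv v f x = frechet_derivative f (at x) v"

text \<open>Multi-indices are lists of standard basis vectors. Tempered distributions are again functionals
  on all of \<open>'a \<Rightarrow> complex\<close>, of which only the values on Schwartz functions are meaningful.\<close>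

definition iter_deriv :: "'a::euclidean_space list \<Rightarrow> ('a \<Rightarrow> complex) \<Rightarrow> 'a \<Rightarrow> complex" where
  "iter_deriv vs f = foldr dir_deriv vs f"

definition smooth :: "('a::euclidean_space \<Rightarrow> complex) \<Rightarrow> bool" where
  "smooth f \<longleftrightarrow> (\<forall>vs. set vs \<subseteq> Basis \<longrightarrow> iter_deriv vs f differentiable_on UNIV)"

definition schwartz :: "('a::euclidean_space \<Rightarrow> complex) set" where
  "schwartz = {f. smooth f \<and>
    (\<forall>k vs. set vs \<subseteq> Basis \<longrightarrow> bounded (range (\<lambda>x. norm x ^ k * norm (iter_deriv vs f x))))}"

definition schwartz_seminorm :: "nat \<Rightarrow> 'a::euclidean_space list \<Rightarrow> ('a \<Rightarrow> complex) \<Rightarrow> real" where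
  "schwartz_seminorm k vs f = (SUP x. norm x ^ k * norm (iter_deriv vs f x))"

definition tempered_distribution :: "'a::euclidean_space functional \<Rightarrow> bool" where
  "tempered_distribution T \<longleftrightarrow>
    (\<forall>f\<in>schwartz. \<forall>g\<in>schwartz. T (\<lambda>x. f x + g x) = T f + T g) \<and>
    (\<forall>f\<in>schwartz. \<forall>c. T (\<lambda>x. c * f x) = c * T f) \<and>
    (\<exists>C N. \<forall>f\<in>schwartz. norm (T f) \<le>
      C * (\<Sum>k\<le>N. \<Sum>vs\<in>{vs. set vs \<subseteq> Basis \<and> length vs \<le> N}. schwartz_seminorm k vs f))"

text \<open>A measure \<open>\<mu>\<close> belongs to \<open>\<S>'\<close> if the distribution \<open>\<phi> \<mapsto> \<mu> \<phi>\<close> on \<open>C\<^sub>c\<^sup>\<infinity>\<close> extends to a tempered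
  distribution \<open>T\<close>, which is then unique. No absolute convergence of \<open>\<integral>\<phi> d\<mu>\<close> for Schwartz functions
  \<open>\<phi>\<close> is required.\<close>

definition tempered_extension :: "'a::euclidean_space functional \<Rightarrow> 'a functional \<Rightarrow> bool" where
  "tempered_extension \<mu> T \<longleftrightarrow>
    tempered_distribution T \<and> (\<forall>\<phi>\<in>Cc. smooth \<phi> \<longrightarrow> T \<phi> = \<mu> \<phi>)"

definition has_distr_fourier :: "'a::euclidean_space functional \<Rightarrow> 'a functional \<Rightarrow> bool" where
  "has_distr_fourier T U \<longleftrightarrow>
    tempered_distribution T \<and> tempered_distribution U \<and>
    (\<forall>\<phi>\<in>schwartz. U \<phi> = T (fourier \<phi>))"

end

theory Submission
  imports Defs "HOL-Probability.Sinc_Integral" "HOL-Probability.Characteristic_Functions"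
begin

text \<open>
  The heart of the matter is that the coefficients are bounded. Averaging \<open>\<mu>\<close> against a dilated window
  \<open>\<chi>(x/T)\<close> turns the identity \<open>\<nu> = \<mu>\<close>-hat into the statement that a trigonometric sum with
  frequencies in \<open>\<Lambda>\<close> equals \<open>T\<^sup>d \<Sum> b(y) \<omega>(T(y - k))\<close>, a sum of bumps of width \<open>1/T\<close> around the points
  of \<open>S\<close>. Since \<open>\<Lambda>\<close> is uniformly discrete, Schur's test shows that the energies of such a sum in
  sufficiently large windows are comparable, with constants that do not depend on the position of
  the window. The energy near the origin involves only the finitely many points of \<open>S\<close> there, hence it
  is \<open>O(T\<^sup>d)\<close>, and so is the energy near any other \<open>y \<in> S\<close>; letting \<open>T \<rightarrow> \<infinity>\<close> isolates \<open>b(y)\<close> and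
  bounds it independently of \<open>y\<close>. Testing with Gaussians concentrated at a point of \<open>\<Lambda>\<close> then bounds
  \<open>a\<close>. With bounded coefficients both sums converge absolutely on Schwartz functions. For \<open>g\<close> in the
  span of \<open>C\<^sub>c * C\<^sub>c\<close>, the inverse transform is absolutely summable over \<open>S\<close> by a dual form of the
  same Schur estimate, and the identity for \<open>g\<close> is the limit of the identities for its Gaussian
  mollifications.
\<close>


section \<open>Smooth functions\<close>

text \<open>The obstacle is that \<open>S\<close> is only weakly uniformly discrete. Its points may
  lie arbitrarily close together, so no test function of fixed width isolates a single
  \<open>b y\<close>, and cancellation inside a cluster could hide large coefficients. This forces
  an asymmetric treatment. On \<Lambda> a bump of fixed width isolates each point, and this alone
  gives polynomial growth of \<open>a\<close> and absolute convergence over \<Lambda>. On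
  \<open>S\<close> only test functions of compact support are allowed until \<open>b\<close> is
  bounded, so that all sums there are finite; their transforms are Schwartz functions, which is what
  the side of \<Lambda> can handle. The comparison of energies is stated for arbitrary coefficients
  because those of the trigonometric sum change with the width of the bump, and that width has to be
  adapted to each point of \<open>S\<close>. At the end, a function in \<open>K2\<close> is merely
  continuous and its inverse transform need not decrease rapidly. A Gaussian factor on one side,
  which is a convolution on the other, cures both defects. The transform of \<nu> as a measure is
  the reflection of \<mu>.\<close>

text \<open>Smooth, slowly increasing and Schwartz functions are all instances of this, so that products are
  treated once and for all, without an explicit Leibniz formula.\<close>

definition smooth_with :: "(('a::euclidean_space \<Rightarrow> complex) \<Rightarrow> bool) \<Rightarrow> ('a \<Rightarrow> complex) set" where
  "smooth_with P = {f. \<forall>vs. set vs \<subseteq> Basis \<longrightarrow> iter_deriv vs f differentiable_on UNIV \<and> P (iter_deriv vs f)}"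

lemma iter_deriv_simps [simp]:
  "iter_deriv [] f = f"
  "iter_deriv (v # vs) f = dir_deriv v (iter_deriv vs f)"
  "iter_deriv (us @ vs) f = iter_deriv us (iter_deriv vs f)"
  by (simp_all add: iter_deriv_def)

text \<open>It suffices to exhibit a family that contains \<open>f\<close> and is closed under first
  derivatives. Characters, Gaussians, bumps and Fourier transforms are all treated in this
  way.\<close>

lemma smooth_with_coinduct:
  assumes "f \<in> F"
    and step: "\<And>f. f \<in> F \<Longrightarrow> f differentiable_on UNIV \<and> P f"
      "\<And>f v. f \<in> F \<Longrightarrow> v \<in> Basis \<Longrightarrow> dir_deriv v f \<in> F"
  shows "f \<in> smooth_with P"
proof -
  have "set vs \<subseteq> Basis \<Longrightarrow> iter_deriv vs f \<in> F" for vs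
    by (induction vs) (auto simp: assms)
  with step(1) show ?thesis by (auto simp: smooth_with_def)
qed

lemma smooth_withD:
  assumes "f \<in> smooth_with P"
  shows "f differentiable_on UNIV" "f differentiable at x" "continuous_on UNIV f" "P f"
    "f \<in> borel_measurable borel"
proof -
  from assms show *: "f differentiable_on UNIV" "P f"
    by (auto simp: smooth_with_def dest: spec[of _ "[]"])
  then show "f differentiable at x" by (simp add: differentiable_on_def)
  from * show "continuous_on UNIV f" by (simp add: differentiable_imp_continuous_on)
  then show "f \<in> borel_measurable borel" by (rule borel_measurable_continuous_onI)
qed

lemma smooth_with_iter_deriv:
  assumes "f \<in> smooth_with P" "set vs \<subseteq> Basis" shows "iter_deriv vs f \<in> smooth_with P"
  unfolding smooth_with_def
proof (intro CollectI allI impI)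
  fix us assume "set us \<subseteq> (Basis :: 'a set)"
  then show "iter_deriv us (iter_deriv vs f) differentiable_on UNIV \<and> P (iter_deriv us (iter_deriv vs f))"
    using assms unfolding smooth_with_def by (auto dest!: spec[of _ "us @ vs"])
qed

lemma smooth_with_dir_deriv:
  "f \<in> smooth_with P \<Longrightarrow> v \<in> Basis \<Longrightarrow> dir_deriv v f \<in> smooth_with P"
  using smooth_with_iter_deriv[of f P "[v]"] by simp

lemma smooth_with_mono: "f \<in> smooth_with P \<Longrightarrow> (\<And>g. P g \<Longrightarrow> Q g) \<Longrightarrow> f \<in> smooth_with Q"
  by (auto simp: smooth_with_def)

lemma has_derivative_imp_dir_deriv:
  "(f has_derivative f') (at x) \<Longrightarrow> dir_deriv v f x = f' v"
  unfolding dir_deriv_def by (metis frechet_derivative_at)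

lemma dir_deriv_works:
  "f differentiable at x \<Longrightarrow> (f has_derivative (\<lambda>v. dir_deriv v f x)) (at x)"
  unfolding dir_deriv_def by (simp add: frechet_derivative_works)

lemma dir_deriv_add:
  assumes "f differentiable_on UNIV" "g differentiable_on UNIV"
  shows "dir_deriv v (\<lambda>x. f x + g x) = (\<lambda>x. dir_deriv v f x + dir_deriv v g x)"
  using assms
  by (intro ext has_derivative_imp_dir_deriv has_derivative_add dir_deriv_works)
    (auto simp: differentiable_on_def)

lemma dir_deriv_mult:
  fixes f g :: "'a::euclidean_space \<Rightarrow> complex"
  assumes "f differentiable_on UNIV" "g differentiable_on UNIV"
  shows "dir_deriv v (\<lambda>x. f x * g x) = (\<lambda>x. f x * dir_deriv v g x + dir_deriv v f x * g x)"
  using assms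
  by (intro ext has_derivative_imp_dir_deriv has_derivative_mult dir_deriv_works)
    (auto simp: differentiable_on_def)

lemma dir_deriv_affine:
  fixes f :: "'a::euclidean_space \<Rightarrow> complex"
  assumes "f differentiable_on UNIV"
  shows "dir_deriv v (\<lambda>x. f (c *\<^sub>R x + t)) = (\<lambda>x. of_real c * dir_deriv v f (c *\<^sub>R x + t))"
proof
  fix x
  have "(f has_derivative (\<lambda>v. dir_deriv v f (c *\<^sub>R x + t))) (at (c *\<^sub>R x + t))"
    using assms by (intro dir_deriv_works) (auto simp: differentiable_on_def)
  then have "((f \<circ> (\<lambda>x. c *\<^sub>R x + t)) has_derivative
     (\<lambda>v. dir_deriv v f (c *\<^sub>R x + t)) \<circ> (\<lambda>v. c *\<^sub>R v)) (at x)"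
    by (intro diff_chain_at) (auto intro!: derivative_eq_intros)
  then have "dir_deriv v (\<lambda>x. f (c *\<^sub>R x + t)) x = dir_deriv (c *\<^sub>R v) f (c *\<^sub>R x + t)"
    by (subst has_derivative_imp_dir_deriv) (auto simp: o_def)
  also have "\<dots> = of_real c * dir_deriv v f (c *\<^sub>R x + t)"
  proof -
    have "linear (\<lambda>v. dir_deriv v f (c *\<^sub>R x + t))"
      by (rule has_derivative_linear) fact
    from linear_scale[OF this] show ?thesis by (simp add: scaleR_conv_of_real)
  qed
  finally show "dir_deriv v (\<lambda>x. f (c *\<^sub>R x + t)) x = of_real c * dir_deriv v f (c *\<^sub>R x + t)" .
qed

text \<open>The product rule turns a product into a sum of two products, so sums of products are the
  family to feed into \<open>smooth_with_coinduct\<close>.\<close>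

inductive_set prod_span :: "('a \<Rightarrow> complex) set \<Rightarrow> ('a \<Rightarrow> complex) set \<Rightarrow> ('a \<Rightarrow> complex) set"
  for A B where
  prod: "f \<in> A \<Longrightarrow> g \<in> B \<Longrightarrow> (\<lambda>x. f x * g x) \<in> prod_span A B"
| add: "f \<in> prod_span A B \<Longrightarrow> g \<in> prod_span A B \<Longrightarrow> (\<lambda>x. f x + g x) \<in> prod_span A B"

lemma smooth_with_mult:
  assumes f: "f \<in> smooth_with P" and g: "g \<in> smooth_with Q"
    and prod: "\<And>f g. P f \<Longrightarrow> Q g \<Longrightarrow> R (\<lambda>x. f x * g x)"
    and add: "\<And>f g. R f \<Longrightarrow> R g \<Longrightarrow> R (\<lambda>x. f x + g x)"
  shows "(\<lambda>x. f x * g x) \<in> smooth_with R"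
proof (rule smooth_with_coinduct)
  show "(\<lambda>x. f x * g x) \<in> prod_span (smooth_with P) (smooth_with Q)" using f g by (rule prod_span.prod)
next
  fix h assume "h \<in> prod_span (smooth_with P) (smooth_with Q)"
  then show "h differentiable_on UNIV \<and> R h"
    by induction (auto intro!: prod add differentiable_on_mult dest: smooth_withD)
next
  fix h and v :: 'a assume "h \<in> prod_span (smooth_with P) (smooth_with Q)" and v: "v \<in> Basis"
  \<comment> \<open>Differentiability is carried through the induction because the sum rule
    \<open>dir_deriv_add\<close> asks for it on both summands.\<close>
  then have "h differentiable_on UNIV \<and> dir_deriv v h \<in> prod_span (smooth_with P) (smooth_with Q)"
  proof induction
    case (prod f g)
    then show ?case
      using v by (auto simp: dir_deriv_mult smooth_withD(1) intro!: prod_span.intros smooth_with_dir_deriv)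
  next
    case (add f g)
    then show ?case by (auto simp: dir_deriv_add intro!: prod_span.add)
  qed
  then show "dir_deriv v h \<in> prod_span (smooth_with P) (smooth_with Q)" by simp
qed

lemma iter_deriv_add:
  assumes "f \<in> smooth_with P" "g \<in> smooth_with Q" "set vs \<subseteq> Basis"
  shows "iter_deriv vs (\<lambda>x. f x + g x) = (\<lambda>x. iter_deriv vs f x + iter_deriv vs g x)"
  using assms(3)
proof (induction vs)
  case (Cons v vs)
  then have "iter_deriv vs f \<in> smooth_with P" "iter_deriv vs g \<in> smooth_with Q" using assms by (auto intro: smooth_with_iter_deriv)
  with Cons show ?case by (auto simp: dir_deriv_add smooth_withD)
qed simp

lemma iter_deriv_affine:
  assumes "f \<in> smooth_with P" "set vs \<subseteq> Basis"
  shows "iter_deriv vs (\<lambda>x. f (c *\<^sub>R x + t)) = (\<lambda>x. of_real c ^ length vs * iter_deriv vs f (c *\<^sub>R x + t))"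
  using assms(2)
proof (induction vs)
  case (Cons v vs)
  then have *: "iter_deriv vs f \<in> smooth_with P" using assms by (auto intro: smooth_with_iter_deriv)
  then have "iter_deriv vs f differentiable_on UNIV" by (rule smooth_withD)
  moreover have "(\<lambda>x. iter_deriv vs f (c *\<^sub>R x + t)) differentiable_on UNIV"
    by (rule differentiable_on_compose[of "\<lambda>x. c *\<^sub>R x + t" UNIV "iter_deriv vs f", unfolded o_def])
      (use calculation in \<open>auto intro: differentiable_on_subset intro!: derivative_intros\<close>)
  moreover have "dir_deriv v (\<lambda>x. of_real c ^ length vs) = (\<lambda>x::'a. 0 :: complex)"
    by (intro ext has_derivative_imp_dir_deriv) (auto intro!: derivative_eq_intros)
  ultimately show ?case
    using Cons by (simp add: dir_deriv_affine dir_deriv_mult mult.assoc mult.left_commute)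
qed simp

lemma smooth_with_add:
  assumes f: "f \<in> smooth_with P" and g: "g \<in> smooth_with P"
    and add: "\<And>f g. P f \<Longrightarrow> P g \<Longrightarrow> P (\<lambda>x. f x + g x)"
  shows "(\<lambda>x. f x + g x) \<in> smooth_with P"
  unfolding smooth_with_def
proof (intro CollectI allI impI)
  fix vs :: "'a list" assume "set vs \<subseteq> Basis"
  then have "iter_deriv vs f \<in> smooth_with P" "iter_deriv vs g \<in> smooth_with P" using assms by (auto intro: smooth_with_iter_deriv)
  then show "iter_deriv vs (\<lambda>x. f x + g x) differentiable_on UNIV \<and> P (iter_deriv vs (\<lambda>x. f x + g x))"
    by (simp add: iter_deriv_add[OF f g \<open>set vs \<subseteq> Basis\<close>] smooth_withD add differentiable_on_add)
qed

lemma smooth_with_const: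
  assumes "P (\<lambda>x. c)" "P (\<lambda>x. 0)" shows "(\<lambda>x. c) \<in> smooth_with P"
proof (rule smooth_with_coinduct[of _ "{\<lambda>x. c, \<lambda>x. 0}"])
  fix f :: "'a \<Rightarrow> complex" and v :: 'a assume "f \<in> {\<lambda>x. c, \<lambda>x. 0}"
  then have "dir_deriv v f = (\<lambda>x. 0)"
    by (intro ext has_derivative_imp_dir_deriv) (auto intro!: derivative_eq_intros)
  then show "dir_deriv v f \<in> {\<lambda>x. c, \<lambda>x. 0}" by simp
qed (use assms in auto)

text \<open>The scalar \<open>a\<close> in the closure hypothesis absorbs the powers of
  \<open>c\<close> that the chain rule produces.\<close>

lemma smooth_with_affine:
  assumes f: "f \<in> smooth_with P"
    and P: "\<And>f a. P f \<Longrightarrow> P (\<lambda>x. a * f (c *\<^sub>R x + t))"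
  shows "(\<lambda>x. f (c *\<^sub>R x + t)) \<in> smooth_with P"
  unfolding smooth_with_def
proof (intro CollectI allI impI)
  fix vs :: "'a list" assume vs: "set vs \<subseteq> Basis"
  have *: "iter_deriv vs f \<in> smooth_with P" using assms vs by (auto intro: smooth_with_iter_deriv)
  then have "(\<lambda>x. iter_deriv vs f (c *\<^sub>R x + t)) differentiable_on UNIV"
    by (intro differentiable_on_compose[of "\<lambda>x. c *\<^sub>R x + t" UNIV "iter_deriv vs f", unfolded o_def])
      (auto intro: differentiable_on_subset[OF smooth_withD(1)] intro!: derivative_intros)
  with * show "iter_deriv vs (\<lambda>x. f (c *\<^sub>R x + t)) differentiable_on UNIV
      \<and> P (iter_deriv vs (\<lambda>x. f (c *\<^sub>R x + t)))"
    by (simp add: iter_deriv_affine[OF f vs] smooth_withD P)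
qed


section \<open>Slowly increasing functions, Schwartz functions and test functions\<close>

text \<open>The base \<open>1 + norm x\<close> is never below 1, so bounds with different exponents
  can be compared and multiplied; \<open>rapid_iff_bounded\<close> leads back to the powers of
  \<open>norm x\<close> in \<open>schwartz\<close>.\<close>

definition rapid :: "('a::euclidean_space \<Rightarrow> complex) \<Rightarrow> bool" where
  "rapid f \<longleftrightarrow> (\<forall>k. \<exists>C. \<forall>x. (1 + norm x) ^ k * norm (f x) \<le> C)"

definition poly_growth :: "('a::euclidean_space \<Rightarrow> complex) \<Rightarrow> bool" where
  "poly_growth f \<longleftrightarrow> (\<exists>k C. \<forall>x. norm (f x) \<le> C * (1 + norm x) ^ k)"

text \<open>These are the multipliers of the Schwartz space, often written O_M.\<close>

abbreviation slow :: "('a::euclidean_space \<Rightarrow> complex) set" where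
  "slow \<equiv> smooth_with poly_growth"

lemma smooth_eq: "smooth f \<longleftrightarrow> f \<in> smooth_with (\<lambda>_. True)"
  by (simp add: smooth_def smooth_with_def)

lemma rapid_iff_bounded:
  "rapid f \<longleftrightarrow> (\<forall>k. bounded (range (\<lambda>x. norm x ^ k * norm (f x))))"
proof
  assume r: "rapid f"
  show "\<forall>k. bounded (range (\<lambda>x. norm x ^ k * norm (f x)))"
  proof
    fix k
    obtain C where C: "\<And>x. (1 + norm x) ^ k * norm (f x) \<le> C" using r by (auto simp: rapid_def)
    have "norm (norm x ^ k * norm (f x)) \<le> C" for x
    proof -
      have "norm x ^ k * norm (f x) \<le> (1 + norm x) ^ k * norm (f x)"
        by (intro mult_right_mono power_mono) auto
      with C[of x] show ?thesis by (simp add: abs_mult)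
    qed
    then show "bounded (range (\<lambda>x. norm x ^ k * norm (f x)))" by (auto simp: bounded_iff)
  qed
next
  assume b: "\<forall>k. bounded (range (\<lambda>x. norm x ^ k * norm (f x)))"
  show "rapid f" unfolding rapid_def
  proof
    fix k
    from b[rule_format, of k] obtain C where C: "\<And>x. norm x ^ k * norm (f x) \<le> C"
      by (auto simp: bounded_iff abs_mult)
    from b[rule_format, of 0] obtain D where D: "\<And>x. norm (f x) \<le> D"
      by (auto simp: bounded_iff)
    have "(1 + norm x) ^ k * norm (f x) \<le> 2 ^ k * (C + D)" for x
    proof -
      have "(1 + norm x) ^ k \<le> (2 * max 1 (norm x)) ^ k" by (intro power_mono) auto
      also have "\<dots> \<le> 2 ^ k * (1 + norm x ^ k)"
        by (auto simp: power_mult_distrib max_def)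
      finally have "(1 + norm x) ^ k * norm (f x) \<le> 2 ^ k * (1 + norm x ^ k) * norm (f x)"
        by (rule mult_right_mono) auto
      also have "\<dots> = 2 ^ k * (norm x ^ k * norm (f x) + norm (f x))" by (simp add: algebra_simps)
      also have "\<dots> \<le> 2 ^ k * (C + D)" using C D by (intro mult_left_mono add_mono) auto
      finally show ?thesis .
    qed
    then show "\<exists>C. \<forall>x. (1 + norm x) ^ k * norm (f x) \<le> C" by blast
  qed
qed

lemma schwartz_eq: "schwartz = smooth_with rapid"
  unfolding schwartz_def smooth_def smooth_with_def rapid_iff_bounded by blast

lemma rapidD: "rapid f \<Longrightarrow> \<exists>C\<ge>0. \<forall>x. (1 + norm x) ^ k * norm (f x) \<le> C"
proof -
  assume "rapid f"
  then obtain C where *: "\<And>x. (1 + norm x) ^ k * norm (f x) \<le> C" by (auto simp: rapid_def)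
  from *[of 0] have "C \<ge> 0" by (simp add: order_trans[OF norm_ge_zero])
  with * show ?thesis by blast
qed

lemma poly_growthD: "poly_growth f \<Longrightarrow> \<exists>k C. C \<ge> 0 \<and> (\<forall>x. norm (f x) \<le> C * (1 + norm x) ^ k)"
proof -
  assume "poly_growth f"
  then obtain k C where *: "\<And>x. norm (f x) \<le> C * (1 + norm x) ^ k" by (auto simp: poly_growth_def)
  from *[of 0] have "C \<ge> 0" by (simp add: order_trans[OF norm_ge_zero])
  with * show ?thesis by blast
qed

lemma rapid_add: "rapid f \<Longrightarrow> rapid g \<Longrightarrow> rapid (\<lambda>x. f x + g x)"
  unfolding rapid_def
proof
  fix k assume "\<forall>k. \<exists>C. \<forall>x. (1 + norm x) ^ k * norm (f x) \<le> C" "\<forall>k. \<exists>C. \<forall>x. (1 + norm x) ^ k * norm (g x) \<le> C"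
  then obtain C D where C: "\<And>x. (1 + norm x) ^ k * norm (f x) \<le> C" and D: "\<And>x. (1 + norm x) ^ k * norm (g x) \<le> D"
    by meson
  have "(1 + norm x) ^ k * norm (f x + g x) \<le> C + D" for x
  proof -
    have "(1 + norm x) ^ k * norm (f x + g x) \<le> (1 + norm x) ^ k * (norm (f x) + norm (g x))"
      by (intro mult_left_mono norm_triangle_ineq) auto
    with C[of x] D[of x] show ?thesis by (simp add: distrib_left)
  qed
  then show "\<exists>C. \<forall>x. (1 + norm x) ^ k * norm (f x + g x) \<le> C" by blast
qed

lemma poly_growth_mult_rapid:
  assumes "poly_growth f" "rapid g" shows "rapid (\<lambda>x. f x * g x)"
  unfolding rapid_def
proof
  fix k
  obtain l C where C: "C \<ge> 0" "\<And>x. norm (f x) \<le> C * (1 + norm x) ^ l" using poly_growthD[OF assms(1)] by blast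
  obtain D where D: "\<And>x. (1 + norm x) ^ (k + l) * norm (g x) \<le> D" using rapidD[OF assms(2)] by blast
  have "(1 + norm x) ^ k * norm (f x * g x) \<le> C * D" for x
  proof -
    have "(1 + norm x) ^ k * norm (f x * g x) \<le> (1 + norm x) ^ k * (C * (1 + norm x) ^ l * norm (g x))"
      unfolding norm_mult using C by (intro mult_left_mono mult_right_mono) auto
    also have "\<dots> = C * ((1 + norm x) ^ (k + l) * norm (g x))" by (simp add: power_add)
    also have "\<dots> \<le> C * D" using C D by (intro mult_left_mono) auto
    finally show ?thesis .
  qed
  then show "\<exists>C. \<forall>x. (1 + norm x) ^ k * norm (f x * g x) \<le> C" by blast
qed

lemma poly_growth_add: "poly_growth f \<Longrightarrow> poly_growth g \<Longrightarrow> poly_growth (\<lambda>x. f x + g x)"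
proof -
  assume "poly_growth f" "poly_growth g"
  then obtain k C l D where C: "C \<ge> 0" "\<And>x. norm (f x) \<le> C * (1 + norm x) ^ k"
    and D: "D \<ge> 0" "\<And>x. norm (g x) \<le> D * (1 + norm x) ^ l" by (meson poly_growthD)
  have "norm (f x + g x) \<le> (C + D) * (1 + norm x) ^ (max k l)" for x
  proof -
    have "norm (f x + g x) \<le> C * (1 + norm x) ^ k + D * (1 + norm x) ^ l"
      using C(2)[of x] D(2)[of x] norm_triangle_ineq[of "f x" "g x"] by linarith
    also have "\<dots> \<le> C * (1 + norm x) ^ (max k l) + D * (1 + norm x) ^ (max k l)"
      using C(1) D(1) by (intro add_mono mult_left_mono power_increasing) auto
    finally show ?thesis by (simp add: distrib_right)
  qed
  then show ?thesis unfolding poly_growth_def by blast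
qed

lemma poly_growth_mult: "poly_growth f \<Longrightarrow> poly_growth g \<Longrightarrow> poly_growth (\<lambda>x. f x * g x)"
proof -
  assume "poly_growth f" "poly_growth g"
  then obtain k C l D where C: "C \<ge> 0" "\<And>x. norm (f x) \<le> C * (1 + norm x) ^ k"
    and D: "D \<ge> 0" "\<And>x. norm (g x) \<le> D * (1 + norm x) ^ l" by (meson poly_growthD)
  have "norm (f x * g x) \<le> (C * D) * (1 + norm x) ^ (k + l)" for x
  proof -
    have "norm (f x * g x) \<le> (C * (1 + norm x) ^ k) * (D * (1 + norm x) ^ l)"
      unfolding norm_mult using C D by (intro mult_mono) auto
    then show ?thesis by (simp add: power_add mult_ac)
  qed
  then show ?thesis unfolding poly_growth_def by blast
qed

lemma poly_growth_bounded: "(\<And>x. norm (f x) \<le> C) \<Longrightarrow> poly_growth f"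
  unfolding poly_growth_def by (intro exI[of _ 0] exI[of _ C]) simp

lemma poly_growth_norm_le: "(\<And>x. norm (f x) \<le> C * norm x) \<Longrightarrow> C \<ge> 0 \<Longrightarrow> poly_growth f"
  unfolding poly_growth_def
proof (intro exI allI)
  fix x assume "\<And>x. norm (f x) \<le> C * norm x" "C \<ge> 0"
  then have "norm (f x) \<le> C * norm x" "C * norm x \<le> C * (1 + norm x)" by (auto intro: mult_left_mono)
  then show "norm (f x) \<le> C * (1 + norm x) ^ 1" by simp
qed

lemma rapid_affine:
  assumes "rapid f" "c \<noteq> 0"
  shows "rapid (\<lambda>x. a * f (c *\<^sub>R x + t))"
  unfolding rapid_def
proof
  fix k
  obtain C where C: "C \<ge> 0" "\<And>x. (1 + norm x) ^ k * norm (f x) \<le> C" using rapidD[OF assms(1)] by blast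
  \<comment> \<open>\<open>L\<close> is the constant in 1 + |x| <= L (1 + |c x + t|); the minimum
    with 1 covers both contractions and dilations.\<close>
  define L where "L = (1 + norm t) / min 1 \<bar>c\<bar>"
  have "(1 + norm x) ^ k * norm (a * f (c *\<^sub>R x + t)) \<le> norm a * (L ^ k * C)" for x
  proof -
    have "1 + norm x \<le> L * (1 + norm (c *\<^sub>R x + t))"
    proof -
      have "\<bar>c\<bar> * norm x \<le> norm (c *\<^sub>R x + t) + norm t"
        using norm_triangle_ineq4[of "c *\<^sub>R x + t" t] by simp
      then have "min 1 \<bar>c\<bar> * (1 + norm x) \<le> 1 + (norm (c *\<^sub>R x + t) + norm t)"
      proof -
        have "min 1 \<bar>c\<bar> * norm x \<le> \<bar>c\<bar> * norm x" by (intro mult_right_mono) auto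
        moreover have "min 1 \<bar>c\<bar> \<le> 1" by simp
        ultimately show ?thesis
          using \<open>\<bar>c\<bar> * norm x \<le> norm (c *\<^sub>R x + t) + norm t\<close> by (simp add: distrib_left)
      qed
      also have "\<dots> \<le> (1 + norm t) * (1 + norm (c *\<^sub>R x + t))"
        by (simp add: algebra_simps)
      finally have "min 1 \<bar>c\<bar> * (1 + norm x) \<le> (1 + norm t) * (1 + norm (c *\<^sub>R x + t))" .
      moreover have "min 1 \<bar>c\<bar> > 0" using assms(2) by simp
      ultimately show ?thesis unfolding L_def by (simp add: pos_le_divide_eq mult.commute)
    qed
    then have "(1 + norm x) ^ k \<le> (L * (1 + norm (c *\<^sub>R x + t))) ^ k" by (intro power_mono) auto
    then have "(1 + norm x) ^ k * norm (a * f (c *\<^sub>R x + t)) \<le>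
       (L * (1 + norm (c *\<^sub>R x + t))) ^ k * norm (a * f (c *\<^sub>R x + t))"
      by (rule mult_right_mono) auto
    also have "\<dots> = norm a * (L ^ k * ((1 + norm (c *\<^sub>R x + t)) ^ k * norm (f (c *\<^sub>R x + t))))"
      by (simp add: power_mult_distrib norm_mult)
    also have "\<dots> \<le> norm a * (L ^ k * C)"
      using C by (intro mult_left_mono) (auto simp: L_def)
    finally show ?thesis .
  qed
  then show "\<exists>C. \<forall>x. (1 + norm x) ^ k * norm (a * f (c *\<^sub>R x + t)) \<le> C" by blast
qed

lemma slow_const [intro]: "(\<lambda>x. c) \<in> slow"
  by (intro smooth_with_const poly_growth_bounded) auto

lemma slow_add: "f \<in> slow \<Longrightarrow> g \<in> slow \<Longrightarrow> (\<lambda>x. f x + g x) \<in> slow"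
  by (rule smooth_with_add) (auto intro: poly_growth_add)

lemma slow_mult: "f \<in> slow \<Longrightarrow> g \<in> slow \<Longrightarrow> (\<lambda>x. f x * g x) \<in> slow"
  by (rule smooth_with_mult[where P = poly_growth and Q = poly_growth]) (auto intro: poly_growth_mult poly_growth_add)

lemma slow_inner [intro]: "(\<lambda>x. of_real (x \<bullet> b)) \<in> slow"
proof (rule smooth_with_coinduct[of _ "insert (\<lambda>x. of_real (x \<bullet> b)) (range (\<lambda>c x. c))"])
  fix f :: "'a \<Rightarrow> complex" and v :: 'a
  assume *: "f \<in> insert (\<lambda>x. of_real (x \<bullet> b)) (range (\<lambda>c x. c))"
  have "((\<lambda>x. complex_of_real (x \<bullet> b)) has_derivative (\<lambda>v. of_real (v \<bullet> b))) (at x)" for x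
    by (auto intro!: derivative_eq_intros)
  then have 1: "dir_deriv v (\<lambda>x. complex_of_real (x \<bullet> b)) = (\<lambda>x. of_real (v \<bullet> b))"
    and 2: "(\<lambda>x. complex_of_real (x \<bullet> b)) differentiable_on UNIV"
    by (auto intro!: has_derivative_imp_dir_deriv simp: differentiable_on_def differentiable_def)
  have 3: "dir_deriv v (\<lambda>x. c) = (\<lambda>x::'a. 0)" for c
    by (intro ext has_derivative_imp_dir_deriv) (auto intro!: derivative_eq_intros)
  from * 1 3 show "dir_deriv v f \<in> insert (\<lambda>x. of_real (x \<bullet> b)) (range (\<lambda>c x. c))" by auto
  have "poly_growth (\<lambda>x. complex_of_real (x \<bullet> b))"
    by (rule poly_growth_norm_le[where C = "norm b"]) (auto simp: mult.commute Cauchy_Schwarz_ineq2)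
  with * 2 show "f differentiable_on UNIV \<and> poly_growth f"
    by (auto intro: poly_growth_bounded)
qed auto

section \<open>Characters\<close>

definition cis2 :: "real \<Rightarrow> complex" where "cis2 t = exp (2 * of_real pi * \<i> * of_real t)"

lemma cis2_eq: "cis2 t = cis (2 * pi * t)"
  by (simp add: cis2_def cis_conv_exp mult_ac)

lemma norm_cis2 [simp]: "norm (cis2 t) = 1"
  by (simp add: cis2_eq)

lemma cis2_add: "cis2 (s + t) = cis2 s * cis2 t" and cis2_0 [simp]: "cis2 0 = 1"
  and cnj_cis2: "cnj (cis2 s) = cis2 (- s)"
  by (simp_all add: cis2_eq cis_mult distrib_left cis_cnj)

lemma continuous_on_cis2 [continuous_intros]:
  "continuous_on A f \<Longrightarrow> continuous_on A (\<lambda>x. cis2 (f x))"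
  unfolding cis2_def by (intro continuous_intros)

lemma measurable_cis2 [measurable]: "cis2 \<in> borel_measurable borel"
  by (intro borel_measurable_continuous_onI continuous_intros)

lemma has_derivative_cis2:
  "((\<lambda>x. c * cis2 (x \<bullet> b)) has_derivative
     (\<lambda>v. c * (2 * of_real pi * \<i> * of_real (v \<bullet> b)) * cis2 (x \<bullet> b))) (at x)"
proof -
  have "((\<lambda>x. 2 * of_real pi * \<i> * complex_of_real (x \<bullet> b)) has_derivative
      (\<lambda>v. 2 * of_real pi * \<i> * of_real (v \<bullet> b))) (at x)"
    by (auto intro!: derivative_eq_intros)
  from has_derivative_mult_right[OF has_derivative_compose[OF this
      DERIV_exp[unfolded has_field_derivative_def]], of c]
  show ?thesis unfolding cis2_def by (rule has_derivative_eq_rhs) (auto simp: fun_eq_iff)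
qed

lemma slow_cis2 [intro]: "(\<lambda>x. cis2 (x \<bullet> b)) \<in> slow"
proof (rule smooth_with_coinduct[of _ "range (\<lambda>c x. c * cis2 (x \<bullet> b))"])
  fix f :: "'a \<Rightarrow> complex" and v :: 'a
  assume "f \<in> range (\<lambda>c x. c * cis2 (x \<bullet> b))"
  then obtain c where f: "f = (\<lambda>x. c * cis2 (x \<bullet> b))" by blast
  have *: "(f has_derivative (\<lambda>v. c * (2 * of_real pi * \<i> * of_real (v \<bullet> b)) * cis2 (x \<bullet> b))) (at x)" for x
    unfolding f by (rule has_derivative_cis2)
  then have "dir_deriv v f = (\<lambda>x. c * (2 * of_real pi * \<i> * of_real (v \<bullet> b)) * cis2 (x \<bullet> b))"
    by (auto intro!: has_derivative_imp_dir_deriv)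
  then show "dir_deriv v f \<in> range (\<lambda>c x. c * cis2 (x \<bullet> b))" by blast
  have "norm (f x) \<le> norm c" for x by (simp add: f norm_mult)
  with * show "f differentiable_on UNIV \<and> poly_growth f"
    by (auto simp: differentiable_on_def differentiable_def intro!: poly_growth_bounded)
next
  show "(\<lambda>x. cis2 (x \<bullet> b)) \<in> range (\<lambda>c x. c * cis2 (x \<bullet> b))"
    by (rule image_eqI[of _ _ 1]) auto
qed

lemma schwartz_add: "f \<in> schwartz \<Longrightarrow> g \<in> schwartz \<Longrightarrow> (\<lambda>x. f x + g x) \<in> schwartz"
  unfolding schwartz_eq by (rule smooth_with_add) (auto intro: rapid_add)

lemma slow_mult_schwartz: "f \<in> slow \<Longrightarrow> g \<in> schwartz \<Longrightarrow> (\<lambda>x. f x * g x) \<in> schwartz"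
  unfolding schwartz_eq by (rule smooth_with_mult[where P = poly_growth and Q = rapid]) (auto intro: poly_growth_mult_rapid rapid_add)

lemma schwartz_cmult: "g \<in> schwartz \<Longrightarrow> (\<lambda>x. c * g x) \<in> schwartz"
  by (rule slow_mult_schwartz[OF slow_const])

lemma schwartz_affine: "f \<in> schwartz \<Longrightarrow> c \<noteq> 0 \<Longrightarrow> (\<lambda>x. f (c *\<^sub>R x + t)) \<in> schwartz"
  unfolding schwartz_eq by (rule smooth_with_affine) (auto intro: rapid_affine)

lemma schwartz_slow: "f \<in> schwartz \<Longrightarrow> f \<in> slow"
  unfolding schwartz_eq
proof (erule smooth_with_mono)
  fix g :: "'a \<Rightarrow> complex" assume "rapid g"
  then obtain C where "\<forall>x. (1 + norm x) ^ 0 * norm (g x) \<le> C" unfolding rapid_def by blast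
  then show "poly_growth g" by (intro poly_growth_bounded[of _ C]) simp
qed

lemmas schwartzD = smooth_withD[of _ rapid, folded schwartz_eq]

lemma schwartz_dir_deriv: "f \<in> schwartz \<Longrightarrow> v \<in> Basis \<Longrightarrow> dir_deriv v f \<in> schwartz"
  unfolding schwartz_eq by (rule smooth_with_dir_deriv)

lemma schwartz_smooth: "f \<in> schwartz \<Longrightarrow> smooth f"
  by (auto simp: schwartz_def)

section \<open>Gaussians\<close>

definition gauss :: "real \<Rightarrow> 'a::euclidean_space \<Rightarrow> complex" where
  "gauss c x = of_real (exp (- c * (x \<bullet> x)))"

lemma gauss_rapid:
  assumes "c > 0" shows "rapid (gauss c)"
  unfolding rapid_iff_bounded
proof
  fix k
  have "norm (norm x ^ k * norm (gauss c x)) \<le> 1 + fact k / c ^ k" for x :: 'a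
  proof (cases "norm x \<le> 1")
    case True
    have "norm x ^ k * norm (gauss c x) \<le> 1 * 1"
      using assms by (intro mult_mono) (auto simp: gauss_def power_le_one True)
    then show ?thesis using assms
      by (simp add: abs_mult) (smt (verit) divide_nonneg_nonneg fact_ge_zero zero_le_power)
  next
    case False
    \<comment> \<open>Outside the unit ball the exponent may be doubled, which makes the left-hand
      side a power of the quantity in the exponential.\<close>
    have "norm x ^ k \<le> norm x ^ (2 * k)" using False by (intro power_increasing) auto
    also have "\<dots> = (x \<bullet> x) ^ k" by (simp add: power_mult dot_square_norm)
    finally have 1: "norm x ^ k \<le> (x \<bullet> x) ^ k" .
    have "(c * (x \<bullet> x)) ^ k / fact k \<le> exp (c * (x \<bullet> x))"
    proof -
      \<comment> \<open>A single term of the exponential series bounds \<open>exp\<close> from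
        below.\<close>
      have "(\<Sum>i\<in>{k}. inverse (fact i) * (c * (x \<bullet> x)) ^ i) \<le> (\<Sum>i. inverse (fact i) * (c * (x \<bullet> x)) ^ i)"
        using assms by (intro sum_le_suminf summable_exp) auto
      then show ?thesis by (simp add: exp_def divide_inverse mult.commute scaleR_conv_of_real)
    qed
    then have "(x \<bullet> x) ^ k * exp (- c * (x \<bullet> x)) \<le> fact k / c ^ k"
      using assms by (simp add: exp_minus field_simps power_mult_distrib)
    moreover have "norm x ^ k * exp (- c * (x \<bullet> x)) \<le> (x \<bullet> x) ^ k * exp (- c * (x \<bullet> x))"
      using 1 by (intro mult_right_mono) auto
    ultimately have "norm x ^ k * exp (- c * (x \<bullet> x)) \<le> 1 + fact k / c ^ k" by linarith
    then show ?thesis by (simp add: gauss_def abs_mult)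
  qed
  then show "bounded (range (\<lambda>x::'a. norm x ^ k * norm (gauss c x)))"
    by (auto simp: bounded_iff)
qed

text \<open>The derivative of a Gaussian is a linear function times the same Gaussian, so the
  products with elements of \<open>slow\<close> are closed under differentiation.\<close>

lemma gauss_schwartz [intro]:
  assumes "c > 0" shows "gauss c \<in> schwartz"
  unfolding schwartz_eq
proof (rule smooth_with_coinduct[of _ "(\<lambda>p x. p x * gauss c x) ` slow"])
  have *: "(gauss c has_derivative (\<lambda>v. of_real (x \<bullet> ((- 2 * c) *\<^sub>R v)) * gauss c x)) (at x)" for x :: 'a
    unfolding gauss_def
    by (auto intro!: derivative_eq_intros simp: fun_eq_iff inner_commute algebra_simps)
  then have gd: "(gauss c :: 'a \<Rightarrow> complex) differentiable_on UNIV"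
    unfolding differentiable_on_def differentiable_def by blast
  fix f :: "'a \<Rightarrow> complex" and v :: 'a assume "f \<in> (\<lambda>p x. p x * gauss c x) ` slow"
  then obtain p where p: "p \<in> slow" and f: "f = (\<lambda>x. p x * gauss c x)" by auto
  show "f differentiable_on UNIV \<and> rapid f"
    unfolding f using gd smooth_withD(1,4)[OF p] gauss_rapid[OF assms]
    by (auto intro!: poly_growth_mult_rapid differentiable_on_mult)
  assume v: "v \<in> Basis"
  have "dir_deriv v (gauss c) = (\<lambda>x. of_real (x \<bullet> ((- 2 * c) *\<^sub>R v)) * gauss c x)"
    by (intro ext has_derivative_imp_dir_deriv *)
  then have eq: "dir_deriv v f = (\<lambda>x. (p x * of_real (x \<bullet> ((- 2 * c) *\<^sub>R v)) + dir_deriv v p x) * gauss c x)"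
    unfolding f using gd smooth_withD(1)[OF p] by (simp add: dir_deriv_mult algebra_simps)
  show "dir_deriv v f \<in> (\<lambda>p x. p x * gauss c x) ` slow"
    by (rule image_eqI[where x = "\<lambda>x. p x * of_real (x \<bullet> ((- 2 * c) *\<^sub>R v)) + dir_deriv v p x"])
      (rule eq, intro slow_add slow_mult p smooth_with_dir_deriv v slow_inner)
next
  show "gauss c \<in> (\<lambda>p x. p x * gauss c x) ` slow"
    by (rule image_eqI[of _ _ "\<lambda>_. 1"]) (auto simp: fun_eq_iff)
qed

section \<open>A smooth bump supported in the unit ball\<close>

definition flat_exp :: "nat \<Rightarrow> real \<Rightarrow> real" where
  "flat_exp n t = (if t > 0 then exp (- 1 / t) / t ^ n else 0)"

text \<open>The term of order \<open>n + 1\<close> in the series of exp (1/t) beats the denominator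
  \<open>t ^ n\<close> with a factor \<open>t\<close> to spare. This factor makes the difference
  quotient at 0 vanish in the limit.\<close>

lemma flat_exp_bounds: "0 \<le> flat_exp n t" "flat_exp n t \<le> fact (n + 1) * max 0 t"
proof -
  show "0 \<le> flat_exp n t" by (auto simp: flat_exp_def)
  show "flat_exp n t \<le> fact (n + 1) * max 0 t"
  proof (cases "t > 0")
    case True
    have "(1 / t) ^ (n+1) / fact (n+1) \<le> exp (1 / t)"
    proof -
      have "(\<Sum>i\<in>{n+1}. inverse (fact i) * (1 / t) ^ i) \<le> (\<Sum>i. inverse (fact i) * (1 / t) ^ i)"
        using True by (intro sum_le_suminf summable_exp) auto
      then show ?thesis by (simp add: exp_def divide_inverse mult.commute scaleR_conv_of_real)
    qed
    then have "(1 / t) ^ (n+1) \<le> fact (n+1) * exp (1 / t)"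
      by (simp add: pos_divide_le_eq mult.commute del: fact_Suc power_Suc)
    then have "exp (- 1 / t) * (1 / t) ^ (n + 1) \<le> exp (- 1 / t) * (fact (n+1) * exp (1 / t))"
      by (intro mult_left_mono) auto
    also have "\<dots> = fact (n + 1) * (exp (- 1 / t) * exp (1 / t))" by (simp only: mult_ac)
    also have "exp (- 1 / t) * exp (1 / t) = 1" by (simp add: mult_exp_exp)
    finally have "exp (- 1 / t) * (1 / t) ^ (n + 1) * t \<le> fact (n+1) * t"
      using True by (intro mult_right_mono) auto
    moreover have "exp (- 1 / t) * (1 / t) ^ (n + 1) * t = flat_exp n t"
      using True by (simp add: flat_exp_def power_divide)
    ultimately show ?thesis using True by simp
  qed (simp add: flat_exp_def)
qed

text \<open>The denominators in \<open>flat_exp\<close> make the family closed under linear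
  combinations of derivatives. At 0, the difference quotient of \<open>flat_exp n\<close> from the
  right is \<open>flat_exp (n + 1)\<close>, which has a linear bound.\<close>

lemma flat_exp_deriv:
  "(flat_exp n has_real_derivative (flat_exp (n + 2) t - n * flat_exp (n + 1) t)) (at t)"
proof -
  consider "t > 0" | "t < 0" | "t = 0" by linarith
  then show ?thesis
  proof cases
    case 1
    have "((\<lambda>t. exp (- 1 / t) / t ^ n) has_real_derivative (flat_exp (n + 2) t - n * flat_exp (n + 1) t)) (at t)"
      using 1 by (auto intro!: derivative_eq_intros simp: flat_exp_def field_simps power2_eq_square power_Suc)
        (cases n; simp add: field_simps)
    from has_field_derivative_transform_within_open[OF this, of "{0<..}" "flat_exp n"] 1
    show ?thesis by (auto simp: flat_exp_def)
  next
    case 2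
    have "((\<lambda>t. 0) has_real_derivative (flat_exp (n + 2) t - n * flat_exp (n + 1) t)) (at t)"
      using 2 by (simp add: flat_exp_def)
    from has_field_derivative_transform_within_open[OF this, of "{..<0}" "flat_exp n"] 2
    show ?thesis by (auto simp: flat_exp_def)
  next
    case 3
    have "\<bar>flat_exp n h / h\<bar> \<le> fact (n + 2) * \<bar>h\<bar>" for h
    proof (cases "h > 0")
      case True
      then have "flat_exp n h / h = flat_exp (n + 1) h" by (simp add: flat_exp_def)
      with flat_exp_bounds[of "n + 1" h] True show ?thesis by simp
    next
      case False
      then have "flat_exp n h = 0" by (simp add: flat_exp_def)
      moreover have "0 \<le> fact (n + 2) * \<bar>h\<bar>" by (intro mult_nonneg_nonneg) auto
      ultimately show ?thesis by (metis abs_zero div_0)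
    qed
    then have "((\<lambda>h. flat_exp n h / h) \<longlongrightarrow> 0) (at 0)"
      by (intro tendsto_0_le[OF tendsto_ident_at, where K = "fact (n + 2)"] always_eventually)
        (simp add: mult.commute del: fact_Suc)
    then show ?thesis using 3 by (simp add: DERIV_def flat_exp_def)
  qed
qed

definition bumpr :: "'a::euclidean_space \<Rightarrow> real" where
  "bumpr x = flat_exp 0 (1 - x \<bullet> x)"

definition bump :: "'a::euclidean_space \<Rightarrow> complex" where
  "bump x = of_real (bumpr x)"

text \<open>The family consists of sums of slowly increasing functions times
  \<open>flat_exp n (1 - x \<bullet> x)\<close>: the chain rule raises \<open>n\<close> by one or
  two and brings in a linear factor.\<close>

lemma bump_schwartz [intro]: "bump \<in> schwartz"
  unfolding schwartz_eq
proof (rule smooth_with_coinduct)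
  let ?E = "\<lambda>n (x::'a). complex_of_real (flat_exp n (1 - x \<bullet> x))"
  let ?F = "prod_span slow (range ?E)"
  have "(\<lambda>x. 1 * ?E 0 x) \<in> ?F" by (rule prod_span.prod) auto
  then show "bump \<in> ?F" by (simp add: bump_def[abs_def] bumpr_def)
  have Ed: "(?E n has_derivative (\<lambda>v. of_real (x \<bullet> ((- 2) *\<^sub>R v)) * ?E (n + 2) x
      + of_real (x \<bullet> ((2 * n) *\<^sub>R v)) * ?E (n + 1) x)) (at x)" for n x
  proof -
    have "((\<lambda>x. flat_exp n (1 - x \<bullet> x)) has_derivative
       (\<lambda>v. (flat_exp (n + 2) (1 - x \<bullet> x) - n * flat_exp (n + 1) (1 - x \<bullet> x)) * (x \<bullet> ((- 2) *\<^sub>R v)))) (at x)"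
      by (rule has_derivative_eq_rhs[OF DERIV_compose_FDERIV[OF flat_exp_deriv]])
        (auto intro!: derivative_eq_intros simp: fun_eq_iff inner_commute)
    from has_derivative_of_real[OF this] show ?thesis
      by (rule has_derivative_eq_rhs) (auto simp: fun_eq_iff algebra_simps)
  qed
  have Er: "rapid (?E n)" for n
    unfolding rapid_def
  proof (intro allI exI)
    fix k and x :: 'a
    show "(1 + norm x) ^ k * norm (?E n x) \<le> 2 ^ k * fact (n + 1)"
    proof (cases "norm x < 1")
      case True
      have "flat_exp n (1 - x \<bullet> x) \<le> fact (n + 1) * max 0 (1 - x \<bullet> x)" by (rule flat_exp_bounds)
      also have "\<dots> \<le> fact (n + 1) * 1" by (intro mult_left_mono) auto
      finally have "norm (?E n x) \<le> fact (n + 1)" using flat_exp_bounds(1)[of n] by simp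
      then show ?thesis using True by (intro mult_mono power_mono) auto
    next
      case False
      then have "1 - x \<bullet> x \<le> 0" by (simp add: dot_square_norm)
      then show ?thesis by (simp add: flat_exp_def)
    qed
  qed
  show "f differentiable_on UNIV \<and> rapid f" if "f \<in> ?F" for f using that
  proof induction
    case (prod f g)
    then obtain n where g: "g = ?E n" by auto
    have "?E n differentiable_on UNIV"
      using Ed unfolding differentiable_on_def differentiable_def by blast
    then show ?case using Er[of n] smooth_withD(1,4)[OF prod(1)] unfolding g
      by (auto intro!: poly_growth_mult_rapid differentiable_on_mult)
  qed (auto intro: rapid_add)
  have "f differentiable_on UNIV \<and> dir_deriv v f \<in> ?F" if "f \<in> ?F" "v \<in> Basis" for f v using that
  proof induction
    case (prod f g)
    then obtain n where g: "g = ?E n" by auto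
    have d: "?E n differentiable_on UNIV"
      using Ed unfolding differentiable_on_def differentiable_def by blast
    have "dir_deriv v (?E n) = (\<lambda>x. of_real (x \<bullet> ((- 2) *\<^sub>R v)) * ?E (n + 2) x
      + of_real (x \<bullet> ((2 * n) *\<^sub>R v)) * ?E (n + 1) x)" by (intro ext has_derivative_imp_dir_deriv Ed)
    then have "dir_deriv v (\<lambda>x. f x * g x) =
       (\<lambda>x. ((f x * of_real (x \<bullet> ((- 2) *\<^sub>R v))) * ?E (n + 2) x
         + (f x * of_real (x \<bullet> ((2 * n) *\<^sub>R v))) * ?E (n + 1) x) + dir_deriv v f x * ?E n x)"
      unfolding g using d smooth_withD(1)[OF prod(1)] by (simp add: dir_deriv_mult algebra_simps)
    moreover have "\<dots> \<in> ?F"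
      using prod by (intro prod_span.intros slow_mult smooth_with_dir_deriv slow_inner) auto
    ultimately show ?case using d smooth_withD(1)[OF prod(1)] by (auto simp: g intro!: differentiable_on_mult)
  qed (auto simp: dir_deriv_add intro: prod_span.add)
  then show "dir_deriv v f \<in> ?F" if "f \<in> ?F" "v \<in> Basis" for f v using that by blast
qed

lemma bumpr_nonneg [simp]: "bumpr x \<ge> 0"
  by (simp add: bumpr_def flat_exp_bounds)

lemma bumpr_eq_0: "norm x \<ge> 1 \<Longrightarrow> bumpr x = 0"
proof -
  assume "norm x \<ge> 1"
  then have "(norm x)\<^sup>2 \<ge> 1" by (rule one_le_power)
  then show ?thesis by (simp add: bumpr_def flat_exp_def dot_square_norm)
qed

lemma bumpr_pos: "norm x < 1 \<Longrightarrow> bumpr x > 0"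
  by (simp add: bumpr_def flat_exp_def dot_square_norm abs_square_less_1)

lemma bumpr_antimono: "norm x \<le> norm y \<Longrightarrow> bumpr y \<le> bumpr x"
proof (cases "norm y < 1")
  case True
  assume le: "norm x \<le> norm y"
  have "x \<bullet> x \<le> y \<bullet> y" "y \<bullet> y < 1"
    using le True by (auto simp: dot_square_norm power_mono abs_square_less_1)
  then show ?thesis by (simp add: bumpr_def flat_exp_def frac_le)
next
  case False
  then show ?thesis using bumpr_eq_0[of y] by simp
qed

lemma bumpr_minus [simp]: "bumpr (- x) = bumpr x"
  by (simp add: bumpr_def)

lemma norm_bump [simp]: "norm (bump x) = bumpr x"
  by (simp add: bump_def)

lemma bumpr_continuous [continuous_intros]:
  "continuous_on A f \<Longrightarrow> continuous_on A (\<lambda>x. bumpr (f x))"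
proof -
  have "continuous_on UNIV (\<lambda>x::'b. Re (bump x))"
    by (intro continuous_intros schwartzD bump_schwartz)
  then have "continuous_on UNIV (bumpr :: 'b \<Rightarrow> real)" by (simp add: bump_def[abs_def])
  then show "continuous_on A f \<Longrightarrow> continuous_on A (\<lambda>x. bumpr (f x))"
    by (rule continuous_on_compose2) auto
qed

section \<open>Continuous functions of compact support\<close>

lemma CcI:
  fixes f :: "'a::euclidean_space \<Rightarrow> complex"
  assumes "continuous_on UNIV f" "\<And>x. norm x > r \<Longrightarrow> f x = 0"
  shows "f \<in> Cc" "tsupport f \<subseteq> cball 0 r"
proof -
  show *: "tsupport f \<subseteq> cball 0 r"
    unfolding tsupport_def
  proof (rule closure_minimal)
    show "{x. f x \<noteq> 0} \<subseteq> cball 0 r" using assms(2) by (fastforce simp: not_less[symmetric])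
  qed auto
  have "compact (tsupport f)"
    by (rule compact_Int_closed[OF compact_cball[of 0 r], of "tsupport f", simplified Int_absorb1[OF *]])
      (simp add: tsupport_def)
  with assms show "f \<in> Cc" by (simp add: Cc_def)
qed

lemma CcD:
  fixes f :: "'a::euclidean_space \<Rightarrow> complex"
  assumes "f \<in> Cc"
  shows "continuous_on UNIV f" "f \<in> borel_measurable borel" "\<exists>r>0. \<forall>x. norm x > r \<longrightarrow> f x = 0"
proof -
  show c: "continuous_on UNIV f" using assms by (simp add: Cc_def)
  then show "f \<in> borel_measurable borel" by (rule borel_measurable_continuous_onI)
  have "bounded (tsupport f)" using assms by (simp add: Cc_def compact_imp_bounded)
  then obtain r where r: "r > 0" "\<And>x. x \<in> tsupport f \<Longrightarrow> norm x \<le> r" by (auto simp: bounded_pos)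
  have "f x = 0" if "norm x > r" for x
  proof (rule ccontr)
    assume "f x \<noteq> 0"
    then have "x \<in> tsupport f" by (auto simp: tsupport_def intro: closure_subset[THEN subsetD])
    with r that show False by fastforce
  qed
  with r show "\<exists>r>0. \<forall>x. norm x > r \<longrightarrow> f x = 0" by blast
qed

lemma Cc_bounded:
  fixes f :: "'a::euclidean_space \<Rightarrow> complex"
  assumes "f \<in> Cc" shows "\<exists>B>0. \<forall>x. norm (f x) \<le> B"
proof -
  obtain r where r: "r > 0" "\<And>x. norm x > r \<Longrightarrow> f x = 0" using CcD(3)[OF assms] by blast
  have "compact (f ` cball 0 r)"
    by (intro compact_continuous_image continuous_on_subset[OF CcD(1)[OF assms]]) auto
  then obtain B where B: "B > 0" "\<And>x. x \<in> cball 0 r \<Longrightarrow> norm (f x) \<le> B"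
    by (auto dest!: compact_imp_bounded simp: bounded_pos)
  then have "norm (f x) \<le> B" for x using r(2)[of x] B by (cases "norm x \<le> r") auto
  with B show ?thesis by blast
qed

lemma Cc_rapid:
  fixes f :: "'a::euclidean_space \<Rightarrow> complex"
  assumes "f \<in> Cc" shows "rapid f"
  unfolding rapid_def
proof
  fix k
  obtain r where r: "r > 0" "\<And>x. norm x > r \<Longrightarrow> f x = 0" using CcD(3)[OF assms] by blast
  obtain B where B: "B > 0" "\<And>x. norm (f x) \<le> B" using Cc_bounded[OF assms] by blast
  have "(1 + norm x) ^ k * norm (f x) \<le> (1 + r) ^ k * B" for x
  proof (cases "norm x \<le> r")
    case True
    then show ?thesis using B r by (intro mult_mono power_mono) auto
  next
    case False
    then show ?thesis using B r by simp
  qed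
  then show "\<exists>C. \<forall>x. (1 + norm x) ^ k * norm (f x) \<le> C" by blast
qed


section \<open>The Fourier transform\<close>

lemma
  fixes f :: "'a::euclidean_space \<Rightarrow> real \<Rightarrow> 'b::{real_normed_field,banach,second_countable_topology}"
  assumes "\<And>b. b \<in> Basis \<Longrightarrow> integrable lborel (f b)"
  shows lborel_integrable_prod: "integrable lborel (\<lambda>x. \<Prod>b\<in>Basis. f b (x \<bullet> b))"
    and lborel_integral_prod:
      "(\<integral>x. (\<Prod>b\<in>Basis. f b (x \<bullet> b)) \<partial>lborel) = (\<Prod>b\<in>Basis. \<integral>x. f b x \<partial>lborel)"
proof -
  interpret product_sigma_finite "\<lambda>b::'a. lborel :: real measure" by standard
  have m [measurable]: "f b \<in> borel_measurable borel" if "b \<in> Basis" for b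
    using assms[OF that] by simp
  have [measurable]: "(\<lambda>g. \<Sum>b\<in>Basis. g b *\<^sub>R b) \<in> (\<Pi>\<^sub>M b\<in>Basis. lborel) \<rightarrow>\<^sub>M (borel :: 'a measure)"
    by measurable
  have mm: "(\<lambda>x::'a. \<Prod>b\<in>Basis. f b (x \<bullet> b)) \<in> borel_measurable borel"
    by (intro borel_measurable_prod measurable_compose[OF _ m]) auto
  have [simp]: "(\<Prod>b\<in>Basis. f b ((\<Sum>b\<in>Basis. g b *\<^sub>R b) \<bullet> b)) = (\<Prod>b\<in>Basis. f b (g b))" for g
    by (intro prod.cong) auto
  show "integrable lborel (\<lambda>x. \<Prod>b\<in>Basis. f b (x \<bullet> b))"
    unfolding lborel_eq[where 'a='a]
    by (subst integrable_distr_eq) (use mm assms in \<open>auto intro!: product_integrable_prod\<close>)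
  show "(\<integral>x. (\<Prod>b\<in>Basis. f b (x \<bullet> b)) \<partial>lborel) = (\<Prod>b\<in>Basis. \<integral>x. f b x \<partial>lborel)"
    unfolding lborel_eq[where 'a='a]
    by (subst integral_distr) (use mm assms in \<open>auto intro!: product_integral_prod\<close>)
qed

lemma
  fixes f :: "'a::euclidean_space \<Rightarrow> 'b::{banach,second_countable_topology}"
  assumes [measurable]: "f \<in> borel_measurable borel" and c: "c \<noteq> 0"
  shows lborel_integrable_affine: "integrable lborel (\<lambda>x. f (t + c *\<^sub>R x)) \<longleftrightarrow> integrable lborel f"
    and lborel_integral_affine:
      "(\<integral>x. f x \<partial>lborel) = \<bar>c\<bar> ^ DIM('a) *\<^sub>R (\<integral>x. f (t + c *\<^sub>R x) \<partial>lborel)"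
proof -
  have [measurable]: "f \<in> borel_measurable (distr lborel borel (\<lambda>x. t + c *\<^sub>R x))"
    by simp
  have "integrable lborel f \<longleftrightarrow>
      integrable (distr lborel borel (\<lambda>x. t + c *\<^sub>R x)) (\<lambda>x. \<bar>c\<bar> ^ DIM('a) *\<^sub>R f x)"
    by (subst lborel_affine[OF c, of t]) (simp add: integrable_density)
  also have "\<dots> \<longleftrightarrow> integrable lborel (\<lambda>x. \<bar>c\<bar> ^ DIM('a) *\<^sub>R f (t + c *\<^sub>R x))"
    by (subst integrable_distr_eq) auto
  also have "\<dots> \<longleftrightarrow> integrable lborel (\<lambda>x. f (t + c *\<^sub>R x))"
  proof -
    have "integrable lborel (\<lambda>x. f (t + c *\<^sub>R x))"
      if "integrable lborel (\<lambda>x. \<bar>c\<bar> ^ DIM('a) *\<^sub>R f (t + c *\<^sub>R x))"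
      using integrable_scaleR_right[of "inverse (\<bar>c\<bar> ^ DIM('a))", OF that] c by simp
    then show ?thesis by (intro iffI integrable_scaleR_right)
  qed
  finally show "integrable lborel (\<lambda>x. f (t + c *\<^sub>R x)) \<longleftrightarrow> integrable lborel f" by simp
  show "(\<integral>x. f x \<partial>lborel) = \<bar>c\<bar> ^ DIM('a) *\<^sub>R (\<integral>x. f (t + c *\<^sub>R x) \<partial>lborel)"
    by (subst lborel_affine[OF c, of t]) (simp add: integral_density integral_distr)
qed

lemma lborel_integral_reflect:
  fixes f :: "'a::euclidean_space \<Rightarrow> 'b::{banach,second_countable_topology}"
  assumes "f \<in> borel_measurable borel"
  shows "(\<integral>x. f (t - x) \<partial>lborel) = (\<integral>x. f x \<partial>lborel)"
  using lborel_integral_affine[OF assms, of "-1" t] by simp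

text \<open>A product of one-dimensional Cauchy profiles: integrable by Fubini, comparable under
  shifts one coordinate at a time, and of merely polynomial decay, so that a multiple of it
  dominates any rapidly decreasing function. It is the common majorant for integrals and for sums
  over discrete sets.\<close>

definition weight :: "'a::euclidean_space \<Rightarrow> real" where
  "weight x = (\<Prod>b\<in>Basis. 1 / (1 + (x \<bullet> b)\<^sup>2))"

lemma weight_pos [simp]: "weight x > 0"
  unfolding weight_def by (intro prod_pos) (auto intro: add_pos_nonneg)

lemma weight_nonneg [simp]: "weight x \<ge> 0" "\<bar>weight x\<bar> = weight x"
  by (simp_all add: less_imp_le)

lemma weight_le_1: "weight x \<le> 1"
  unfolding weight_def by (intro prod_le_1) (auto simp: divide_le_eq add_pos_nonneg)

lemma weight_minus [simp]: "weight (- x) = weight x"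
  by (simp add: weight_def)

lemma continuous_weight [continuous_intros]:
  "continuous_on A f \<Longrightarrow> continuous_on A (\<lambda>x. weight (f x))"
  unfolding weight_def by (intro continuous_intros) (auto simp: add_nonneg_eq_0_iff)

lemma measurable_weight [measurable]: "weight \<in> borel_measurable borel"
  by (intro borel_measurable_continuous_onI continuous_intros)

lemma weight_integrable [simp, intro]: "integrable lborel (weight :: 'a::euclidean_space \<Rightarrow> real)"
proof -
  have "integrable lborel (\<lambda>x::real. 1 / (1 + x\<^sup>2))"
    using integrable_inverse_1_plus_square by (simp add: set_integrable_def inverse_eq_divide)
  then show ?thesis unfolding weight_def[abs_def] by (intro lborel_integrable_prod)
qed

text \<open>Each of the \<open>DIM('a)\<close> factors is at least (1 + |x|)^-2.\<close>

lemma weight_lower: "1 \<le> (1 + norm x) ^ (2 * DIM('a)) * weight (x :: 'a::euclidean_space)"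
proof -
  have "(\<Prod>b\<in>(Basis::'a set). 1 / (1 + norm x)\<^sup>2) \<le> weight x"
    unfolding weight_def
  proof (intro prod_mono conjI)
    fix b :: 'a assume b: "b \<in> Basis"
    have "(x \<bullet> b)\<^sup>2 \<le> (norm x)\<^sup>2" using Basis_le_norm[OF b, of x] by (simp add: abs_le_square_iff[symmetric])
    then have "1 + (x \<bullet> b)\<^sup>2 \<le> (1 + norm x)\<^sup>2"
    proof -
      have "(1 + norm x)\<^sup>2 = 1 + 2 * norm x + (norm x)\<^sup>2" by (simp add: power2_sum)
      with \<open>(x \<bullet> b)\<^sup>2 \<le> (norm x)\<^sup>2\<close> norm_ge_zero[of x] show ?thesis by linarith
    qed
    then show "1 / (1 + norm x)\<^sup>2 \<le> 1 / (1 + (x \<bullet> b)\<^sup>2)"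
      by (intro divide_left_mono mult_pos_pos zero_less_power) (auto intro: add_pos_nonneg)
  qed auto
  then have "1 / (1 + norm x) ^ (2 * DIM('a)) \<le> weight x"
    by (simp add: power_mult power_divide)
  then show ?thesis by (simp add: divide_le_eq mult.commute add_pos_nonneg)
qed

text \<open>Peetre's inequality, from 1 + s^2 <= 2 (1 + (s + t)^2) (1 + t^2) in each coordinate. It
  moves the weight across a shift.\<close>

lemma weight_peetre: "weight (x + v) * weight v \<le> 2 ^ DIM('a) * weight (x :: 'a::euclidean_space)"
proof -
  have "weight (x + v) * weight v = (\<Prod>b\<in>Basis. 1 / (1 + ((x + v) \<bullet> b)\<^sup>2) * (1 / (1 + (v \<bullet> b)\<^sup>2)))"
    unfolding weight_def by (simp only: prod.distrib)
  also have "\<dots> \<le> (\<Prod>b\<in>Basis. 2 * (1 / (1 + (x \<bullet> b)\<^sup>2)))"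
  proof (intro prod_mono conjI)
    fix b :: 'a
    define s t where "s = x \<bullet> b" and "t = v \<bullet> b"
    have "1 + s\<^sup>2 \<le> 2 * (1 + (s + t)\<^sup>2) * (1 + t\<^sup>2)"
    proof -
      have "s\<^sup>2 \<le> 2 * (s + t)\<^sup>2 + 2 * t\<^sup>2"
        using zero_le_power2[of "s + 2 * t"] by (simp add: power2_eq_square algebra_simps)
      moreover have "0 \<le> (s + t)\<^sup>2 * t\<^sup>2" by simp
      moreover have "2 * (1 + (s + t)\<^sup>2) * (1 + t\<^sup>2) = 2 + 2 * (s + t)\<^sup>2 + 2 * t\<^sup>2 + 2 * ((s + t)\<^sup>2 * t\<^sup>2)"
        by (simp add: algebra_simps)
      ultimately show ?thesis by linarith
    qed
    moreover have "0 < 1 + s\<^sup>2" "0 < (1 + (s + t)\<^sup>2) * (1 + t\<^sup>2)"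
      by (auto intro!: add_pos_nonneg mult_pos_pos)
    ultimately have "1 / ((1 + (s + t)\<^sup>2) * (1 + t\<^sup>2)) \<le> 2 / (1 + s\<^sup>2)"
      by (simp add: field_simps)
    then show "1 / (1 + ((x + v) \<bullet> b)\<^sup>2) * (1 / (1 + (v \<bullet> b)\<^sup>2)) \<le> 2 * (1 / (1 + (x \<bullet> b)\<^sup>2))"
      by (simp add: s_def t_def inner_add_left)
    show "0 \<le> 1 / (1 + ((x + v) \<bullet> b)\<^sup>2) * (1 / (1 + (v \<bullet> b)\<^sup>2))" by (auto intro!: mult_nonneg_nonneg)
  qed
  also have "\<dots> = 2 ^ DIM('a) * weight x" by (simp only: prod.distrib weight_def prod_constant)
  finally show ?thesis .
qed

text \<open>The constant is 8 = 2 * 4 per coordinate: 2 from \<open>weight_peetre\<close>, and 4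
  from \<open>weight_lower\<close> for the shift \<open>v\<close> in the unit ball.\<close>

lemma weight_near:
  assumes "norm v \<le> 1"
  shows "weight (x + v) \<le> 8 ^ DIM('a) * weight (x :: 'a::euclidean_space)"
proof -
  have "1 \<le> (1 + norm v) ^ (2 * DIM('a)) * weight v" by (rule weight_lower)
  also have "\<dots> \<le> 2 ^ (2 * DIM('a)) * weight v" using assms by (intro mult_right_mono power_mono) auto
  also have "(2::real) ^ (2 * DIM('a)) = 4 ^ DIM('a)" by (simp add: power_mult)
  finally have "weight (x + v) * 1 \<le> weight (x + v) * (4 ^ DIM('a) * weight v)" by (intro mult_left_mono) auto
  also have "\<dots> = 4 ^ DIM('a) * (weight (x + v) * weight v)" by simp
  also have "\<dots> \<le> 4 ^ DIM('a) * (2 ^ DIM('a) * weight x)" by (intro mult_left_mono weight_peetre) auto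
  also have "\<dots> = 8 ^ DIM('a) * weight x" by (simp add: power_mult_distrib[symmetric])
  finally show ?thesis by simp
qed

lemma weight_scale: "R \<ge> 1 \<Longrightarrow> weight (R *\<^sub>R x) \<le> weight x"
  unfolding weight_def
proof (intro prod_mono conjI)
  fix b assume "R \<ge> 1"
  have "\<bar>x \<bullet> b\<bar> \<le> R * \<bar>x \<bullet> b\<bar>" using mult_right_mono[OF \<open>R \<ge> 1\<close>, of "\<bar>x \<bullet> b\<bar>"] by simp
  then have "(x \<bullet> b)\<^sup>2 \<le> ((R *\<^sub>R x) \<bullet> b)\<^sup>2" using \<open>R \<ge> 1\<close> by (simp add: abs_le_square_iff[symmetric] abs_mult)
  then show "1 / (1 + ((R *\<^sub>R x) \<bullet> b)\<^sup>2) \<le> 1 / (1 + (x \<bullet> b)\<^sup>2)"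
    by (intro divide_left_mono mult_pos_pos) (auto intro: add_pos_nonneg)
qed auto

lemma rapid_weight:
  assumes "rapid f"
  shows "\<exists>C\<ge>0. \<forall>x. (1 + norm x) ^ k * norm (f x) \<le> C * weight (x :: 'a::euclidean_space)"
proof -
  obtain C where C: "C \<ge> 0" "\<And>x. (1 + norm x) ^ (2 * DIM('a) + k) * norm (f x) \<le> C"
    using rapidD[OF assms] by blast
  have "(1 + norm x) ^ k * norm (f x) \<le> C * weight x" for x
  proof -
    have "(1 + norm x) ^ k * norm (f x) * 1 \<le>
        (1 + norm x) ^ k * norm (f x) * ((1 + norm x) ^ (2 * DIM('a)) * weight x)"
      by (intro mult_left_mono weight_lower) auto
    also have "\<dots> = (1 + norm x) ^ (2 * DIM('a) + k) * norm (f x) * weight x" by (simp add: power_add)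
    also have "\<dots> \<le> C * weight x" by (intro mult_right_mono C) auto
    finally show ?thesis by simp
  qed
  with C show ?thesis by blast
qed

lemma rapid_integrable:
  assumes "rapid f" and [measurable]: "f \<in> borel_measurable borel"
  shows "integrable lborel (\<lambda>x. (1 + norm x) ^ k * norm (f x))" "integrable lborel f"
proof -
  have *: "integrable lborel (\<lambda>x. (1 + norm x) ^ k * norm (f x))" for k
  proof -
    obtain C where C: "C \<ge> 0" "\<And>x. (1 + norm x) ^ k * norm (f x) \<le> C * weight x"
      using rapid_weight[OF assms(1)] by blast
    have "integrable lborel (\<lambda>x::'a. C * weight x)" by simp
    then show ?thesis
      by (rule Bochner_Integration.integrable_bound) (use C in \<open>auto simp: abs_mult\<close>)
  qed
  from this[of k] this[of 0] show "integrable lborel (\<lambda>x. (1 + norm x) ^ k * norm (f x))" "integrable lborel f"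
    by (auto simp: integrable_norm_iff)
qed

lemma integral_norm_le:
  fixes f :: "'a \<Rightarrow> 'b::{banach,second_countable_topology}"
  assumes "integrable M g" "\<And>x. norm (f x) \<le> g x"
  shows "norm (integral\<^sup>L M f) \<le> integral\<^sup>L M g"
  by (rule order_trans[OF integral_norm_bound integral_mono_AE'])
    (use assms order_trans[OF norm_ge_zero] in auto)

lemma has_derivative_quadratic:
  fixes f :: "'a::euclidean_space \<Rightarrow> 'b::real_normed_vector"
  assumes "linear L" "\<And>h. norm (f (x + h) - f x - L h) \<le> C * (norm h)\<^sup>2"
  shows "(f has_derivative L) (at x)"
  unfolding has_derivative_at
proof
  show "bounded_linear L" using assms(1) by (simp add: linear_conv_bounded_linear)
  have "norm (norm (f (x + h) - f x - L h) / norm h) \<le> norm h * C" for h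
  proof (cases "h = 0")
    case False
    then show ?thesis using assms(2)[of h] by (simp add: divide_le_eq power2_eq_square mult_ac)
  qed auto
  then have "\<forall>\<^sub>F h in at 0. norm (norm (f (x + h) - f x - L h) / norm h) \<le> norm (norm h) * C"
    by (intro always_eventually allI) (metis real_norm_def abs_norm_cancel)
  moreover have "((\<lambda>h::'a. norm h) \<longlongrightarrow> 0) (at 0)" by (intro tendsto_norm_zero tendsto_ident_at)
  ultimately show "(\<lambda>h. norm (f (x + h) - f x - L h) / norm h) \<midarrow>0\<rightarrow> 0"
    by (rule tendsto_0_le[rotated])
qed

section \<open>Differentiation and decay under the Fourier transform\<close>

lemma fourier_cis2: "fourier f k = (\<integral>x. cis2 (- (k \<bullet> x)) * f x \<partial>lborel)"
  unfolding fourier_def cis2_def by (simp add: mult_ac)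

lemma inv_fourier_cis2: "inv_fourier f k = (\<integral>x. cis2 (k \<bullet> x) * f x \<partial>lborel)"
  by (simp add: inv_fourier_def fourier_cis2)

lemma inv_fourier_reflect:
  "f \<in> borel_measurable borel \<Longrightarrow> inv_fourier (\<lambda>x. f (- x)) k = fourier f k"
  unfolding inv_fourier_cis2 fourier_cis2
  using lborel_integral_reflect[of "\<lambda>x. cis2 (- (k \<bullet> x)) * f x" 0] by simp

lemma norm_fourier_le:
  "norm (fourier f k) \<le> (\<integral>x. norm (f x) \<partial>lborel)"
  unfolding fourier_cis2 by (rule order_trans[OF integral_norm_bound]) (simp add: norm_mult)

lemma cis2_integrable:
  assumes "integrable lborel f"
  shows "integrable lborel (\<lambda>x. cis2 (k \<bullet> x) * f x)"
proof -
  have [measurable]: "f \<in> borel_measurable borel" using borel_measurable_integrable[OF assms] by simp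
  show ?thesis by (rule Bochner_Integration.integrable_bound[OF assms]) (auto simp: norm_mult)
qed

text \<open>A common home for \<open>schwartz\<close> and \<open>Cc\<close>: all moments exist and
  multiplication by linear functions stays inside, which is what differentiating the transform
  requires.\<close>

definition rapid_meas :: "('a::euclidean_space \<Rightarrow> complex) set" where
  "rapid_meas = {f. f \<in> borel_measurable borel \<and> rapid f}"

lemma rapid_measD:
  assumes "f \<in> rapid_meas"
  shows "f \<in> borel_measurable borel" "rapid f" "integrable lborel f"
    "integrable lborel (\<lambda>x. (1 + norm x) ^ k * norm (f x))"
  using assms rapid_integrable by (auto simp: rapid_meas_def)

lemma rapid_meas_mult_inner: "f \<in> rapid_meas \<Longrightarrow> (\<lambda>x. c * (of_real (x \<bullet> v) * f x)) \<in> rapid_meas"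
proof -
  assume f: "f \<in> rapid_meas"
  have [measurable]: "f \<in> borel_measurable borel" by (rule rapid_measD[OF f])
  have "poly_growth (\<lambda>x. c)" "poly_growth (\<lambda>x. complex_of_real (x \<bullet> v))"
    using smooth_withD(4)[OF slow_const] smooth_withD(4)[OF slow_inner] by blast+
  with rapid_measD(2)[OF f] have "rapid (\<lambda>x. c * (of_real (x \<bullet> v) * f x))"
    by (intro poly_growth_mult_rapid)
  then show ?thesis by (simp add: rapid_meas_def)
qed

lemma schwartz_rapid_meas: "f \<in> schwartz \<Longrightarrow> f \<in> rapid_meas"
  by (simp add: rapid_meas_def schwartzD)

lemma Cc_rapid_meas: "f \<in> Cc \<Longrightarrow> f \<in> rapid_meas"
  by (simp add: rapid_meas_def CcD Cc_rapid)

lemma cis2_remainder: "norm (cis2 t - 1 - 2 * of_real pi * \<i> * of_real t) \<le> (2 * pi * t)\<^sup>2"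
proof -
  have "cmod (iexp (2 * pi * t) - (\<Sum>k\<le>1. (\<i> * of_real (2 * pi * t))^k / fact k)) \<le> \<bar>2 * pi * t\<bar>\<^sup>2 / 2"
    using iexp_approx1[of "2 * pi * t" 1] by (simp add: power2_eq_square)
  also have "\<dots> \<le> (2 * pi * t)\<^sup>2" by simp
  finally show ?thesis by (simp add: cis2_def mult_ac diff_diff_eq)
qed

text \<open>The first-order remainder of the character is quadratic in h \<bullet> x, so a second
  moment of \<open>f\<close> bounds the error by a multiple of |h|^2, uniformly in the direction of
  \<open>h\<close>.\<close>

lemma fourier_has_derivative:
  assumes f: "f \<in> rapid_meas"
  shows "(fourier f has_derivative (\<lambda>v. fourier (\<lambda>x. - 2 * of_real pi * \<i> * (of_real (x \<bullet> v) * f x)) k)) (at k)"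
    (is "(_ has_derivative ?L) _")
proof (rule has_derivative_quadratic)
  note [measurable] = rapid_measD(1)[OF f]
  have i: "integrable lborel (\<lambda>x. - 2 * of_real pi * \<i> * (of_real (x \<bullet> v) * f x))" for v
    by (intro rapid_measD(3) rapid_meas_mult_inner f)
  have i0: "integrable lborel f" by (intro rapid_measD f)
  show "linear ?L"
  proof
    fix v w :: 'a and r :: real
    show "?L (v + w) = ?L v + ?L w"
      unfolding fourier_cis2
      by (subst Bochner_Integration.integral_add[symmetric])
        (use i cis2_integrable[OF i, of "-k"] in \<open>auto simp: algebra_simps inner_add_right\<close>)
    show "?L (r *\<^sub>R v) = r *\<^sub>R ?L v"
      unfolding fourier_cis2
      by (subst integral_scaleR_right[symmetric]) (auto simp: scaleR_conv_of_real mult_ac)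
  qed
  fix h
  let ?J = "\<integral>x. (1 + norm x) ^ 2 * norm (f x) \<partial>lborel"
  have "fourier f (k + h) - fourier f k - ?L h =
     (\<integral>x. cis2 (- (k \<bullet> x)) * (cis2 (- (h \<bullet> x)) - 1 - 2 * of_real pi * \<i> * of_real (- (h \<bullet> x))) * f x \<partial>lborel)"
  proof -
    have "fourier f (k + h) - fourier f k - ?L h =
     (\<integral>x. cis2 (- ((k + h) \<bullet> x)) * f x - cis2 (- (k \<bullet> x)) * f x
        - cis2 (- (k \<bullet> x)) * (- 2 * of_real pi * \<i> * (of_real (x \<bullet> h) * f x)) \<partial>lborel)"
      unfolding fourier_cis2
      using Bochner_Integration.integral_diff[OF Bochner_Integration.integrable_diff[OF
            cis2_integrable[OF i0, of "- (k + h)"] cis2_integrable[OF i0, of "-k"]] cis2_integrable[OF i, of "-k" h]]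
        Bochner_Integration.integral_diff[OF
            cis2_integrable[OF i0, of "- (k + h)"] cis2_integrable[OF i0, of "-k"]]
      by (simp only: inner_minus_left)
    also have "\<dots> = (\<integral>x. cis2 (- (k \<bullet> x)) * (cis2 (- (h \<bullet> x)) - 1 - 2 * of_real pi * \<i> * of_real (- (h \<bullet> x))) * f x \<partial>lborel)"
      by (intro Bochner_Integration.integral_cong refl)
        (use cis2_add[of "- (h \<bullet> _)" "- (k \<bullet> _)"] in
          \<open>simp add: inner_add_left algebra_simps inner_commute[of _ h]\<close>)
    finally show ?thesis .
  qed
  also have "norm \<dots> \<le> (\<integral>x. ((2 * pi)\<^sup>2 * (norm h)\<^sup>2) * ((1 + norm x) ^ 2 * norm (f x)) \<partial>lborel)"
  proof (rule integral_norm_le)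
    show "integrable lborel (\<lambda>x. ((2 * pi)\<^sup>2 * (norm h)\<^sup>2) * ((1 + norm x) ^ 2 * norm (f x)))"
      by (intro integrable_mult_right rapid_measD f)
    fix x
    let ?r = "cis2 (- (h \<bullet> x)) - 1 - 2 * of_real pi * \<i> * of_real (- (h \<bullet> x))"
    have "norm ?r \<le> (2 * pi * (- (h \<bullet> x)))\<^sup>2"
      by (rule cis2_remainder)
    also have "\<dots> = (2 * pi)\<^sup>2 * \<bar>h \<bullet> x\<bar>\<^sup>2" by (simp add: power_mult_distrib)
    also have "\<dots> \<le> (2 * pi)\<^sup>2 * (norm h * (1 + norm x))\<^sup>2"
      by (intro mult_left_mono power_mono order_trans[OF Cauchy_Schwarz_ineq2]) auto
    finally have "norm ?r * norm (f x) \<le> (2 * pi)\<^sup>2 * (norm h * (1 + norm x))\<^sup>2 * norm (f x)"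
      by (rule mult_right_mono) auto
    then show "norm (cis2 (- (k \<bullet> x)) * ?r * f x) \<le> ((2 * pi)\<^sup>2 * (norm h)\<^sup>2) * ((1 + norm x) ^ 2 * norm (f x))"
      by (simp add: norm_mult power_mult_distrib mult_ac)
  qed
  also have "\<dots> = ((2 * pi)\<^sup>2 * ?J) * (norm h)\<^sup>2" by simp
  finally show "norm (fourier f (k + h) - fourier f k - ?L h) \<le> ((2 * pi)\<^sup>2 * ?J) * (norm h)\<^sup>2" .
qed

lemma fourier_slow:
  assumes "f \<in> rapid_meas" shows "fourier f \<in> slow"
proof (rule smooth_with_coinduct[of _ "fourier ` rapid_meas"])
  fix g :: "'a \<Rightarrow> complex" and v :: 'a
  assume "g \<in> fourier ` rapid_meas"
  then obtain f where f: "f \<in> rapid_meas" and g: "g = fourier f" by blast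
  note d = fourier_has_derivative[OF f]
  have "fourier f differentiable_on UNIV"
    unfolding differentiable_on_def differentiable_def using d by blast
  moreover have "poly_growth (fourier f)" by (rule poly_growth_bounded[OF norm_fourier_le])
  ultimately show "g differentiable_on UNIV \<and> poly_growth g" by (simp add: g)
  have "dir_deriv v g = fourier (\<lambda>x. - 2 * of_real pi * \<i> * (of_real (x \<bullet> v) * f x))"
    unfolding g by (intro ext has_derivative_imp_dir_deriv d)
  then show "dir_deriv v g \<in> fourier ` rapid_meas" using rapid_meas_mult_inner[OF f] by blast
qed (use assms in blast)

lemma inv_fourier_slow:
  assumes "f \<in> rapid_meas" shows "inv_fourier f \<in> slow"
proof -
  have "(\<lambda>x. fourier f ((-1) *\<^sub>R x + 0)) \<in> slow"
  proof (rule smooth_with_affine[OF fourier_slow[OF assms]])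
    fix g :: "'a \<Rightarrow> complex" and a assume "poly_growth g"
    then obtain k C where C: "\<And>x. norm (g x) \<le> C * (1 + norm x) ^ k" by (auto simp: poly_growth_def)
    have "norm (a * g (- 1 *\<^sub>R x + 0)) \<le> (norm a * C) * (1 + norm x) ^ k" for x
      using mult_left_mono[OF C[of "-x"], of "norm a"] by (simp add: norm_mult mult_ac)
    then show "poly_growth (\<lambda>x. a * g (- 1 *\<^sub>R x + 0))" unfolding poly_growth_def by blast
  qed
  then show ?thesis by (simp add: inv_fourier_def[abs_def])
qed

text \<open>An integrable majorant for all difference quotients at once: the mean value inequality
  on a segment of length at most 1, along which \<open>weight\<close> changes by a bounded
  factor.\<close>

lemma schwartz_diff_bound:
  assumes f: "f \<in> schwartz" and v: "v \<in> Basis"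
  shows "\<exists>C\<ge>0. \<forall>x. \<forall>h\<in>{0<..1}. norm (f (x + h *\<^sub>R v) - f x) \<le> C * h * weight x"
proof -
  have df: "dir_deriv v f \<in> schwartz" by (rule schwartz_dir_deriv[OF f v])
  obtain C where C: "C \<ge> 0" "\<And>x. norm (dir_deriv v f x) \<le> C * weight x"
    using rapid_weight[OF schwartzD(4)[OF df], of 0] by auto
  have "norm (f (x + h *\<^sub>R v) - f x) \<le> (C * 8 ^ DIM('a)) * h * weight x" if h: "0 < h" "h \<le> 1" for x h
  proof -
    define \<phi> where "\<phi> s = f (x + s *\<^sub>R v)" for s :: real
    have d: "(\<phi> has_derivative (\<lambda>t. t *\<^sub>R dir_deriv v f (x + s *\<^sub>R v))) (at s within {0..h})" for s
    proof -
      have D: "(f has_derivative (\<lambda>w. dir_deriv w f (x + s *\<^sub>R v))) (at (x + s *\<^sub>R v))"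
        by (rule dir_deriv_works[OF schwartzD(2)[OF f]])
      have "((\<lambda>s. x + s *\<^sub>R v) has_derivative (\<lambda>t. t *\<^sub>R v)) (at s)"
        by (auto intro!: derivative_eq_intros)
      from has_derivative_compose[OF this D]
      have "(\<phi> has_derivative (\<lambda>t. dir_deriv (t *\<^sub>R v) f (x + s *\<^sub>R v))) (at s)"
        unfolding \<phi>_def .
      also have "(\<lambda>t. dir_deriv (t *\<^sub>R v) f (x + s *\<^sub>R v)) = (\<lambda>t. t *\<^sub>R dir_deriv v f (x + s *\<^sub>R v))"
        using linear_scale[OF has_derivative_linear[OF D]] by auto
      finally show ?thesis by (rule has_derivative_at_withinI)
    qed
    have "norm (\<phi> h - \<phi> 0) \<le> (C * (8 ^ DIM('a) * weight x)) * norm (h - 0)"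
    proof (rule differentiable_bound[OF _ d])
      fix s assume s: "s \<in> {0..h}"
      then have "norm (s *\<^sub>R v) \<le> 1" using v h by simp
      then have "C * weight (x + s *\<^sub>R v) \<le> C * (8 ^ DIM('a) * weight x)" by (intro mult_left_mono weight_near C)
      then have "norm (dir_deriv v f (x + s *\<^sub>R v)) \<le> C * (8 ^ DIM('a) * weight x)"
        using C(2)[of "x + s *\<^sub>R v"] by linarith
      then have "norm (t *\<^sub>R dir_deriv v f (x + s *\<^sub>R v)) \<le> C * (8 ^ DIM('a) * weight x) * norm t" for t
        using mult_left_mono[of _ _ "\<bar>t\<bar>"] by (simp add: mult.commute[of _ "\<bar>t\<bar>"])
      then show "onorm (\<lambda>t. t *\<^sub>R dir_deriv v f (x + s *\<^sub>R v)) \<le> C * (8 ^ DIM('a) * weight x)"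
        by (rule onorm_le)
    qed (use h in auto)
    then show ?thesis using h by (simp add: \<phi>_def mult_ac)
  qed
  moreover have "C * 8 ^ DIM('a) \<ge> 0" using C by simp
  ultimately show ?thesis by (metis greaterThanAtMost_iff)
qed

text \<open>Translation invariance makes the integral of every difference quotient vanish.\<close>

lemma integral_dir_deriv_eq_0:
  assumes f: "f \<in> schwartz" and v: "v \<in> Basis"
  shows "(\<integral>x. dir_deriv v f x \<partial>lborel) = 0"
proof -
  note [measurable] = schwartzD(5)[OF f]
  have [measurable]: "dir_deriv v f \<in> borel_measurable borel"
    by (intro schwartzD schwartz_dir_deriv f v)
  obtain C where C: "C \<ge> 0" "\<And>x h. 0 < h \<Longrightarrow> h \<le> 1 \<Longrightarrow> norm (f (x + h *\<^sub>R v) - f x) \<le> C * h * weight x"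
    using schwartz_diff_bound[OF f v] by auto
  define h where "h n = inverse (real (Suc n))" for n
  have h: "0 < h n" "h n \<le> 1" for n unfolding h_def by (auto simp: inverse_le_1_iff)
  have h0: "h \<longlonglongrightarrow> 0" unfolding h_def by (rule LIMSEQ_inverse_real_of_nat)
  define q where "q n x = (1 / h n) *\<^sub>R (f (x + h n *\<^sub>R v) - f x)" for n x
  have "(\<lambda>n. \<integral>x. q n x \<partial>lborel) \<longlonglongrightarrow> (\<integral>x. dir_deriv v f x \<partial>lborel)"
  proof (rule integral_dominated_convergence[where w = "\<lambda>x. C * weight x"])
    show "AE x in lborel. (\<lambda>n. q n x) \<longlonglongrightarrow> dir_deriv v f x"
    proof (rule AE_I2)
      fix x
      have D: "(f has_derivative (\<lambda>v. dir_deriv v f x)) (at x)"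
        by (intro dir_deriv_works schwartzD f)
      have "((\<lambda>s. x + s *\<^sub>R v) has_derivative (\<lambda>t. t *\<^sub>R v)) (at 0)"
        by (auto intro!: derivative_eq_intros)
      from has_derivative_compose[OF this, of f "\<lambda>w. dir_deriv w f x"] D
      have "((\<lambda>s. f (x + s *\<^sub>R v)) has_derivative (\<lambda>t. dir_deriv (t *\<^sub>R v) f x)) (at 0)"
        by simp
      also have "(\<lambda>t. dir_deriv (t *\<^sub>R v) f x) = (\<lambda>t. t *\<^sub>R dir_deriv v f x)"
        using linear_scale[OF has_derivative_linear[OF D]] by auto
      finally have "(\<lambda>s. norm (f (x + s *\<^sub>R v) - f x - s *\<^sub>R dir_deriv v f x) / norm s) \<midarrow>0\<rightarrow> 0"
        by (simp add: has_derivative_at)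
      then have "(\<lambda>s. norm ((1 / s) *\<^sub>R (f (x + s *\<^sub>R v) - f x) - dir_deriv v f x)) \<midarrow>0\<rightarrow> 0"
      proof (rule Lim_transform_eventually)
        have "norm (f (x + s *\<^sub>R v) - f x - s *\<^sub>R dir_deriv v f x) / norm s
            = norm ((1 / s) *\<^sub>R (f (x + s *\<^sub>R v) - f x) - dir_deriv v f x)" if "s \<noteq> 0" for s
        proof -
          have "(1 / s) *\<^sub>R (f (x + s *\<^sub>R v) - f x) - dir_deriv v f x
              = (1 / s) *\<^sub>R (f (x + s *\<^sub>R v) - f x - s *\<^sub>R dir_deriv v f x)"
            using that by (simp add: scaleR_diff_right)
          then show ?thesis by simp
        qed
        then show "\<forall>\<^sub>F s in at 0. norm (f (x + s *\<^sub>R v) - f x - s *\<^sub>R dir_deriv v f x) / norm s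
            = norm ((1 / s) *\<^sub>R (f (x + s *\<^sub>R v) - f x) - dir_deriv v f x)"
          by (simp add: eventually_at_filter)
      qed
      then have "((\<lambda>s. (1 / s) *\<^sub>R (f (x + s *\<^sub>R v) - f x)) \<longlongrightarrow> dir_deriv v f x) (at 0)"
        by (rule LIM_zero_cancel[OF tendsto_norm_zero_cancel])
      moreover have "filterlim h (at 0) sequentially"
        using h h0 by (auto simp: filterlim_at eventually_sequentially intro!: exI[of _ 0] less_imp_neq[symmetric])
      ultimately show "(\<lambda>n. q n x) \<longlonglongrightarrow> dir_deriv v f x"
        unfolding q_def by (rule filterlim_compose)
    qed
    show "AE x in lborel. norm (q n x) \<le> C * weight x" for n
    proof (rule AE_I2)
      fix x
      have "norm (q n x) = norm (f (x + h n *\<^sub>R v) - f x) / h n"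
        unfolding q_def norm_scaleR using h(1)[of n] by simp
      then show "norm (q n x) \<le> C * weight x"
        using C(2)[OF h(1)[of n] h(2)[of n], of x] h(1)[of n] by (simp add: divide_le_eq mult_ac)
    qed
  qed (auto simp: q_def[abs_def])
  moreover have "(\<integral>x. q n x \<partial>lborel) = 0" for n
  proof -
    have i: "integrable lborel f" by (intro rapid_measD schwartz_rapid_meas f)
    have "integrable lborel (\<lambda>x. f (h n *\<^sub>R v + 1 *\<^sub>R x))"
      by (subst lborel_integrable_affine) (use i in auto)
    moreover have "(\<integral>x. f x \<partial>lborel) = (\<integral>x. f (h n *\<^sub>R v + 1 *\<^sub>R x) \<partial>lborel)"
      by (subst lborel_integral_affine[of f 1 "h n *\<^sub>R v"]) auto
    ultimately show ?thesis using i by (simp add: q_def add.commute)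
  qed
  ultimately show ?thesis by (simp add: LIMSEQ_const_iff)
qed

text \<open>Integration by parts: the derivative of the product of \<open>f\<close> with a character
  has integral 0.\<close>

lemma fourier_dir_deriv:
  assumes f: "f \<in> schwartz" and v: "v \<in> Basis"
  shows "fourier (dir_deriv v f) k = 2 * of_real pi * \<i> * of_real (k \<bullet> v) * fourier f k"
proof -
  let ?e = "\<lambda>x. cis2 (x \<bullet> (- k))"
  let ?c = "2 * of_real pi * \<i> * of_real (v \<bullet> (- k))"
  have e: "?e \<in> slow" by (rule slow_cis2)
  have "dir_deriv v ?e = (\<lambda>x. ?c * ?e x)"
    using has_derivative_imp_dir_deriv[OF has_derivative_cis2[of 1 "-k"]] by (auto simp: fun_eq_iff)
  then have "dir_deriv v (\<lambda>x. ?e x * f x) = (\<lambda>x. ?e x * dir_deriv v f x + ?c * (?e x * f x))"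
    by (subst dir_deriv_mult[OF smooth_withD(1)[OF e] schwartzD(1)[OF f]]) (simp add: mult_ac)
  moreover have "(\<integral>x. dir_deriv v (\<lambda>x. ?e x * f x) x \<partial>lborel) = 0"
    by (intro integral_dir_deriv_eq_0 slow_mult_schwartz e f v)
  ultimately have "0 = (\<integral>x. ?e x * dir_deriv v f x + ?c * (?e x * f x) \<partial>lborel)" by simp
  also have "\<dots> = (\<integral>x. ?e x * dir_deriv v f x \<partial>lborel) + (\<integral>x. ?c * (?e x * f x) \<partial>lborel)"
    by (intro Bochner_Integration.integral_add integrable_mult_right rapid_measD schwartz_rapid_meas
        slow_mult_schwartz e f schwartz_dir_deriv v)
  also have "(\<integral>x. ?c * (?e x * f x) \<partial>lborel) = ?c * (\<integral>x. ?e x * f x \<partial>lborel)"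
    by (rule integral_mult_right_zero)
  finally have "0 = (\<integral>x. ?e x * dir_deriv v f x \<partial>lborel) + ?c * (\<integral>x. ?e x * f x \<partial>lborel)" .
  moreover have "(\<integral>x. ?e x * g x \<partial>lborel) = fourier g k" for g
    by (simp add: fourier_cis2 inner_commute[of _ k])
  ultimately show ?thesis by (simp add: inner_commute[of v])
qed

lemma norm_le_Basis_max: "\<exists>b\<in>Basis. norm k \<le> DIM('a) * \<bar>(k::'a::euclidean_space) \<bullet> b\<bar>"
proof -
  let ?A = "(\<lambda>b. \<bar>k \<bullet> b\<bar>) ` Basis"
  have "Max ?A \<in> ?A" by (intro Max_in) auto
  then obtain b where b: "b \<in> Basis" "Max ?A = \<bar>k \<bullet> b\<bar>" by (elim imageE)
  have "norm k \<le> (\<Sum>b\<in>Basis. \<bar>k \<bullet> b\<bar>)" by (rule norm_le_l1)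
  also have "\<dots> \<le> of_nat (card (Basis::'a set)) * \<bar>k \<bullet> b\<bar>"
    unfolding b(2)[symmetric] by (intro sum_bounded_above Max_ge) auto
  finally show ?thesis using b by auto
qed

text \<open>Every derivative of \<open>f\<close> along \<open>b\<close> yields a factor
  \<open>k \<bullet> b\<close> in the transform, and the largest coordinate of \<open>k\<close>
  controls its norm.\<close>

lemma fourier_rapid:
  fixes f :: "'a::euclidean_space \<Rightarrow> complex"
  assumes f: "f \<in> schwartz" shows "rapid (fourier f)"
  unfolding rapid_iff_bounded
proof
  fix n
  have *: "\<exists>C\<ge>0. \<forall>k. \<bar>k \<bullet> b\<bar> ^ n * norm (fourier f k) \<le> C" if "b \<in> Basis" for b
    using f
  proof (induction n arbitrary: f)
    case 0
    show ?case
      by (rule exI[of _ "\<integral>x. norm (f x) \<partial>lborel"]) (simp add: norm_fourier_le)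
  next
    case (Suc n)
    from Suc.IH[OF schwartz_dir_deriv[OF Suc.prems that]]
    obtain C where C: "C \<ge> 0" "\<And>k. \<bar>k \<bullet> b\<bar> ^ n * norm (fourier (dir_deriv b f) k) \<le> C" by blast
    have "\<bar>k \<bullet> b\<bar> ^ Suc n * norm (fourier f k) \<le> C / (2 * pi)" for k
      using C(2)[of k] by (simp add: fourier_dir_deriv[OF Suc.prems that] norm_mult field_simps)
    with C(1) show ?case by (intro exI[of _ "C / (2 * pi)"]) auto
  qed
  then obtain C where C: "\<And>b. b \<in> Basis \<Longrightarrow> C b \<ge> 0 \<and> (\<forall>k. \<bar>k \<bullet> b\<bar> ^ n * norm (fourier f k) \<le> C b)"
    by metis
  have "norm (norm k ^ n * norm (fourier f k)) \<le> real DIM('a) ^ n * (\<Sum>b\<in>Basis. C b)" for k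
  proof -
    obtain b where b: "b \<in> Basis" "norm k \<le> DIM('a) * \<bar>k \<bullet> b\<bar>" using norm_le_Basis_max by blast
    have "norm k ^ n * norm (fourier f k) \<le> (DIM('a) * \<bar>k \<bullet> b\<bar>) ^ n * norm (fourier f k)"
      by (intro mult_right_mono power_mono b) auto
    also have "\<dots> = real DIM('a) ^ n * (\<bar>k \<bullet> b\<bar> ^ n * norm (fourier f k))"
      by (simp add: power_mult_distrib)
    also have "\<dots> \<le> real DIM('a) ^ n * C b" using C[OF b(1)] by (intro mult_left_mono) auto
    also have "\<dots> \<le> real DIM('a) ^ n * (\<Sum>b\<in>Basis. C b)"
      using C b(1) by (intro mult_left_mono member_le_sum) auto
    finally show ?thesis by (simp add: abs_mult)
  qed
  then show "bounded (range (\<lambda>k. norm k ^ n * norm (fourier f k)))" by (auto simp: bounded_iff)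
qed

lemma fourier_schwartz [intro]:
  assumes "f \<in> schwartz" shows "fourier f \<in> schwartz"
  unfolding schwartz_eq
proof (rule smooth_with_coinduct[of _ "fourier ` schwartz"])
  fix g :: "'a \<Rightarrow> complex" and v :: 'a
  assume "g \<in> fourier ` schwartz"
  then obtain f where f: "f \<in> schwartz" and g: "g = fourier f" by blast
  note d = fourier_has_derivative[OF schwartz_rapid_meas[OF f]]
  show "g differentiable_on UNIV \<and> rapid g"
    using smooth_withD(1)[OF fourier_slow[OF schwartz_rapid_meas[OF f]]] fourier_rapid[OF f] by (simp add: g)
  have "dir_deriv v g = fourier (\<lambda>x. - 2 * of_real pi * \<i> * (of_real (x \<bullet> v) * f x))"
    unfolding g by (intro ext has_derivative_imp_dir_deriv d)
  moreover have "(\<lambda>x. - 2 * of_real pi * \<i> * (of_real (x \<bullet> v) * f x)) \<in> schwartz"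
    by (intro schwartz_cmult slow_mult_schwartz slow_inner f)
  ultimately show "dir_deriv v g \<in> fourier ` schwartz" by blast
qed (use assms in blast)

lemma fourier_affine:
  fixes f :: "'a::euclidean_space \<Rightarrow> complex"
  assumes [measurable]: "f \<in> borel_measurable borel" and c: "c > 0"
  shows "fourier (\<lambda>y. f (c *\<^sub>R (y - k))) x = (1 / c ^ DIM('a)) *\<^sub>R (cis2 (- (x \<bullet> k)) * fourier f (x /\<^sub>R c))"
proof -
  have "fourier (\<lambda>y. f (c *\<^sub>R (y - k))) x = \<bar>1 / c\<bar> ^ DIM('a) *\<^sub>R
      (\<integral>u. cis2 (- (x \<bullet> (k + (1 / c) *\<^sub>R u))) * f (c *\<^sub>R ((k + (1 / c) *\<^sub>R u) - k)) \<partial>lborel)"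
    unfolding fourier_cis2
    by (rule lborel_integral_affine) (use c in auto)
  also have "(\<lambda>u. cis2 (- (x \<bullet> (k + (1 / c) *\<^sub>R u))) * f (c *\<^sub>R ((k + (1 / c) *\<^sub>R u) - k)))
      = (\<lambda>u. cis2 (- (x \<bullet> k)) * (cis2 (- ((x /\<^sub>R c) \<bullet> u)) * f u))"
  proof
    fix u
    show "cis2 (- (x \<bullet> (k + (1 / c) *\<^sub>R u))) * f (c *\<^sub>R ((k + (1 / c) *\<^sub>R u) - k))
       = cis2 (- (x \<bullet> k)) * (cis2 (- ((x /\<^sub>R c) \<bullet> u)) * f u)"
      using c cis2_add[of "- (x \<bullet> k)" "- ((x /\<^sub>R c) \<bullet> u)"]
      by (simp add: inner_add_right divide_inverse)
  qed
  finally show ?thesis using c unfolding fourier_cis2 by (simp add: power_divide)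
qed

section \<open>The Gaussian as its own transform\<close>

lemma gauss_real_fourier:
  "(\<integral>x. cis2 (- (k * x)) * of_real (exp (- (pi * x\<^sup>2))) \<partial>lborel) = complex_of_real (exp (- (pi * k\<^sup>2)))"
proof -
  \<comment> \<open>With s^2 = 2 pi, the substitution x -> s x turns the standard normal density
    into exp (- pi x^2), with the Jacobian cancelling the normalising constant.\<close>
  define s where "s = sqrt (2 * pi)"
  have s: "s > 0" "s\<^sup>2 = 2 * pi" by (auto simp: s_def)
  have "complex_of_real (exp (- ((s * k)\<^sup>2) / 2)) = char std_normal_distribution (- s * k)"
    by (simp add: char_std_normal_distribution)
  also have "\<dots> = (\<integral>x. std_normal_density x *\<^sub>R iexp (- s * k * x) \<partial>lborel)"
    unfolding char_def by (subst integral_density) (auto simp: normal_density_nonneg)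
  also have "\<dots> = \<bar>s\<bar> *\<^sub>R (\<integral>x. std_normal_density (0 + s * x) *\<^sub>R iexp (- s * k * (0 + s * x)) \<partial>lborel)"
    by (rule lborel_integral_real_affine) (use s in auto)
  also have "\<dots> = (\<integral>x. s *\<^sub>R (std_normal_density (0 + s * x) *\<^sub>R iexp (- s * k * (0 + s * x))) \<partial>lborel)"
    using s by (simp only: integral_scaleR_right abs_of_pos)
  also have "\<dots> = (\<integral>x. cis2 (- (k * x)) * of_real (exp (- (pi * x\<^sup>2))) \<partial>lborel)"
  proof (rule Bochner_Integration.integral_cong[OF refl])
    fix x
    have eq1: "s * std_normal_density (s * x) = exp (- (pi * x\<^sup>2))"
      using s by (simp add: std_normal_density_def s_def[symmetric] power_mult_distrib)
    have eq2: "iexp (- s * k * (s * x)) = cis2 (- (k * x))"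
    proof -
      have "- s * k * (s * x) = 2 * pi * (- (k * x))" using s(2) by (simp add: power2_eq_square)
      then show ?thesis by (simp only: cis2_eq cis_conv_exp)
    qed
    show "s *\<^sub>R (std_normal_density (0 + s * x) *\<^sub>R iexp (- s * k * (0 + s * x)))
        = cis2 (- (k * x)) * of_real (exp (- (pi * x\<^sup>2)))"
      by (simp only: add_0 scaleR_scaleR eq1 eq2) (simp add: scaleR_conv_of_real mult.commute)
  qed
  finally show ?thesis using s by (simp add: power_mult_distrib)
qed

text \<open>Gaussian and character both factor over the coordinates, which leaves a product of
  one-dimensional integrals.\<close>

lemma fourier_gauss_pi: "fourier (gauss pi) = (gauss pi :: 'a::euclidean_space \<Rightarrow> complex)"
proof
  fix k :: 'a
  have i: "integrable lborel (\<lambda>x. cis2 (- (k \<bullet> b * x)) * complex_of_real (exp (- (pi * x\<^sup>2))))" for b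
  proof -
    have "integrable lborel (\<lambda>x::real. cis2 ((- (k \<bullet> b)) \<bullet> x) * gauss pi x)"
      by (intro cis2_integrable rapid_measD schwartz_rapid_meas gauss_schwartz) auto
    then show ?thesis by (simp add: gauss_def power2_eq_square)
  qed
  have cis2_sum: "cis2 (- (\<Sum>b\<in>A. g b)) = (\<Prod>b\<in>A. cis2 (- g b))" if "finite A" for A and g :: "'a \<Rightarrow> real"
    using that
  proof (induction A rule: finite_induct)
    case (insert x F)
    then show ?case using cis2_add[of "- g x" "- sum g F"] by simp
  qed simp
  have "cis2 (- (k \<bullet> x)) * gauss pi x = (\<Prod>b\<in>Basis. cis2 (- (k \<bullet> b * (x \<bullet> b))) * complex_of_real (exp (- (pi * (x \<bullet> b)\<^sup>2))))" for x
    by (simp add: prod.distrib cis2_sum[symmetric] gauss_def exp_sum[symmetric] sum_negf sum_distrib_left[symmetric]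
       flip: of_real_prod) (simp add: euclidean_inner[of k x] euclidean_inner[of x x] power2_eq_square)
  then have "fourier (gauss pi) k = (\<integral>x. (\<Prod>b\<in>Basis. cis2 (- (k \<bullet> b * (x \<bullet> b))) * complex_of_real (exp (- (pi * (x \<bullet> b)\<^sup>2)))) \<partial>lborel)"
    unfolding fourier_cis2 by simp
  also have "\<dots> = (\<Prod>b\<in>Basis. complex_of_real (exp (- (pi * (k \<bullet> b)\<^sup>2))))"
    by (subst lborel_integral_prod[OF i]) (simp_all add: gauss_real_fourier)
  also have "\<dots> = gauss pi k"
    by (simp add: gauss_def exp_sum[symmetric] sum_negf sum_distrib_left[symmetric] flip: of_real_prod)
      (simp add: euclidean_inner[of k k] power2_eq_square)
  finally show "fourier (gauss pi) k = gauss pi k" .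
qed

section \<open>Convolution and exchange of integrals\<close>

lemma fubini_kernel:
  fixes K :: "'a::euclidean_space \<Rightarrow> 'a \<Rightarrow> complex" and g h :: "'a \<Rightarrow> complex"
  assumes [measurable]: "(\<lambda>(x, y). K x y) \<in> borel_measurable (borel \<Otimes>\<^sub>M borel)"
    and K: "\<And>x y. norm (K x y) \<le> 1"
    and g: "integrable lborel g" and h: "integrable lborel h"
  shows "(\<integral>x. (\<integral>y. K x y * (g x * h (y - x)) \<partial>lborel) \<partial>lborel) = (\<integral>y. (\<integral>x. K x y * (g x * h (y - x)) \<partial>lborel) \<partial>lborel)"
    and "(\<integral>x. (\<integral>y. K x y * (g x * h y) \<partial>lborel) \<partial>lborel) = (\<integral>y. (\<integral>x. K x y * (g x * h y) \<partial>lborel) \<partial>lborel)"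
proof -
  have [measurable]: "g \<in> borel_measurable borel" "h \<in> borel_measurable borel"
    using borel_measurable_integrable[OF g] borel_measurable_integrable[OF h] by auto
  have hs: "integrable lborel (\<lambda>y. h (y - x))" and hn: "(\<integral>y. norm (h (y - x)) \<partial>lborel) = (\<integral>y. norm (h y) \<partial>lborel)" for x
    using lborel_integrable_affine[of h 1 "-x"] h lborel_integral_affine[of "\<lambda>y. norm (h y)" 1 "-x"] by (auto simp: algebra_simps)
  \<comment> \<open>\<open>H\<close> stands for either second factor, \<open>h (y - x)\<close> or
    \<open>h y\<close>; in both cases the L1 norm in \<open>y\<close> is the same for every
    \<open>x\<close>.\<close>
  have F: "(\<integral>x. (\<integral>y. K x y * (g x * H x y) \<partial>lborel) \<partial>lborel) = (\<integral>y. (\<integral>x. K x y * (g x * H x y) \<partial>lborel) \<partial>lborel)"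
    if [measurable]: "(\<lambda>(x, y). H x y) \<in> borel_measurable (borel \<Otimes>\<^sub>M borel)"
      and Hi: "\<And>x. integrable lborel (H x)"
      and Hn: "\<And>x. (\<integral>y. norm (H x y) \<partial>lborel) = (\<integral>y. norm (h y) \<partial>lborel)" for H :: "'a \<Rightarrow> 'a \<Rightarrow> complex"
  proof (rule lborel_pair.Fubini_integral[symmetric], rule lborel_pair.Fubini_integrable)
    show [measurable]: "(\<lambda>(x, y). K x y * (g x * H x y)) \<in> borel_measurable (lborel \<Otimes>\<^sub>M lborel)"
      by measurable
    have b: "norm (K x y * (g x * H x y)) \<le> norm (g x) * norm (H x y)" for x y
      using mult_right_mono[OF K[of x y], of "norm (g x * H x y)"] by (simp add: norm_mult)
    have i: "integrable lborel (\<lambda>y. K x y * (g x * H x y))" for x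
    proof (rule Bochner_Integration.integrable_bound)
      show "integrable lborel (\<lambda>y. norm (g x) * norm (H x y))" using Hi by auto
    qed (use b in auto)
    then show "AE x in lborel. integrable lborel (\<lambda>y. case (x, y) of (x, y) \<Rightarrow> K x y * (g x * H x y))" by simp
    show "integrable lborel (\<lambda>x. \<integral>y. norm (case (x, y) of (x, y) \<Rightarrow> K x y * (g x * H x y)) \<partial>lborel)"
    proof (rule Bochner_Integration.integrable_bound)
      show "integrable lborel (\<lambda>x. norm (g x) * (\<integral>y. norm (h y) \<partial>lborel))" using g by auto
      have "(\<integral>y. norm (K x y * (g x * H x y)) \<partial>lborel) \<le> (\<integral>y. norm (g x) * norm (H x y) \<partial>lborel)" for x
        using i b Hi by (intro integral_mono) auto
      then show "AE x in lborel. norm (\<integral>y. norm (case (x, y) of (x, y) \<Rightarrow> K x y * (g x * H x y)) \<partial>lborel)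
         \<le> norm (norm (g x) * (\<integral>y. norm (h y) \<partial>lborel))"
        by (auto simp: Hn)
    qed measurable
  qed
  show "(\<integral>x. (\<integral>y. K x y * (g x * h (y - x)) \<partial>lborel) \<partial>lborel) = (\<integral>y. (\<integral>x. K x y * (g x * h (y - x)) \<partial>lborel) \<partial>lborel)"
    by (rule F) (use hs hn in auto)
  show "(\<integral>x. (\<integral>y. K x y * (g x * h y) \<partial>lborel) \<partial>lborel) = (\<integral>y. (\<integral>x. K x y * (g x * h y) \<partial>lborel) \<partial>lborel)"
    by (rule F) (use h in auto)
qed

lemma fourier_convolve:
  fixes g h :: "'a::euclidean_space \<Rightarrow> complex"
  assumes "integrable lborel g" "integrable lborel h"
  shows "fourier (convolve g h) k = fourier g k * fourier h k"
proof -
  have [measurable]: "h \<in> borel_measurable borel"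
    using borel_measurable_integrable[OF assms(2)] by auto
  have "fourier (convolve g h) k = (\<integral>y. (\<integral>x. cis2 (- (k \<bullet> y)) * (g x * h (y - x)) \<partial>lborel) \<partial>lborel)"
    unfolding fourier_cis2 convolve_def by simp
  also have "\<dots> = (\<integral>x. (\<integral>y. cis2 (- (k \<bullet> y)) * (g x * h (y - x)) \<partial>lborel) \<partial>lborel)"
    by (rule fubini_kernel(1)[OF _ _ assms, symmetric]) auto
  also have "\<dots> = (\<integral>x. cis2 (- (k \<bullet> x)) * g x * fourier h k \<partial>lborel)"
  proof (rule Bochner_Integration.integral_cong[OF refl])
    fix x
    have "(\<integral>y. cis2 (- (k \<bullet> y)) * (g x * h (y - x)) \<partial>lborel)
       = (\<integral>y. cis2 (- (k \<bullet> (x + 1 *\<^sub>R y))) * (g x * h ((x + 1 *\<^sub>R y) - x)) \<partial>lborel)"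
      by (subst lborel_integral_affine[where c = 1 and t = x]) auto
    also have "\<dots> = (\<integral>y. cis2 (- (k \<bullet> x)) * g x * (cis2 (- (k \<bullet> y)) * h y) \<partial>lborel)"
      by (intro Bochner_Integration.integral_cong refl)
        (use cis2_add[of "- (k \<bullet> x)" "- (k \<bullet> _)"] in \<open>simp add: inner_add_right mult_ac\<close>)
    finally show "(\<integral>y. cis2 (- (k \<bullet> y)) * (g x * h (y - x)) \<partial>lborel) = cis2 (- (k \<bullet> x)) * g x * fourier h k"
      by (simp add: fourier_cis2)
  qed
  finally show ?thesis by (simp add: fourier_cis2)
qed

text \<open>With a Gaussian for \<open>p\<close> this is the mollification identity. It asks only
  for integrability of \<open>g\<close>, so it applies to functions in \<open>Cc\<close> that are
  not smooth.\<close>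

lemma fourier_mult_inv_fourier:
  fixes g p :: "'a::euclidean_space \<Rightarrow> complex"
  assumes "integrable lborel g" "integrable lborel p"
  shows "fourier (\<lambda>y. inv_fourier g y * p y) t = convolve g (fourier p) t"
proof -
  have "fourier (\<lambda>y. inv_fourier g y * p y) t = (\<integral>y. (\<integral>x. cis2 (y \<bullet> x) * cis2 (- (t \<bullet> y)) * (g x * p y) \<partial>lborel) \<partial>lborel)"
    unfolding fourier_cis2
  proof (rule Bochner_Integration.integral_cong[OF refl])
    fix y
    have "cis2 (- (t \<bullet> y)) * (inv_fourier g y * p y) = (cis2 (- (t \<bullet> y)) * p y) * inv_fourier g y"
      by simp
    also have "\<dots> = (\<integral>x. (cis2 (- (t \<bullet> y)) * p y) * (cis2 (y \<bullet> x) * g x) \<partial>lborel)"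
      unfolding inv_fourier_cis2 by (rule integral_mult_right_zero[symmetric])
    finally show "cis2 (- (t \<bullet> y)) * (inv_fourier g y * p y) =
        (\<integral>x. cis2 (y \<bullet> x) * cis2 (- (t \<bullet> y)) * (g x * p y) \<partial>lborel)"
      by (simp only: mult_ac)
  qed
  also have "\<dots> = (\<integral>x. (\<integral>y. cis2 (y \<bullet> x) * cis2 (- (t \<bullet> y)) * (g x * p y) \<partial>lborel) \<partial>lborel)"
    by (rule fubini_kernel(2)[OF _ _ assms, symmetric]) (auto simp: norm_mult)
  also have "\<dots> = (\<integral>x. g x * fourier p (t - x) \<partial>lborel)"
  proof (rule Bochner_Integration.integral_cong[OF refl])
    fix x
    have eq: "cis2 (y \<bullet> x) * cis2 (- (t \<bullet> y)) * (g x * p y) = g x * (cis2 (- ((t - x) \<bullet> y)) * p y)" for y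
      using cis2_add[of "y \<bullet> x" "- (t \<bullet> y)"] by (simp add: inner_diff_left inner_commute[of y x] mult_ac)
    show "(\<integral>y. cis2 (y \<bullet> x) * cis2 (- (t \<bullet> y)) * (g x * p y) \<partial>lborel) = g x * fourier p (t - x)"
      by (simp only: eq fourier_cis2 integral_mult_right_zero)
  qed
  finally show ?thesis by (simp add: convolve_def)
qed

lemma convolve_Cc:
  fixes f g :: "'a::euclidean_space \<Rightarrow> complex"
  assumes f: "f \<in> Cc" and g: "g \<in> Cc" shows "convolve f g \<in> Cc"
proof -
  note [measurable] = CcD(2)[OF f] CcD(2)[OF g]
  obtain r where r: "r > 0" "\<And>x. norm x > r \<Longrightarrow> f x = 0" using CcD(3)[OF f] by blast
  obtain s where s: "s > 0" "\<And>x. norm x > s \<Longrightarrow> g x = 0" using CcD(3)[OF g] by blast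
  obtain B where B: "B > 0" "\<And>x. norm (g x) \<le> B" using Cc_bounded[OF g] by blast
  have "convolve f g x = 0" if "norm x > r + s" for x
  proof -
    have z: "f y * g (x - y) = 0" for y
    proof (cases "norm y > r")
      case False
      then have "norm (x - y) > s" using that norm_triangle_ineq2[of x y] by linarith
      then show ?thesis by (simp add: s)
    qed (simp add: r)
    show ?thesis unfolding convolve_def by (simp only: z Bochner_Integration.integral_zero)
  qed
  moreover have "continuous_on UNIV (convolve f g)"
    unfolding continuous_on_eq_continuous_at[OF open_UNIV] continuous_at_sequentially o_def
  proof (intro ballI allI impI)
    fix x and u :: "nat \<Rightarrow> 'a" assume u: "u \<longlonglongrightarrow> x"
    show "(\<lambda>n. convolve f g (u n)) \<longlonglongrightarrow> convolve f g x"
      unfolding convolve_def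
    proof (rule integral_dominated_convergence[where w = "\<lambda>y. norm (f y) * B"])
      show "integrable lborel (\<lambda>y. norm (f y) * B)"
        using rapid_measD(3)[OF Cc_rapid_meas[OF f]] by auto
      have "(\<lambda>n. g (u n - y)) \<longlonglongrightarrow> g (x - y)" for y
        by (rule continuous_on_tendsto_compose[OF CcD(1)[OF g]]) (auto intro!: tendsto_intros u)
      then show "AE y in lborel. (\<lambda>n. f y * g (u n - y)) \<longlonglongrightarrow> f y * g (x - y)"
        by (intro AE_I2 tendsto_intros)
      show "AE y in lborel. norm (f y * g (u n - y)) \<le> norm (f y) * B" for n
        unfolding norm_mult using B by (intro AE_I2 mult_left_mono) auto
    qed measurable
  qed
  ultimately show ?thesis by (intro CcI(1)[of _ "r + s"])
qed


section \<open>Sums over weakly uniformly discrete sets\<close>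

text \<open>Cover \<open>K\<close> by finitely many balls of half the separation distance: every
  translate of such a ball contains at most one point of \<Lambda>, so the size of the cover bounds
  the count for all translates.\<close>

lemma uniform_discrete_imp_weakly:
  fixes \<Lambda> :: "'a::euclidean_space set"
  assumes "uniform_discrete \<Lambda>" shows "weakly_uniformly_discrete \<Lambda>"
  unfolding weakly_uniformly_discrete_def
proof (intro allI impI)
  fix K :: "'a set" assume "compact K"
  obtain e where e: "e > 0" "\<And>x y. x \<in> \<Lambda> \<Longrightarrow> y \<in> \<Lambda> \<Longrightarrow> dist x y < e \<Longrightarrow> x = y"
    using assms unfolding uniform_discrete_def by blast
  obtain D where D: "finite D" "K \<subseteq> (\<Union>z\<in>D. ball z (e/2))"
    using \<open>compact K\<close> e(1) unfolding compact_eq_totally_bounded by (meson half_gt_zero)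
  have "finite (\<Lambda> \<inter> (+) x ` K) \<and> card (\<Lambda> \<inter> (+) x ` K) \<le> card D" for x
  proof -
    have "\<forall>y\<in>\<Lambda> \<inter> (+) x ` K. \<exists>z\<in>D. dist (x + z) y < e/2"
    proof
      fix y assume "y \<in> \<Lambda> \<inter> (+) x ` K"
      then obtain u where u: "u \<in> K" "y = x + u" by auto
      with D obtain z where "z \<in> D" "dist z u < e/2" by auto
      with u show "\<exists>z\<in>D. dist (x + z) y < e/2" by auto
    qed
    then obtain \<zeta> where \<zeta>: "\<And>y. y \<in> \<Lambda> \<inter> (+) x ` K \<Longrightarrow> \<zeta> y \<in> D \<and> dist (x + \<zeta> y) y < e/2" by metis
    have "inj_on \<zeta> (\<Lambda> \<inter> (+) x ` K)"
    proof (rule inj_onI)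
      fix y y' assume y: "y \<in> \<Lambda> \<inter> (+) x ` K" "y' \<in> \<Lambda> \<inter> (+) x ` K" "\<zeta> y = \<zeta> y'"
      then have "dist (x + \<zeta> y) y < e/2" "dist (x + \<zeta> y) y' < e/2" using \<zeta> by metis+
      then have "dist y y' < e" by (metis dist_commute dist_triangle_half_r)
      then show "y = y'" using e y by blast
    qed
    moreover have "\<zeta> ` (\<Lambda> \<inter> (+) x ` K) \<subseteq> D" using \<zeta> by blast
    ultimately show ?thesis using D(1) by (metis card_inj_on_le inj_on_finite)
  qed
  then show "\<exists>n. \<forall>x. finite (\<Lambda> \<inter> (+) x ` K) \<and> card (\<Lambda> \<inter> (+) x ` K) \<le> n" by blast
qed

lemma wud_finite_cball:
  fixes S :: "'a::euclidean_space set"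
  assumes "weakly_uniformly_discrete S"
  shows "finite (S \<inter> cball x r)"
    and "\<exists>n. \<forall>x. card (S \<inter> cball x r) \<le> n"
proof -
  have "(+) x ` cball 0 r = cball x r" for x :: 'a by simp
  with assms obtain n where n: "\<And>x. finite (S \<inter> cball x r)" "\<And>x. card (S \<inter> cball x r) \<le> n"
    unfolding weakly_uniformly_discrete_def by (metis compact_cball)
  then show "finite (S \<inter> cball x r)" "\<exists>n. \<forall>x. card (S \<inter> cball x r) \<le> n" by blast+
qed

text \<open>The sum is compared with an integral: the dilated weight varies by a bounded factor on
  unit balls, and the unit balls around points of \<open>S\<close> overlap a bounded number of
  times. The power of \<open>T\<close> is the Jacobian of the dilation.\<close>

lemma wud_sum_weight:
  fixes S :: "'a::euclidean_space set"
  assumes "weakly_uniformly_discrete S"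
  shows "\<exists>C\<ge>0. \<forall>t T F. T \<ge> 1 \<longrightarrow> finite F \<longrightarrow> F \<subseteq> S \<longrightarrow>
    (\<Sum>y\<in>F. weight ((1/T) *\<^sub>R (y - t))) \<le> C * T ^ DIM('a)"
proof -
  obtain n where n: "\<And>x. card (S \<inter> cball x 1) \<le> n" using wud_finite_cball(2)[OF assms] by metis
  define V where "V = measure lborel (cball (0::'a) 1)"
  have V: "V > 0" unfolding V_def using content_cball_pos[of 1 "0::'a"] by simp
  define I where "I = integral\<^sup>L lborel (weight :: 'a \<Rightarrow> real)"
  have I: "I \<ge> 0" unfolding I_def by (intro Bochner_Integration.integral_nonneg) auto
  \<comment> \<open>\<open>8 ^ DIM('a)\<close> comes from \<open>weight_near\<close>,
    \<open>n\<close> bounds the overlap of the balls, and I / V compares the total mass of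
    \<open>weight\<close> with the volume of one ball.\<close>
  have "(\<Sum>y\<in>F. weight ((1/T) *\<^sub>R (y - t))) \<le> (8 ^ DIM('a) * n * I / V) * T ^ DIM('a)"
    if T: "T \<ge> 1" and F: "finite F" "F \<subseteq> S" for t T F
  proof -
    define u where "u x = weight ((1/T) *\<^sub>R (x - t))" for x
    have [measurable]: "u \<in> borel_measurable borel" unfolding u_def by measurable
    have ui: "integrable lborel u"
    proof -
      have "integrable lborel (\<lambda>x. weight (-(1/T) *\<^sub>R t + (1/T) *\<^sub>R x))"
        using T by (subst lborel_integrable_affine) auto
      then show ?thesis unfolding u_def by (simp add: scaleR_diff_right)
    qed
    have uI: "(\<integral>x. u x \<partial>lborel) = I * T ^ DIM('a)"
    proof -
      have "I = \<bar>1/T\<bar> ^ DIM('a) *\<^sub>R (\<integral>x. weight (-(1/T) *\<^sub>R t + (1/T) *\<^sub>R x) \<partial>lborel)"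
        unfolding I_def using T by (intro lborel_integral_affine) auto
      then show ?thesis using T unfolding u_def by (simp add: scaleR_diff_right power_divide field_simps)
    qed
    have ind: "integrable lborel (\<lambda>x. u x * indicator (cball y 1) x)" for y
      by (rule Bochner_Integration.integrable_bound[OF ui]) (auto simp: indicator_def u_def)
    have 1: "V * u y \<le> 8 ^ DIM('a) * (\<integral>x. u x * indicator (cball y 1) x \<partial>lborel)" for y
    proof -
      have "V * u y = (\<integral>x. u y * indicator (cball y 1) x \<partial>lborel)"
        by (simp add: V_def content_cball)
      also have "\<dots> \<le> (\<integral>x. 8 ^ DIM('a) * (u x * indicator (cball y 1) x) \<partial>lborel)"
      proof (rule integral_mono)
        show "integrable lborel (\<lambda>x. u y * indicator (cball y 1) x)"
          by (intro integrable_mult_right integrable_real_indicator) (auto simp: emeasure_cball)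
        show "integrable lborel (\<lambda>x. 8 ^ DIM('a) * (u x * indicator (cball y 1) x))"
          by (intro integrable_mult_right ind)
        fix x
        show "u y * indicator (cball y 1) x \<le> 8 ^ DIM('a) * (u x * indicator (cball y 1) x)"
        proof (cases "x \<in> cball y 1")
          case True
          have "norm ((1/T) *\<^sub>R (y - x)) \<le> 1"
            using True T by (simp add: dist_norm divide_le_eq)
          from weight_near[OF this, of "(1/T) *\<^sub>R (x - t)"] True
          show ?thesis by (simp add: u_def scaleR_diff_right)
        qed simp
      qed
      finally show ?thesis by simp
    qed
    have "V * (\<Sum>y\<in>F. u y) \<le> (\<Sum>y\<in>F. 8 ^ DIM('a) * (\<integral>x. u x * indicator (cball y 1) x \<partial>lborel))"
      unfolding sum_distrib_left by (intro sum_mono 1)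
    also have "\<dots> = 8 ^ DIM('a) * (\<integral>x. (\<Sum>y\<in>F. u x * indicator (cball y 1) x) \<partial>lborel)"
      by (subst Bochner_Integration.integral_sum) (use ind in \<open>auto simp: sum_distrib_left\<close>)
    also have "(\<integral>x. (\<Sum>y\<in>F. u x * indicator (cball y 1) x) \<partial>lborel) \<le> (\<integral>x. n * u x \<partial>lborel)"
    proof (rule integral_mono)
      show "integrable lborel (\<lambda>x. \<Sum>y\<in>F. u x * indicator (cball y 1) x)"
        by (intro Bochner_Integration.integrable_sum ind)
      show "integrable lborel (\<lambda>x. n * u x)" using ui by simp
      fix x
      have "(\<Sum>y\<in>F. u x * indicator (cball y 1) x) = u x * (\<Sum>y\<in>F. if y \<in> cball x 1 then 1 else 0)"
        by (simp add: sum_distrib_left indicator_def of_bool_def dist_commute)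
      also have "(\<Sum>y\<in>F. if y \<in> cball x 1 then 1 else 0) = real (card (F \<inter> cball x 1))"
        using F(1) by (simp add: sum.If_cases del: mem_cball)
      also have "card (F \<inter> cball x 1) \<le> card (S \<inter> cball x 1)"
        using F wud_finite_cball(1)[OF assms] by (intro card_mono) auto
      then have "real (card (F \<inter> cball x 1)) \<le> n" using n[of x] by linarith
      then have "u x * real (card (F \<inter> cball x 1)) \<le> u x * n" by (intro mult_left_mono) (auto simp: u_def)
      finally show "(\<Sum>y\<in>F. u x * indicator (cball y 1) x) \<le> n * u x" by (simp add: mult.commute)
    qed
    finally have "V * (\<Sum>y\<in>F. u y) \<le> 8 ^ DIM('a) * (n * (I * T ^ DIM('a)))"
      by (simp add: uI)
    then show ?thesis using V by (simp add: u_def field_simps)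
  qed
  moreover have "8 ^ DIM('a) * n * I / V \<ge> 0" using V I by simp
  ultimately show ?thesis by (intro exI[of _ "8 ^ DIM('a) * n * I / V"] conjI allI impI)
qed

lemma wud_summable_weight:
  fixes S :: "'a::euclidean_space set"
  assumes "weakly_uniformly_discrete S" "T \<ge> 1"
  shows "(\<lambda>y. weight ((1/T) *\<^sub>R (y - t))) summable_on S"
proof -
  obtain C where C: "\<And>t T F. T \<ge> 1 \<Longrightarrow> finite F \<Longrightarrow> F \<subseteq> S \<Longrightarrow>
    (\<Sum>y\<in>F. weight ((1/T) *\<^sub>R (y - t))) \<le> C * T ^ DIM('a)" using wud_sum_weight[OF assms(1)] by blast
  show ?thesis
  proof (rule nonneg_bdd_above_summable_on)
    show "bdd_above (sum (\<lambda>y. weight ((1/T) *\<^sub>R (y - t))) ` {F. F \<subseteq> S \<and> finite F})"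
      using C[OF assms(2)] by (intro bdd_aboveI2) blast
  qed simp
qed

lemma wud_summable_le_weight:
  fixes S :: "'a::euclidean_space set" and f :: "'a \<Rightarrow> 'b::banach"
  assumes "weakly_uniformly_discrete S" "\<And>y. y \<in> S \<Longrightarrow> norm (f y) \<le> C * weight y"
  shows "(\<lambda>y. norm (f y)) summable_on S" "f summable_on S"
proof -
  have "(\<lambda>y. C * weight y) summable_on S"
    using wud_summable_weight[OF assms(1), of 1 0] by (intro summable_on_cmult_right) auto
  then show "(\<lambda>y. norm (f y)) summable_on S"
    by (rule Infinite_Sum.abs_summable_on_comparison_test') (rule assms(2))
  then show "f summable_on S" by (rule abs_summable_summable)
qed

lemma schwartz_lipschitz:
  fixes f :: "'a::euclidean_space \<Rightarrow> complex"
  assumes f: "f \<in> schwartz"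
  shows "\<exists>L\<ge>0. \<forall>x y. norm (f x - f y) \<le> L * norm (x - y)"
proof -
  have "\<exists>C\<ge>0. \<forall>x. norm (dir_deriv b f x) \<le> C" if "b \<in> Basis" for b
    using rapidD[OF schwartzD(4)[OF schwartz_dir_deriv[OF f that]], of 0] by simp
  then obtain C where C: "\<And>b x. b \<in> Basis \<Longrightarrow> 0 \<le> C b \<and> norm (dir_deriv b f x) \<le> C b" by metis
  have "norm (f x - f y) \<le> (\<Sum>b\<in>Basis. C b) * norm (x - y)" for x y
  proof (rule differentiable_bound[of UNIV])
    fix x
    show D: "(f has_derivative (\<lambda>v. dir_deriv v f x)) (at x within UNIV)"
      by (rule dir_deriv_works[OF schwartzD(2)[OF f]])
    have "onorm (\<lambda>v. dir_deriv v f x) \<le> (\<Sum>b\<in>Basis. norm (dir_deriv b f x))"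
      by (intro onorm_componentwise has_derivative_bounded_linear[OF D])
    also have "\<dots> \<le> (\<Sum>b\<in>Basis. C b)" using C by (intro sum_mono) auto
    finally show "onorm (\<lambda>v. dir_deriv v f x) \<le> (\<Sum>b\<in>Basis. C b)" .
  qed auto
  moreover have "(\<Sum>b\<in>Basis. C b) \<ge> 0" using C by (intro sum_nonneg) auto
  ultimately show ?thesis by blast
qed

section \<open>Tempered distributions given by point sums\<close>

lemma schwartz_seminorm_le:
  assumes "\<And>x. norm x ^ k * norm (iter_deriv vs f x) \<le> C"
  shows "schwartz_seminorm k vs f \<le> C"
  unfolding schwartz_seminorm_def by (rule cSUP_least) (use assms in auto)

text \<open>Arbitrary pointwise majorants \<open>c k vs\<close> take the place of the seminorms, so
  that the later estimates need not handle suprema.\<close>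

lemma tempered_seminorm_bound:
  fixes T :: "'a::euclidean_space functional"
  assumes "tempered_distribution T"
  obtains C N where "C \<ge> 0" "\<And>f c. f \<in> schwartz \<Longrightarrow>
    (\<forall>k vs x. k \<le> N \<longrightarrow> set vs \<subseteq> Basis \<longrightarrow> length vs \<le> N \<longrightarrow>
      norm x ^ k * norm (iter_deriv vs f x) \<le> c k vs) \<Longrightarrow>
    norm (T f) \<le> C * (\<Sum>k\<le>N. \<Sum>vs\<in>{vs. set vs \<subseteq> Basis \<and> length vs \<le> N}. c k vs)"
proof -
  obtain C N where C: "\<And>f. f \<in> schwartz \<Longrightarrow> norm (T f) \<le>
      C * (\<Sum>k\<le>N. \<Sum>vs\<in>{vs. set vs \<subseteq> Basis \<and> length vs \<le> N}. schwartz_seminorm k vs f)"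
    using assms unfolding tempered_distribution_def by blast
  have "norm (T f) \<le> \<bar>C\<bar> * (\<Sum>k\<le>N. \<Sum>vs\<in>{vs. set vs \<subseteq> Basis \<and> length vs \<le> N}. c k vs)"
    if f: "f \<in> schwartz" and c: "\<And>k vs x. k \<le> N \<Longrightarrow> set vs \<subseteq> Basis \<Longrightarrow> length vs \<le> N \<Longrightarrow>
      norm x ^ k * norm (iter_deriv vs f x) \<le> c k vs" for f c
  proof -
    let ?S = "\<Sum>k\<le>N. \<Sum>vs\<in>{vs. set vs \<subseteq> Basis \<and> length vs \<le> N}. schwartz_seminorm k vs f"
    have "bounded (range (\<lambda>x. norm x ^ k * norm (iter_deriv vs f x)))" if "set vs \<subseteq> Basis" for k vs
      using f that by (auto simp: schwartz_def)
    then have "0 \<le> schwartz_seminorm k vs f" if "set vs \<subseteq> Basis" for k vs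
      unfolding schwartz_seminorm_def using that
      by (intro cSUP_upper2[of _ _ 0] bounded_imp_bdd_above) auto
    then have "0 \<le> ?S" by (intro sum_nonneg) auto
    \<comment> \<open>The constant in \<open>tempered_distribution\<close> may be negative, hence
      the absolute value.\<close>
    then have "C * ?S \<le> \<bar>C\<bar> * ?S" by (intro mult_right_mono) auto
    also have "\<dots> \<le> \<bar>C\<bar> * (\<Sum>k\<le>N. \<Sum>vs\<in>{vs. set vs \<subseteq> Basis \<and> length vs \<le> N}. c k vs)"
      by (intro mult_left_mono sum_mono schwartz_seminorm_le c) auto
    finally show ?thesis using C[OF f] by linarith
  qed
  then show ?thesis by (intro that[of "\<bar>C\<bar>" N]) auto
qed

text \<open>Since 1 + |x| is at most (1 + |t|) (1 + |x - t|) up to the summand 1, a shift by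
  \<open>t\<close> multiplies the seminorms of order at most \<open>N\<close> by no more than (1 +
  |t|)^N. This is the source of the polynomial growth of \<open>a\<close>.\<close>

lemma tempered_shift_bound:
  fixes T :: "'a::euclidean_space functional"
  assumes T: "tempered_distribution T" and f: "f \<in> schwartz"
  shows "\<exists>C\<ge>0. \<exists>N. \<forall>t. norm (T (\<lambda>x. f (x - t))) \<le> C * (1 + norm t) ^ N"
proof -
  obtain C N where C: "C \<ge> 0" "\<And>f c. f \<in> schwartz \<Longrightarrow> (\<forall>k vs x. k \<le> N \<longrightarrow> set vs \<subseteq> Basis \<longrightarrow> length vs \<le> N \<longrightarrow>
     norm x ^ k * norm (iter_deriv vs f x) \<le> c k vs) \<Longrightarrow>
    norm (T f) \<le> C * (\<Sum>k\<le>N. \<Sum>vs\<in>{vs. set vs \<subseteq> Basis \<and> length vs \<le> N}. c k vs)"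
    using tempered_seminorm_bound[OF T] by blast
  have "\<exists>D\<ge>0. \<forall>x. (1 + norm x) ^ k * norm (iter_deriv vs f x) \<le> D" if "set vs \<subseteq> Basis" for k vs
    by (rule rapidD[OF smooth_withD(4)[OF smooth_with_iter_deriv[OF f[unfolded schwartz_eq] that]]])
  note ex = this
  define D where "D k vs = (SOME D. 0 \<le> D \<and> (\<forall>x. (1 + norm x) ^ k * norm (iter_deriv vs f x) \<le> D))" for k vs
  have D: "0 \<le> D k vs \<and> (1 + norm x) ^ k * norm (iter_deriv vs f x) \<le> D k vs"
    if "set vs \<subseteq> Basis" for k vs x
    using someI_ex[OF ex[OF that, of k]] unfolding D_def by blast
  let ?S = "\<Sum>k\<le>N. \<Sum>vs\<in>{vs::'a list. set vs \<subseteq> Basis \<and> length vs \<le> N}. D k vs"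
  have "norm (T (\<lambda>x. f (x - t))) \<le> (C * ?S) * (1 + norm t) ^ N" for t
  proof -
    have "norm (T (\<lambda>x. f (1 *\<^sub>R x + (- t)))) \<le>
        C * (\<Sum>k\<le>N. \<Sum>vs\<in>{vs. set vs \<subseteq> Basis \<and> length vs \<le> N}. (1 + norm t) ^ N * D k vs)"
    proof (rule C(2); (intro allI impI)?)
      show "(\<lambda>x. f (1 *\<^sub>R x + - t)) \<in> schwartz" by (rule schwartz_affine[OF f]) simp
      fix k and vs :: "'a list" and x assume k: "k \<le> N" and vs: "set vs \<subseteq> Basis"
      have "norm x \<le> norm t + norm (x - t)" using norm_triangle_sub[of x t] by simp
      also have "\<dots> \<le> (1 + norm t) * (1 + norm (x - t))" by (simp add: algebra_simps)
      finally have "norm x ^ k \<le> ((1 + norm t) * (1 + norm (x - t))) ^ k" by (intro power_mono) auto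
      also have "\<dots> \<le> (1 + norm t) ^ N * (1 + norm (x - t)) ^ k"
        unfolding power_mult_distrib using k by (intro mult_right_mono power_increasing) auto
      finally have "norm x ^ k * norm (iter_deriv vs f (x - t)) \<le>
          (1 + norm t) ^ N * (1 + norm (x - t)) ^ k * norm (iter_deriv vs f (x - t))"
        by (intro mult_right_mono) auto
      also have "\<dots> = (1 + norm t) ^ N * ((1 + norm (x - t)) ^ k * norm (iter_deriv vs f (x - t)))"
        by simp
      also have "\<dots> \<le> (1 + norm t) ^ N * D k vs" using D[OF vs] by (intro mult_left_mono) auto
      finally show "norm x ^ k * norm (iter_deriv vs (\<lambda>x. f (1 *\<^sub>R x + - t)) x) \<le> (1 + norm t) ^ N * D k vs"
        using iter_deriv_affine[of f rapid vs 1 "-t"] f vs by (simp add: schwartz_eq)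
    qed
    also have "\<dots> = (C * ?S) * (1 + norm t) ^ N"
      by (simp only: sum_distrib_left[symmetric]) (simp only: mult_ac)
    finally show ?thesis by simp
  qed
  moreover have "C * ?S \<ge> 0" using C(1) D by (intro mult_nonneg_nonneg sum_nonneg) auto
  ultimately show ?thesis by blast
qed

text \<open>Modelled on \<open>cutoff n - 1\<close>: every derivative is O(1/n) except for linear
  growth in \<open>x\<close>, which a Schwartz factor absorbs.\<close>

definition small_family :: "(nat \<Rightarrow> 'a::euclidean_space \<Rightarrow> complex) \<Rightarrow> bool" where
  "small_family \<eta> \<longleftrightarrow> (\<forall>n. smooth (\<eta> n)) \<and>
    (\<forall>vs. set vs \<subseteq> Basis \<longrightarrow> (\<exists>C. \<forall>n x. norm (iter_deriv vs (\<eta> n) x) \<le> C * (1 + norm x) / Suc n))"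

lemma small_familyD:
  assumes "small_family \<eta>" shows "\<exists>C. \<forall>n x. norm (\<eta> n x) \<le> C * (1 + norm x) / Suc n"
  using assms[unfolded small_family_def, THEN conjunct2, rule_format, of "[]"]
  by (simp del: of_nat_Suc)

lemma small_family_dir_deriv:
  assumes "small_family \<eta>" "v \<in> Basis" shows "small_family (\<lambda>n. dir_deriv v (\<eta> n))"
  unfolding small_family_def
proof (intro conjI allI impI)
  show "smooth (dir_deriv v (\<eta> n))" for n
    using assms by (auto simp: small_family_def smooth_eq intro: smooth_with_dir_deriv)
  fix vs :: "'a list" assume "set vs \<subseteq> Basis"
  then have "set (vs @ [v]) \<subseteq> Basis" using assms(2) by simp
  with assms(1) obtain C where "\<And>n x. norm (iter_deriv (vs @ [v]) (\<eta> n) x) \<le> C * (1 + norm x) / Suc n"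
    unfolding small_family_def by meson
  then show "\<exists>C. \<forall>n x. norm (iter_deriv vs (dir_deriv v (\<eta> n)) x) \<le> C * (1 + norm x) / Suc n" by auto
qed

text \<open>The last list entry is the innermost derivative, so \<open>rev_induct\<close> applies
  the product rule to the product itself and leaves two products of the same kind. This is why
  \<eta> and \<psi> must be arbitrary in the induction.\<close>

lemma small_family_seminorm:
  fixes \<psi> :: "'a::euclidean_space \<Rightarrow> complex"
  assumes "small_family \<eta>" "\<psi> \<in> schwartz" "set vs \<subseteq> Basis"
  shows "\<exists>C. \<forall>n x. norm x ^ k * norm (iter_deriv vs (\<lambda>x. \<eta> n x * \<psi> x) x) \<le> C / Suc n"
  using assms
proof (induction vs arbitrary: \<eta> \<psi> rule: rev_induct)
  case Nil
  obtain C where C: "\<And>n x. norm (\<eta> n x) \<le> C * (1 + norm x) / Suc n"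
    using small_familyD[OF Nil.prems(1)] by blast
  have C0: "C \<ge> 0" using order_trans[OF norm_ge_zero C[of 0 0]] by simp
  obtain D where D: "D \<ge> 0" "\<And>x. (1 + norm x) ^ (k + 1) * norm (\<psi> x) \<le> D"
    using rapidD[OF schwartzD(4)[OF Nil.prems(2)]] by blast
  have "norm x ^ k * norm (\<eta> n x * \<psi> x) \<le> (C * D) / Suc n" for n x
  proof -
    have "norm x ^ k * norm (\<eta> n x * \<psi> x) \<le> (1 + norm x) ^ k * (C * (1 + norm x) / Suc n * norm (\<psi> x))"
      unfolding norm_mult using C by (intro mult_mono mult_right_mono power_mono) auto
    also have "\<dots> = C * ((1 + norm x) ^ (k + 1) * norm (\<psi> x)) / Suc n" by simp
    also have "\<dots> \<le> C * D / Suc n" using C0 D by (intro divide_right_mono mult_left_mono) auto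
    finally show ?thesis .
  qed
  then show ?case by auto
next
  case (snoc v vs)
  then have v: "v \<in> Basis" and vs: "set vs \<subseteq> Basis" by auto
  obtain C where C: "\<And>n x. norm x ^ k * norm (iter_deriv vs (\<lambda>x. \<eta> n x * dir_deriv v \<psi> x) x) \<le> C / Suc n"
    using snoc.IH[OF snoc.prems(1) schwartz_dir_deriv[OF snoc.prems(2) v] vs] by blast
  obtain D where D: "\<And>n x. norm x ^ k * norm (iter_deriv vs (\<lambda>x. dir_deriv v (\<eta> n) x * \<psi> x) x) \<le> D / Suc n"
    using snoc.IH[OF small_family_dir_deriv[OF snoc.prems(1) v] snoc.prems(2) vs] by blast
  have "norm x ^ k * norm (iter_deriv (vs @ [v]) (\<lambda>x. \<eta> n x * \<psi> x) x) \<le> (C + D) / Suc n" for n x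
  proof -
    have \<eta>: "\<eta> n \<in> smooth_with (\<lambda>_. True)" using snoc.prems(1) by (simp add: small_family_def smooth_eq)
    have \<psi>: "\<psi> \<in> smooth_with (\<lambda>_. True)" using snoc.prems(2) schwartz_smooth smooth_eq by blast
    have "dir_deriv v (\<lambda>x. \<eta> n x * \<psi> x) = (\<lambda>x. \<eta> n x * dir_deriv v \<psi> x + dir_deriv v (\<eta> n) x * \<psi> x)"
      by (intro dir_deriv_mult smooth_withD(1)[OF \<eta>] smooth_withD(1)[OF \<psi>])
    then have "iter_deriv (vs @ [v]) (\<lambda>x. \<eta> n x * \<psi> x) =
       (\<lambda>x. iter_deriv vs (\<lambda>x. \<eta> n x * dir_deriv v \<psi> x) x + iter_deriv vs (\<lambda>x. dir_deriv v (\<eta> n) x * \<psi> x) x)"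
      using iter_deriv_add[OF smooth_with_mult[OF \<eta> smooth_with_dir_deriv[OF \<psi> v]] smooth_with_mult[OF smooth_with_dir_deriv[OF \<eta> v] \<psi>] vs,
          of "\<lambda>_. True" "\<lambda>_. True"] by simp
    then have "norm x ^ k * norm (iter_deriv (vs @ [v]) (\<lambda>x. \<eta> n x * \<psi> x) x) \<le>
      norm x ^ k * (norm (iter_deriv vs (\<lambda>x. \<eta> n x * dir_deriv v \<psi> x) x)
        + norm (iter_deriv vs (\<lambda>x. dir_deriv v (\<eta> n) x * \<psi> x) x))"
      by (simp add: mult_left_mono norm_triangle_ineq)
    also have "\<dots> \<le> C / Suc n + D / Suc n"
      unfolding distrib_left by (intro add_mono C D)
    finally show ?thesis by (simp add: add_divide_distrib)
  qed
  then show ?case by blast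
qed

text \<open>The factor \<open>exp 1\<close> normalises the value at the origin to 1, as
  \<open>bumpr 0\<close> is \<open>exp (- 1)\<close>.\<close>

definition cutoff :: "nat \<Rightarrow> 'a::euclidean_space \<Rightarrow> complex" where
  "cutoff n x = of_real (exp 1) * bump ((1 / Suc n) *\<^sub>R x)"

lemma cutoff_schwartz: "cutoff n \<in> schwartz"
proof -
  have "(\<lambda>x. bump ((1 / Suc n) *\<^sub>R x + 0)) \<in> schwartz" by (rule schwartz_affine) auto
  then show ?thesis unfolding cutoff_def[abs_def] by (intro schwartz_cmult) simp
qed

lemma cutoff_eq_0: "norm x \<ge> Suc n \<Longrightarrow> cutoff n x = 0"
  by (simp add: cutoff_def bump_def bumpr_eq_0)

text \<open>Order zero is the Lipschitz bound of the profile, the origin of the factor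
  \<open>1 + norm x\<close>. In higher orders the constant 1 drops out and each derivative brings a
  factor \<open>1 / Suc n\<close>.\<close>

lemma small_family_cutoff: "small_family (\<lambda>n x. cutoff n x - 1 :: complex)"
  unfolding small_family_def
proof (intro conjI allI impI)
  have c: "cutoff n \<in> smooth_with (\<lambda>_. True)" for n using cutoff_schwartz schwartz_smooth smooth_eq by blast
  have m1: "(\<lambda>x. - 1) \<in> smooth_with (\<lambda>_. True)" by (rule smooth_with_const) auto
  show "smooth (\<lambda>x. cutoff n x - 1)" for n
    using smooth_with_add[OF c m1] by (simp add: smooth_eq)
  fix vs :: "'a list" assume vs: "set vs \<subseteq> Basis"
  define \<kappa> where "\<kappa> x = of_real (exp 1) * bump x" for x :: 'a
  have \<kappa>: "\<kappa> \<in> schwartz" unfolding \<kappa>_def by (intro schwartz_cmult bump_schwartz)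
  have cut: "cutoff n = (\<lambda>x. \<kappa> ((1 / Suc n) *\<^sub>R x + 0))" for n
    by (simp add: fun_eq_iff cutoff_def \<kappa>_def)
  have \<kappa>0: "\<kappa> 0 = 1"
    by (simp add: \<kappa>_def bump_def bumpr_def flat_exp_def flip: of_real_mult)
      (simp add: mult_exp_exp)
  show "\<exists>C. \<forall>n x. norm (iter_deriv vs (\<lambda>x. cutoff n x - 1) x) \<le> C * (1 + norm x) / Suc n"
  proof (cases vs rule: rev_cases)
    case Nil
    obtain L where L: "L \<ge> 0" "\<And>x y. norm (\<kappa> x - \<kappa> y) \<le> L * norm (x - y)"
      using schwartz_lipschitz[OF \<kappa>] by blast
    have "norm (cutoff n x - 1) \<le> L * (1 + norm x) / Suc n" for n and x :: 'a
    proof -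
      have "norm (cutoff n x - 1) \<le> L * norm x / Suc n"
        using L(2)[of "(1 / Suc n) *\<^sub>R x" 0] by (simp add: cut \<kappa>0)
      also have "\<dots> \<le> L * (1 + norm x) / Suc n" using L(1) by (intro divide_right_mono mult_left_mono) auto
      finally show ?thesis .
    qed
    then show ?thesis using Nil by auto
  next
    case (snoc us v)
    with vs have v: "v \<in> Basis" by auto
    have "dir_deriv v (\<lambda>x. - 1 :: complex) = (\<lambda>x. 0)"
      by (intro ext has_derivative_imp_dir_deriv) (auto intro!: derivative_eq_intros)
    then have "dir_deriv v (\<lambda>x. cutoff n x - 1) = dir_deriv v (cutoff n)" for n
      using dir_deriv_add[OF smooth_withD(1)[OF c] smooth_withD(1)[OF m1], of v n] by simp
    then have eq: "iter_deriv vs (\<lambda>x. cutoff n x - 1) = (\<lambda>x. of_real (1 / Suc n) ^ length vs * iter_deriv vs \<kappa> ((1 / Suc n) *\<^sub>R x + 0))" for n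
      using iter_deriv_affine[OF \<kappa>[unfolded schwartz_eq] vs, of "1 / Suc n" 0, folded cut] snoc by simp
    obtain D where D: "D \<ge> 0" "\<And>x. norm (iter_deriv vs \<kappa> x) \<le> D"
      using rapidD[OF smooth_withD(4)[OF smooth_with_iter_deriv[OF \<kappa>[unfolded schwartz_eq] vs]], of 0] by auto
    have "norm (iter_deriv vs (\<lambda>x. cutoff n x - 1) x) \<le> D * (1 + norm x) / Suc n" for n and x :: 'a
    proof -
      have "norm (of_real (1 / Suc n) ^ length vs :: complex) = (1 / Suc n) ^ length vs"
        by (simp only: norm_power norm_of_real) simp
      also have "\<dots> \<le> (1 / Suc n) ^ 1"
        using snoc by (intro power_decreasing) auto
      finally have 1: "norm (of_real (1 / Suc n) ^ length vs :: complex) \<le> 1 / Suc n" by simp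
      have "norm (iter_deriv vs (\<lambda>x. cutoff n x - 1) x) \<le> (1 / Suc n) * D"
        unfolding eq norm_mult by (intro mult_mono 1 D) auto
      also have "\<dots> \<le> D * (1 + norm x) / Suc n"
        using D(1) by (simp add: divide_right_mono distrib_left)
      finally show ?thesis .
    qed
    then show ?thesis by blast
  qed
qed

lemma LIMSEQ_norm_le_inverse:
  assumes "\<And>n. norm (f n - l) \<le> C / real (Suc n)" shows "f \<longlonglongrightarrow> l"
proof -
  have ev: "\<forall>\<^sub>F n in sequentially. norm (f n - l) \<le> C * inverse (real (Suc n))"
    using assms by (simp add: divide_inverse always_eventually)
  have "(\<lambda>n. f n - l) \<longlonglongrightarrow> 0"
    by (rule Lim_null_comparison[OF ev tendsto_mult_right_zero[OF LIMSEQ_inverse_real_of_nat]])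
  then show ?thesis by (rule LIM_zero_cancel)
qed

text \<open>\<open>T\<close> and the sum agree on \<open>cutoff n * \<psi>\<close>, which has
  compact support. Replacing this product by \<psi> changes either side by O(1/n): the seminorm
  estimate shows it for \<open>T\<close>, absolute convergence for the sum.\<close>

lemma tempered_point_sum:
  fixes A :: "'a::euclidean_space set" and T :: "'a functional"
  assumes A: "weakly_uniformly_discrete A"
    and p: "\<And>x. x \<in> A \<Longrightarrow> norm (p x) \<le> M * (1 + norm x) ^ N"
    and T: "tempered_distribution T"
    and Tp: "\<And>\<phi>. \<phi> \<in> Cc \<Longrightarrow> smooth \<phi> \<Longrightarrow> T \<phi> = (\<Sum>\<^sub>\<infinity>x\<in>A. p x * \<phi> x)"
    and \<psi>: "\<psi> \<in> schwartz"
  shows "(\<lambda>x. norm (p x * \<psi> x)) summable_on A" "T \<psi> = (\<Sum>\<^sub>\<infinity>x\<in>A. p x * \<psi> x)"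
proof -
  obtain D where D: "D \<ge> 0" "\<And>x. (1 + norm x) ^ Suc N * norm (\<psi> x) \<le> D * weight x"
    using rapid_weight[OF schwartzD(4)[OF \<psi>]] by blast
  \<comment> \<open>The additional factor \<open>1 + norm x\<close> is kept to pay for the linear
    growth of \<open>cutoff n - 1\<close>.\<close>
  have b: "norm (p x * \<psi> x) * (1 + norm x) \<le> \<bar>M\<bar> * D * weight x" if "x \<in> A" for x
  proof -
    have "norm (p x * \<psi> x) * (1 + norm x) \<le> (M * (1 + norm x) ^ N) * norm (\<psi> x) * (1 + norm x)"
      unfolding norm_mult by (intro mult_right_mono p that) auto
    also have "\<dots> = M * ((1 + norm x) ^ Suc N * norm (\<psi> x))" by simp
    also have "\<dots> \<le> \<bar>M\<bar> * (D * weight x)" by (intro mult_mono D) auto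
    finally show ?thesis by simp
  qed
  have b0: "norm (p x * \<psi> x) \<le> \<bar>M\<bar> * D * weight x" if "x \<in> A" for x
  proof -
    have "norm (p x * \<psi> x) * 1 \<le> norm (p x * \<psi> x) * (1 + norm x)" by (intro mult_left_mono) auto
    with b[OF that] show ?thesis by simp
  qed
  show "(\<lambda>x. norm (p x * \<psi> x)) summable_on A" by (rule wud_summable_le_weight[OF A b0])
  have s: "(\<lambda>x. p x * \<psi> x) summable_on A" by (rule wud_summable_le_weight[OF A b0])
  define \<eta> where "\<eta> n x = cutoff n x - 1" for n and x :: 'a
  have \<eta>: "small_family \<eta>" using small_family_cutoff by (simp add: \<eta>_def[abs_def])
  have cs: "(\<lambda>x. cutoff n x * \<psi> x) \<in> schwartz" for n
    by (intro slow_mult_schwartz schwartz_slow cutoff_schwartz \<psi>)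
  have \<eta>s: "(\<lambda>x. \<eta> n x * \<psi> x) \<in> schwartz" for n
    using schwartz_add[OF cs[of n] schwartz_cmult[OF \<psi>, of "-1"]] by (simp add: \<eta>_def algebra_simps)
  have "\<exists>C. \<forall>n. norm (T (\<lambda>x. cutoff n x * \<psi> x) - T \<psi>) \<le> C / Suc n"
  proof -
    obtain C K where C: "C \<ge> 0" "\<And>f c. f \<in> schwartz \<Longrightarrow> (\<forall>k vs x. k \<le> K \<longrightarrow> set vs \<subseteq> Basis \<longrightarrow> length vs \<le> K \<longrightarrow>
       norm x ^ k * norm (iter_deriv vs f x) \<le> c k vs) \<Longrightarrow>
      norm (T f) \<le> C * (\<Sum>k\<le>K. \<Sum>vs\<in>{vs. set vs \<subseteq> Basis \<and> length vs \<le> K}. c k vs)"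
      using tempered_seminorm_bound[OF T] by blast
    define c where "c k vs = (SOME C. \<forall>n x. norm x ^ k * norm (iter_deriv vs (\<lambda>x. \<eta> n x * \<psi> x) x) \<le> C / Suc n)" for k vs
    have c: "norm x ^ k * norm (iter_deriv vs (\<lambda>x. \<eta> n x * \<psi> x) x) \<le> c k vs / Suc n"
      if "set vs \<subseteq> Basis" for k vs n x
      using someI_ex[OF small_family_seminorm[OF \<eta> \<psi> that, of k]] unfolding c_def by blast
    have "norm (T (\<lambda>x. \<eta> n x * \<psi> x)) \<le>
        C * (\<Sum>k\<le>K. \<Sum>vs\<in>{vs. set vs \<subseteq> Basis \<and> length vs \<le> K}. c k vs / Suc n)" for n
      using C(2)[OF \<eta>s, of _ "\<lambda>k vs. c k vs / Suc n"] c by blast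
    then have "norm (T (\<lambda>x. \<eta> n x * \<psi> x)) \<le>
        (C * (\<Sum>k\<le>K. \<Sum>vs\<in>{vs. set vs \<subseteq> Basis \<and> length vs \<le> K}. c k vs)) / Suc n" for n
      by (simp only: sum_divide_distrib[symmetric] times_divide_eq_right)
    moreover have "T (\<lambda>x. cutoff n x * \<psi> x) = T (\<lambda>x. \<eta> n x * \<psi> x) + T \<psi>" for n
    proof -
      have "T (\<lambda>x. \<eta> n x * \<psi> x + \<psi> x) = T (\<lambda>x. \<eta> n x * \<psi> x) + T \<psi>"
        by (rule T[unfolded tempered_distribution_def, THEN conjunct1, rule_format, OF \<eta>s \<psi>])
      then show ?thesis by (simp add: \<eta>_def algebra_simps)
    qed
    ultimately show ?thesis by auto
  qed
  then obtain C where "\<And>n. norm (T (\<lambda>x. cutoff n x * \<psi> x) - T \<psi>) \<le> C / Suc n" by blast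
  then have 1: "(\<lambda>n. T (\<lambda>x. cutoff n x * \<psi> x)) \<longlonglongrightarrow> T \<psi>"
    by (rule LIMSEQ_norm_le_inverse)
  obtain E where E: "\<And>n x. norm (\<eta> n x) \<le> E * (1 + norm x) / Suc n"
    using small_familyD[OF \<eta>] by blast
  have 2: "(\<lambda>n. T (\<lambda>x. cutoff n x * \<psi> x)) \<longlonglongrightarrow> (\<Sum>\<^sub>\<infinity>x\<in>A. p x * \<psi> x)"
  proof (rule LIMSEQ_norm_le_inverse)
    fix n
    have "continuous_on UNIV (\<lambda>x. cutoff n x * \<psi> x)" by (rule schwartzD[OF cs])
    then have "(\<lambda>x. cutoff n x * \<psi> x) \<in> Cc"
      by (rule CcI(1)[of _ "Suc n"]) (simp add: cutoff_eq_0)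
    then have eq: "T (\<lambda>x. cutoff n x * \<psi> x) = (\<Sum>\<^sub>\<infinity>x\<in>A. p x * (cutoff n x * \<psi> x))"
      by (rule Tp) (intro schwartz_smooth cs)
    have e: "norm (p x * (\<eta> n x * \<psi> x)) \<le> (\<bar>E\<bar> * (\<bar>M\<bar> * D) / Suc n) * weight x" if "x \<in> A" for x
    proof -
      have "norm (p x * (\<eta> n x * \<psi> x)) = norm (\<eta> n x) * norm (p x * \<psi> x)" by (simp add: norm_mult)
      also have "\<dots> \<le> (\<bar>E\<bar> * (1 + norm x) / Suc n) * norm (p x * \<psi> x)"
        by (intro mult_right_mono order_trans[OF E] divide_right_mono) auto
      also have "\<dots> = (\<bar>E\<bar> / Suc n) * (norm (p x * \<psi> x) * (1 + norm x))" by simp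
      also have "\<dots> \<le> (\<bar>E\<bar> / Suc n) * (\<bar>M\<bar> * D * weight x)" by (intro mult_left_mono b that) auto
      finally show ?thesis by (simp add: mult_ac)
    qed
    have \<eta>sum: "(\<lambda>x. p x * (\<eta> n x * \<psi> x)) summable_on A"
      "(\<lambda>x. norm (p x * (\<eta> n x * \<psi> x))) summable_on A"
      using wud_summable_le_weight[OF A e] by auto
    have "(\<Sum>\<^sub>\<infinity>x\<in>A. p x * (cutoff n x * \<psi> x)) = (\<Sum>\<^sub>\<infinity>x\<in>A. p x * (\<eta> n x * \<psi> x) + p x * \<psi> x)"
      by (simp add: \<eta>_def algebra_simps)
    also have "\<dots> = (\<Sum>\<^sub>\<infinity>x\<in>A. p x * (\<eta> n x * \<psi> x)) + (\<Sum>\<^sub>\<infinity>x\<in>A. p x * \<psi> x)"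
      by (rule infsum_add[OF \<eta>sum(1) s])
    finally have "T (\<lambda>x. cutoff n x * \<psi> x) - (\<Sum>\<^sub>\<infinity>x\<in>A. p x * \<psi> x) = (\<Sum>\<^sub>\<infinity>x\<in>A. p x * (\<eta> n x * \<psi> x))"
      using eq by simp
    also have "norm \<dots> \<le> (\<Sum>\<^sub>\<infinity>x\<in>A. norm (p x * (\<eta> n x * \<psi> x)))" by (rule norm_infsum_bound[OF \<eta>sum(2)])
    also have "\<dots> \<le> (\<Sum>\<^sub>\<infinity>x\<in>A. (\<bar>E\<bar> * (\<bar>M\<bar> * D) / Suc n) * weight x)"
      using wud_summable_weight[OF A, of 1 0] by (intro infsum_mono \<eta>sum e summable_on_cmult_right) auto
    also have "\<dots> = (\<bar>E\<bar> * (\<bar>M\<bar> * D) / Suc n) * (\<Sum>\<^sub>\<infinity>x\<in>A. weight x)" by (rule infsum_cmult_right')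
    finally show "norm (T (\<lambda>x. cutoff n x * \<psi> x) - (\<Sum>\<^sub>\<infinity>x\<in>A. p x * \<psi> x))
        \<le> (\<bar>E\<bar> * (\<bar>M\<bar> * D) * (\<Sum>\<^sub>\<infinity>x\<in>A. weight x)) / Suc n" by simp
  qed
  from LIMSEQ_unique[OF 1 2] show "T \<psi> = (\<Sum>\<^sub>\<infinity>x\<in>A. p x * \<psi> x)" .
qed


section \<open>Windowed energies of trigonometric sums\<close>

lemma wud_sum_weight_1:
  fixes S :: "'a::euclidean_space set"
  assumes "weakly_uniformly_discrete S"
  shows "\<exists>C\<ge>0. \<forall>t F. finite F \<longrightarrow> F \<subseteq> S \<longrightarrow> (\<Sum>y\<in>F. weight (y - t)) \<le> C"
proof -
  obtain C where "C \<ge> 0" and C: "\<And>t T F. T \<ge> 1 \<Longrightarrow> finite F \<Longrightarrow> F \<subseteq> S \<Longrightarrow>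
    (\<Sum>y\<in>F. weight ((1/T) *\<^sub>R (y - t))) \<le> C * T ^ DIM('a)" using wud_sum_weight[OF assms] by blast
  then show ?thesis using C[of 1] by auto
qed

lemma bumpr_le_1: "bumpr x \<le> 1"
  by (simp add: bumpr_def flat_exp_def)

lemma measurable_bumpr [measurable]: "bumpr \<in> borel_measurable borel"
  by (intro borel_measurable_continuous_onI continuous_intros)

lemma bump_integrable [simp, intro]:
  "integrable lborel (bump :: 'a::euclidean_space \<Rightarrow> complex)"
  "integrable lborel (bumpr :: 'a::euclidean_space \<Rightarrow> real)"
proof -
  show *: "integrable lborel (bump :: 'a \<Rightarrow> complex)" by (intro rapid_measD schwartz_rapid_meas bump_schwartz)
  then show "integrable lborel (bumpr :: 'a \<Rightarrow> real)"
    using integrable_norm[OF *] by simp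
qed

text \<open>The powers that occur are the first, for the window alone, and the third, where a window
  meets the square of a bump.\<close>

lemma integral_bumpr_pow_pos: "(\<integral>x. bumpr x ^ Suc n \<partial>(lborel :: 'a::euclidean_space measure)) > 0"
proof -
  have i: "integrable lborel (\<lambda>x::'a. bumpr x ^ Suc n)"
  proof (rule Bochner_Integration.integrable_bound[OF bump_integrable(2)])
    show "AE x in lborel. norm (bumpr (x::'a) ^ Suc n) \<le> norm (bumpr x)"
      using power_le_one[OF bumpr_nonneg bumpr_le_1] by (auto intro!: AE_I2 mult_left_le simp: abs_mult)
  qed simp
  have "(\<integral>x. bumpr x ^ Suc n \<partial>(lborel :: 'a measure)) \<noteq> 0"
  proof
    assume "(\<integral>x. bumpr x ^ Suc n \<partial>(lborel :: 'a measure)) = 0"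
    then have "AE x in lborel. bumpr (x::'a) ^ Suc n = 0"
      using integral_nonneg_eq_0_iff_AE[OF i] by simp
    then have "AE x in lborel. x \<notin> ball (0::'a) 1"
      by eventually_elim (use bumpr_pos in \<open>fastforce simp: dist_norm\<close>)
    then have "emeasure lborel (ball (0::'a) 1) = 0"
      by (subst (asm) AE_iff_measurable[where N = "ball (0::'a) 1"]) (auto simp: dist_norm)
    then show False using emeasure_lborel_ball_finite content_ball_pos[of 1 "0::'a"] by (simp add: measure_def)
  qed
  moreover have "(\<integral>x. bumpr x ^ Suc n \<partial>(lborel :: 'a measure)) \<ge> 0"
    by (intro Bochner_Integration.integral_nonneg) auto
  ultimately show ?thesis by linarith
qed

lemma bumpr_scaled:
  fixes s :: "'a::euclidean_space"
  assumes "c > 0"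
  shows "integrable lborel (\<lambda>k. bumpr (c *\<^sub>R (k - s)))"
    and "(\<integral>k. bumpr (c *\<^sub>R (k - s)) ^ Suc n \<partial>lborel) = (1 / c ^ DIM('a)) * (\<integral>k. bumpr k ^ Suc n \<partial>(lborel :: 'a measure))"
proof -
  have "integrable lborel (\<lambda>k. bumpr (- (c *\<^sub>R s) + c *\<^sub>R k))"
    using assms by (subst lborel_integrable_affine) auto
  then show "integrable lborel (\<lambda>k. bumpr (c *\<^sub>R (k - s)))" by (simp add: scaleR_diff_right)
  have "(\<integral>k. bumpr k ^ Suc n \<partial>(lborel :: 'a measure)) = \<bar>c\<bar> ^ DIM('a) *\<^sub>R (\<integral>k. bumpr (- (c *\<^sub>R s) + c *\<^sub>R k) ^ Suc n \<partial>lborel)"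
    using assms by (intro lborel_integral_affine) auto
  then show "(\<integral>k. bumpr (c *\<^sub>R (k - s)) ^ Suc n \<partial>lborel) = (1 / c ^ DIM('a)) * (\<integral>k. bumpr k ^ Suc n \<partial>(lborel :: 'a measure))"
    using assms by (simp add: scaleR_diff_right del: power_Suc)
qed

definition trig_sum :: "('a::euclidean_space \<Rightarrow> complex) \<Rightarrow> 'a set \<Rightarrow> 'a \<Rightarrow> complex" where
  "trig_sum c F k = (\<Sum>x\<in>F. c x * cis2 (- (k \<bullet> x)))"

lemma trig_sum_measurable [measurable]: "trig_sum c F \<in> borel_measurable borel"
  unfolding trig_sum_def[abs_def] by measurable

lemma norm_trig_sum_le: "norm (trig_sum c F k) \<le> (\<Sum>x\<in>F. norm (c x))"
  unfolding trig_sum_def by (rule order_trans[OF norm_sum]) (simp add: norm_mult)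

text \<open>A local L2 norm. The compact support of the window confines attention to finitely many
  points of \<open>S\<close>; its smoothness provides the decay of \<open>fourier bump\<close> that
  Schur's test consumes.\<close>

definition window_energy :: "real \<Rightarrow> 'a::euclidean_space \<Rightarrow> ('a \<Rightarrow> complex) \<Rightarrow> real" where
  "window_energy R s h = (\<integral>k. bumpr ((1 / R) *\<^sub>R (k - s)) * (norm (h k))\<^sup>2 \<partial>lborel)"

lemma window_integrable:
  assumes R: "R > 0" and [measurable]: "h \<in> borel_measurable borel" and B: "\<And>k. norm (h k) \<le> B"
  shows "integrable lborel (\<lambda>k. bumpr ((1 / R) *\<^sub>R (k - s)) * (norm (h k))\<^sup>2)"
proof (rule Bochner_Integration.integrable_bound)
  show "integrable lborel (\<lambda>k. bumpr ((1 / R) *\<^sub>R (k - s)) * B\<^sup>2)"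
    using R by (intro integrable_mult_left bumpr_scaled) auto
  have "(norm (h k))\<^sup>2 \<le> B\<^sup>2" for k by (intro power_mono B) auto
  then show "AE k in lborel. norm (bumpr ((1 / R) *\<^sub>R (k - s)) * (norm (h k))\<^sup>2) \<le> norm (bumpr ((1 / R) *\<^sub>R (k - s)) * B\<^sup>2)"
    by (intro AE_I2) (simp add: abs_mult mult_left_mono)
qed measurable

text \<open>Expanding the square produces the Gram matrix of the characters in the weighted L2
  space, whose entries are values of the transformed window at differences of frequencies. The
  position \<open>s\<close> enters only through a factor of modulus 1.\<close>

lemma window_energy_trig_sum:
  fixes c :: "'a::euclidean_space \<Rightarrow> complex"
  assumes R: "R > 0" and F: "finite F"
  shows "complex_of_real (window_energy R s (trig_sum c F)) =
    (\<Sum>x\<in>F. \<Sum>y\<in>F. c x * cnj (c y) * (of_real (R ^ DIM('a)) * cis2 (- ((x - y) \<bullet> s)) * fourier bump (R *\<^sub>R (x - y))))"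
proof -
  let ?w = "\<lambda>k. bump ((1 / R) *\<^sub>R (k - s))"
  have wi: "integrable lborel ?w"
    using integrable_of_real[OF bumpr_scaled(1)[of "1/R" s], where 'a = complex] R by (simp add: bump_def[abs_def])
  have ti: "integrable lborel (\<lambda>k. c x * cnj (c y) * (cis2 (- ((x - y) \<bullet> k)) * ?w k))" for x y
    using cis2_integrable[OF wi, of "- (x - y)"] by (intro integrable_mult_right) (simp only: inner_minus_left)
  have "complex_of_real (window_energy R s (trig_sum c F)) = (\<integral>k. of_real (bumpr ((1 / R) *\<^sub>R (k - s)) * (norm (trig_sum c F k))\<^sup>2) \<partial>lborel)"
    unfolding window_energy_def by (rule integral_complex_of_real[symmetric])
  also have "\<dots> = (\<integral>k. (\<Sum>x\<in>F. \<Sum>y\<in>F. c x * cnj (c y) * (cis2 (- ((x - y) \<bullet> k)) * ?w k)) \<partial>lborel)"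
  proof (rule Bochner_Integration.integral_cong[OF refl])
    fix k
    have "complex_of_real ((norm (trig_sum c F k))\<^sup>2) = trig_sum c F k * cnj (trig_sum c F k)"
      by (simp only: complex_norm_square)
    also have "\<dots> = (\<Sum>x\<in>F. \<Sum>y\<in>F. c x * cnj (c y) * cis2 (- ((x - y) \<bullet> k)))"
      unfolding trig_sum_def cnj_sum sum_product
    proof (intro sum.cong refl)
      fix x y
      have "cis2 (- ((x - y) \<bullet> k)) = cis2 (- (k \<bullet> x)) * cis2 (k \<bullet> y)"
        by (simp add: cis2_add[symmetric] inner_diff_left inner_diff_right inner_commute[of _ k])
      then show "c x * cis2 (- (k \<bullet> x)) * cnj (c y * cis2 (- (k \<bullet> y))) = c x * cnj (c y) * cis2 (- ((x - y) \<bullet> k))"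
        by (simp add: cnj_cis2)
    qed
    finally show "complex_of_real (bumpr ((1 / R) *\<^sub>R (k - s)) * (norm (trig_sum c F k))\<^sup>2) =
       (\<Sum>x\<in>F. \<Sum>y\<in>F. c x * cnj (c y) * (cis2 (- ((x - y) \<bullet> k)) * ?w k))"
      by (simp add: bump_def sum_distrib_left mult_ac)
  qed
  also have "\<dots> = (\<Sum>x\<in>F. \<Sum>y\<in>F. c x * cnj (c y) * (\<integral>k. cis2 (- ((x - y) \<bullet> k)) * ?w k \<partial>lborel))"
    using ti by (subst Bochner_Integration.integral_sum, simp, intro sum.cong refl)
      (subst Bochner_Integration.integral_sum, simp, simp only: integral_mult_right_zero)
  also have "(\<lambda>x y. \<integral>k. cis2 (- ((x - y) \<bullet> k)) * ?w k \<partial>lborel) =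
      (\<lambda>x y. of_real (R ^ DIM('a)) * cis2 (- ((x - y) \<bullet> s)) * fourier bump (R *\<^sub>R (x - y)))"
    using fourier_affine[of bump "1/R" s] R
    by (simp add: fun_eq_iff fourier_cis2[of ?w, symmetric] schwartzD(5)[OF bump_schwartz] scaleR_conv_of_real power_divide)
  finally show ?thesis by meson
qed

lemma fourier_bump_minus: "fourier bump (- u) = fourier bump (u :: 'a::euclidean_space)"
proof -
  have "(\<lambda>x. bump (- x)) = (bump :: 'a \<Rightarrow> complex)" by (simp add: bump_def fun_eq_iff)
  then show ?thesis
    using inv_fourier_reflect[of bump u] schwartzD(5)[OF bump_schwartz] by (simp add: inv_fourier_def)
qed

text \<open>Schur's test for a symmetric kernel: split each product by 2 s t <= s^2 + t^2 and use
  that row and column sums agree.\<close>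

lemma schur_bound:
  fixes K :: "'a \<Rightarrow> 'a \<Rightarrow> real" and c :: "'a \<Rightarrow> complex"
  assumes "\<And>x y. K x y \<ge> 0" "\<And>x y. K x y = K y x" "\<And>x. x \<in> F \<Longrightarrow> (\<Sum>y\<in>F. K x y) \<le> M"
  shows "(\<Sum>x\<in>F. \<Sum>y\<in>F. norm (c x) * norm (c y) * K x y) \<le> M * (\<Sum>x\<in>F. (norm (c x))\<^sup>2)"
proof -
  have "(\<Sum>x\<in>F. \<Sum>y\<in>F. norm (c x) * norm (c y) * K x y) \<le>
      (\<Sum>x\<in>F. \<Sum>y\<in>F. (1/2) * ((norm (c x))\<^sup>2 * K x y) + (1/2) * ((norm (c y))\<^sup>2 * K x y))"
  proof (intro sum_mono)
    fix x y
    have "norm (c x) * norm (c y) \<le> (1/2) * ((norm (c x))\<^sup>2 + (norm (c y))\<^sup>2)"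
      using zero_le_power2[of "norm (c x) - norm (c y)"] by (simp add: power2_diff)
    then have "norm (c x) * norm (c y) * K x y \<le> (1/2) * ((norm (c x))\<^sup>2 + (norm (c y))\<^sup>2) * K x y"
      by (rule mult_right_mono) (rule assms(1))
    then show "norm (c x) * norm (c y) * K x y \<le> (1/2) * ((norm (c x))\<^sup>2 * K x y) + (1/2) * ((norm (c y))\<^sup>2 * K x y)"
      by (simp add: algebra_simps)
  qed
  also have "\<dots> = (1/2) * (\<Sum>x\<in>F. \<Sum>y\<in>F. (norm (c x))\<^sup>2 * K x y) + (1/2) * (\<Sum>x\<in>F. \<Sum>y\<in>F. (norm (c y))\<^sup>2 * K x y)"
    by (simp add: sum.distrib sum_distrib_left)
  also have "(\<Sum>x\<in>F. \<Sum>y\<in>F. (norm (c y))\<^sup>2 * K x y) = (\<Sum>x\<in>F. \<Sum>y\<in>F. (norm (c x))\<^sup>2 * K x y)"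
    by (subst sum.swap) (simp add: assms(2))
  also have "(1/2) * (\<Sum>x\<in>F. \<Sum>y\<in>F. (norm (c x))\<^sup>2 * K x y) + (1/2) * (\<Sum>x\<in>F. \<Sum>y\<in>F. (norm (c x))\<^sup>2 * K x y)
      = (\<Sum>x\<in>F. (norm (c x))\<^sup>2 * (\<Sum>y\<in>F. K x y))"
    by (simp add: sum_distrib_left)
  also have "\<dots> \<le> (\<Sum>x\<in>F. (norm (c x))\<^sup>2 * M)"
    by (intro sum_mono mult_left_mono assms(3)) auto
  finally show ?thesis by (simp add: sum_distrib_left mult.commute)
qed

text \<open>Taking norms removes the dependence on \<open>s\<close>, and the row sums of the Gram
  matrix are bounded because \<open>fourier bump\<close> decays like \<open>weight\<close>.\<close>

lemma window_energy_upper: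
  fixes A :: "'a::euclidean_space set"
  assumes A: "weakly_uniformly_discrete A" and R: "R \<ge> 1"
  shows "\<exists>C>0. \<forall>F c s. finite F \<longrightarrow> F \<subseteq> A \<longrightarrow> window_energy R s (trig_sum c F) \<le> C * (\<Sum>x\<in>F. (norm (c x))\<^sup>2)"
proof -
  obtain D where D: "D \<ge> 0" "\<And>u. norm (fourier bump u) \<le> D * weight (u::'a)"
    using rapid_weight[OF schwartzD(4)[OF fourier_schwartz[OF bump_schwartz]], of 0] by auto
  obtain W where W: "W \<ge> 0" "\<And>t F. finite F \<Longrightarrow> F \<subseteq> A \<Longrightarrow> (\<Sum>y\<in>F. weight (y - t)) \<le> W"
    using wud_sum_weight_1[OF A] by blast
  let ?C = "R ^ DIM('a) * (D * W)"
  have "window_energy R s (trig_sum c F) \<le> (?C + 1) * (\<Sum>x\<in>F. (norm (c x))\<^sup>2)"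
    if F: "finite F" "F \<subseteq> A" for F c s
  proof -
    have "window_energy R s (trig_sum c F) \<le> norm (complex_of_real (window_energy R s (trig_sum c F)))"
      by simp
    also have "\<dots> \<le> (\<Sum>x\<in>F. \<Sum>y\<in>F. norm (c x) * norm (c y) * (R ^ DIM('a) * norm (fourier bump (R *\<^sub>R (x - y)))))"
      using R unfolding window_energy_trig_sum[OF less_le_trans[OF zero_less_one R] F(1)]
      by (intro order_trans[OF norm_sum] sum_mono) (simp add: norm_mult norm_power)
    also have "\<dots> \<le> ?C * (\<Sum>x\<in>F. (norm (c x))\<^sup>2)"
    proof (rule schur_bound)
      fix x y :: 'a
      show "R ^ DIM('a) * norm (fourier bump (R *\<^sub>R (x - y))) \<ge> 0" using R by simp
      show "R ^ DIM('a) * norm (fourier bump (R *\<^sub>R (x - y))) = R ^ DIM('a) * norm (fourier bump (R *\<^sub>R (y - x)))"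
        using fourier_bump_minus[of "R *\<^sub>R (x - y)"] by (simp add: scaleR_diff_right)
      have "norm (fourier bump (R *\<^sub>R (x - y))) \<le> D * weight (y - x)" for y
        using D(2)[of "R *\<^sub>R (x - y)"] mult_left_mono[OF weight_scale[OF R, of "x - y"] D(1)] weight_minus[of "x - y"] by simp
      then have "(\<Sum>y\<in>F. norm (fourier bump (R *\<^sub>R (x - y)))) \<le> D * (\<Sum>y\<in>F. weight (y - x))"
        unfolding sum_distrib_left by (rule sum_mono)
      also have "\<dots> \<le> D * W" using D W F by (intro mult_left_mono) auto
      finally show "(\<Sum>y\<in>F. R ^ DIM('a) * norm (fourier bump (R *\<^sub>R (x - y)))) \<le> ?C"
        unfolding sum_distrib_left[symmetric] using R by (intro mult_left_mono) auto
    qed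
    \<comment> \<open>The added 1 makes the constant strictly positive;
      \<open>fourier_Cc_bessel\<close> later divides by it.\<close>
    also have "\<dots> \<le> (?C + 1) * (\<Sum>x\<in>F. (norm (c x))\<^sup>2)" by (intro mult_right_mono sum_nonneg) auto
    finally show ?thesis .
  qed
  moreover have "?C + 1 > 0" using D(1) W(1) R by (intro add_nonneg_pos mult_nonneg_nonneg) auto
  ultimately show ?thesis by blast
qed

text \<open>For large \<open>R\<close> the Gram matrix is diagonally dominant. After removal of the
  factor \<open>R ^ DIM('a)\<close> its diagonal entry is the integral of the window, while one
  spare power in the decay of \<open>fourier bump\<close> makes the off-diagonal row sums of size 1
  / (R e), with \<open>e\<close> the separation of \<Lambda>.\<close>

lemma window_energy_lower:
  fixes \<Lambda> :: "'a::euclidean_space set"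
  assumes \<Lambda>: "uniform_discrete \<Lambda>"
  shows "\<exists>R\<ge>1. \<exists>\<delta>>0. \<forall>F c. finite F \<longrightarrow> F \<subseteq> \<Lambda> \<longrightarrow> \<delta> * (\<Sum>x\<in>F. (norm (c x))\<^sup>2) \<le> window_energy R 0 (trig_sum c F)"
proof -
  obtain e where e: "e > 0" "\<And>x y. x \<in> \<Lambda> \<Longrightarrow> y \<in> \<Lambda> \<Longrightarrow> x \<noteq> y \<Longrightarrow> e \<le> norm (x - y)"
    using \<Lambda> unfolding uniform_discrete_def by (metis dist_norm not_le)
  obtain D where D: "D \<ge> 0" "\<And>u. (1 + norm u) * norm (fourier bump u) \<le> D * weight (u::'a)"
    using rapid_weight[OF schwartzD(4)[OF fourier_schwartz[OF bump_schwartz]], of 1] by auto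
  obtain W where W: "W \<ge> 0" "\<And>t F. finite F \<Longrightarrow> F \<subseteq> \<Lambda> \<Longrightarrow> (\<Sum>y\<in>F. weight (y - t)) \<le> W"
    using wud_sum_weight_1[OF uniform_discrete_imp_weakly[OF \<Lambda>]] by blast
  define J where "J = integral\<^sup>L lborel (bumpr :: 'a \<Rightarrow> real)"
  have J: "J > 0" using integral_bumpr_pow_pos[of 0, where 'a='a] by (simp add: J_def)
  have f0: "fourier bump (0::'a) = of_real J"
    by (simp add: fourier_cis2 J_def bump_def[abs_def])
  \<comment> \<open>Chosen so that the off-diagonal row sums are at most half of the diagonal
    entry.\<close>
  define R where "R = max 1 (2 * D * W / (e * J))"
  have R: "R \<ge> 1" "D * W / (R * e) \<le> J / 2"
  proof -
    have "2 * D * W / (e * J) \<le> R" by (simp add: R_def)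
    then have "2 * D * W \<le> R * (e * J)" using e J by (simp add: divide_le_eq)
    moreover show "R \<ge> 1" by (simp add: R_def)
    ultimately show "D * W / (R * e) \<le> J / 2" using e by (simp add: field_simps)
  qed
  have "R ^ DIM('a) * (J / 2) * (\<Sum>x\<in>F. (norm (c x))\<^sup>2) \<le> window_energy R 0 (trig_sum c F)"
    if F: "finite F" "F \<subseteq> \<Lambda>" for F c
  proof -
    let ?G = "\<lambda>x y. c x * cnj (c y) * (of_real (R ^ DIM('a)) * fourier bump (R *\<^sub>R (x - y)))"
    let ?K = "\<lambda>x y. if x = y then 0 else R ^ DIM('a) * norm (fourier bump (R *\<^sub>R (x - y)))"
    have split: "?G x y = (if x = y then of_real (R ^ DIM('a) * J * (norm (c x))\<^sup>2) else 0) + (if x = y then 0 else ?G x y)" for x y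
      using complex_norm_square[of "c x"] by (cases "x = y") (simp_all add: f0)
    have "complex_of_real (window_energy R 0 (trig_sum c F)) = (\<Sum>x\<in>F. \<Sum>y\<in>F. ?G x y)"
      using R window_energy_trig_sum[of R F 0 c] F by simp
    also have "\<dots> = (\<Sum>x\<in>F. \<Sum>y\<in>F. (if x = y then of_real (R ^ DIM('a) * J * (norm (c x))\<^sup>2) else 0) + (if x = y then 0 else ?G x y))"
      by (intro sum.cong refl split)
    also have "\<dots> = of_real (R ^ DIM('a) * J * (\<Sum>x\<in>F. (norm (c x))\<^sup>2)) + (\<Sum>x\<in>F. \<Sum>y\<in>F. if x = y then 0 else ?G x y)"
      using F(1) by (simp add: sum.distrib sum_distrib_left)
    finally have "complex_of_real (R ^ DIM('a) * J * (\<Sum>x\<in>F. (norm (c x))\<^sup>2) - window_energy R 0 (trig_sum c F))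
        = - (\<Sum>x\<in>F. \<Sum>y\<in>F. if x = y then 0 else ?G x y)" by simp
    then have "norm (complex_of_real (R ^ DIM('a) * J * (\<Sum>x\<in>F. (norm (c x))\<^sup>2) - window_energy R 0 (trig_sum c F)))
        \<le> (\<Sum>x\<in>F. \<Sum>y\<in>F. norm (c x) * norm (c y) * ?K x y)"
      using R by (simp only: norm_minus_cancel) (intro order_trans[OF norm_sum] sum_mono, simp add: norm_mult norm_power)
    also have "\<dots> \<le> (R ^ DIM('a) * (J / 2)) * (\<Sum>x\<in>F. (norm (c x))\<^sup>2)"
    proof (rule schur_bound)
      fix x y :: 'a
      show "?K x y \<ge> 0" using R by simp
      show "?K x y = ?K y x"
        using fourier_bump_minus[of "R *\<^sub>R (x - y)"] by (simp add: scaleR_diff_right)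
      assume x: "x \<in> F"
      have "?K x y \<le> R ^ DIM('a) * (D / (R * e) * weight (y - x))" if y: "y \<in> F" for y
      proof (cases "x = y")
        case False
        then have n: "R * e \<le> norm (R *\<^sub>R (x - y))" using e(2)[of x y] x y F R by auto
        have "(R * e) * norm (fourier bump (R *\<^sub>R (x - y))) \<le> (1 + norm (R *\<^sub>R (x - y))) * norm (fourier bump (R *\<^sub>R (x - y)))"
          using n by (intro mult_right_mono) auto
        also have "\<dots> \<le> D * weight (R *\<^sub>R (x - y))" by (rule D)
        also have "\<dots> \<le> D * weight (x - y)" by (intro mult_left_mono weight_scale R D)
        also have "weight (x - y) = weight (y - x)" using weight_minus[of "x - y"] by simp
        finally have "norm (fourier bump (R *\<^sub>R (x - y))) \<le> D / (R * e) * weight (y - x)"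
          using R e by (simp add: field_simps)
        then have "R ^ DIM('a) * norm (fourier bump (R *\<^sub>R (x - y))) \<le> R ^ DIM('a) * (D / (R * e) * weight (y - x))"
          using R by (intro mult_left_mono) auto
        then show ?thesis by (simp only: False if_False)
      qed (use D R e in auto)
      then have "(\<Sum>y\<in>F. ?K x y) \<le> (\<Sum>y\<in>F. R ^ DIM('a) * (D / (R * e) * weight (y - x)))"
        by (rule sum_mono)
      also have "\<dots> = R ^ DIM('a) * (D / (R * e) * (\<Sum>y\<in>F. weight (y - x)))"
        by (simp only: sum_distrib_left)
      also have "\<dots> \<le> R ^ DIM('a) * (D / (R * e) * W)"
        using R e D W F by (intro mult_left_mono) auto
      also have "\<dots> \<le> R ^ DIM('a) * (J / 2)" using R by (intro mult_left_mono) auto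
      finally show "(\<Sum>y\<in>F. ?K x y) \<le> R ^ DIM('a) * (J / 2)" .
    qed
    finally have "R ^ DIM('a) * J * (\<Sum>x\<in>F. (norm (c x))\<^sup>2) - window_energy R 0 (trig_sum c F)
        \<le> (R ^ DIM('a) * (J / 2)) * (\<Sum>x\<in>F. (norm (c x))\<^sup>2)"
      by (simp only: norm_of_real)
    then show ?thesis by (simp add: algebra_simps)
  qed
  moreover have "R ^ DIM('a) * (J / 2) > 0" using R J by simp
  ultimately show ?thesis using R(1) by blast
qed

lemma
  fixes h :: "'a::euclidean_space \<Rightarrow> complex"
  assumes ap: "\<And>\<epsilon>. \<epsilon> > 0 \<Longrightarrow> \<exists>F. finite F \<and> F \<subseteq> \<Lambda> \<and> (\<forall>k. norm (h k - trig_sum c F k) \<le> \<epsilon>)"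
  shows trig_limit_measurable: "h \<in> borel_measurable borel"
    and trig_limit_bounded: "\<exists>B. \<forall>k. norm (h k) \<le> B"
proof -
  have "\<exists>F. \<forall>k. norm (h k - trig_sum c F k) \<le> 1 / real (Suc n)" for n
    using ap[of "1 / real (Suc n)"] by auto
  then obtain F where F: "\<And>n k. norm (h k - trig_sum c (F n) k) \<le> 1 / real (Suc n)" by metis
  have "(\<lambda>n. trig_sum c (F n) k) \<longlonglongrightarrow> h k" for k
    by (rule LIMSEQ_norm_le_inverse) (use F in \<open>simp add: norm_minus_commute\<close>)
  from borel_measurable_LIMSEQ_metric[where f = "\<lambda>n. trig_sum c (F n)", OF trig_sum_measurable this]
  show "h \<in> borel_measurable borel" .
  have "norm (h k) \<le> (\<Sum>x\<in>F 0. norm (c x)) + 1" for k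
    using norm_triangle_sub[of "h k" "trig_sum c (F 0) k"] F[of k 0] norm_trig_sum_le[of c "F 0" k] by simp
  then show "\<exists>B. \<forall>k. norm (h k) \<le> B" by blast
qed

text \<open>Both energies are comparable to \<open>\<Sum> \<bar>c x\<bar>\<^sup>2\<close>, which knows nothing about the position of the
  window.\<close>

lemma window_comparison:
  fixes \<Lambda> :: "'a::euclidean_space set"
  assumes \<Lambda>: "uniform_discrete \<Lambda>"
  obtains R K where "R \<ge> 1" "K \<ge> 0"
    "\<And>c s h. (\<And>\<epsilon>. \<epsilon> > 0 \<Longrightarrow> \<exists>F. finite F \<and> F \<subseteq> \<Lambda> \<and> (\<forall>k. norm (h k - trig_sum c F k) \<le> \<epsilon>)) \<Longrightarrow>
      window_energy 1 s h \<le> K * window_energy R 0 h"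
proof -
  obtain R \<delta> where R: "R \<ge> 1" "\<delta> > 0"
    and lo: "\<And>F c. finite F \<Longrightarrow> F \<subseteq> \<Lambda> \<Longrightarrow> \<delta> * (\<Sum>x\<in>F. (norm (c x))\<^sup>2) \<le> window_energy R 0 (trig_sum c F)"
    using window_energy_lower[OF \<Lambda>] by blast
  obtain C where C: "C > 0"
    and up: "\<And>F c s. finite F \<Longrightarrow> F \<subseteq> \<Lambda> \<Longrightarrow> window_energy 1 s (trig_sum c F) \<le> C * (\<Sum>x\<in>F. (norm (c x))\<^sup>2)"
    using window_energy_upper[OF uniform_discrete_imp_weakly[OF \<Lambda>] order_refl] by blast
  define K where "K = C / \<delta>"
  have K: "K \<ge> 0" using C R by (simp add: K_def)
  have cmp: "window_energy 1 s (trig_sum c F) \<le> K * window_energy R 0 (trig_sum c F)"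
    if F: "finite F" "F \<subseteq> \<Lambda>" for F c s
  proof -
    have "window_energy 1 s (trig_sum c F) \<le> C * (\<Sum>x\<in>F. (norm (c x))\<^sup>2)" by (rule up[OF F])
    also have "(\<Sum>x\<in>F. (norm (c x))\<^sup>2) \<le> window_energy R 0 (trig_sum c F) / \<delta>"
      using lo[OF F, of c] R by (simp add: pos_le_divide_eq mult.commute)
    finally show ?thesis using C by (simp add: K_def mult_left_mono)
  qed
  show ?thesis
  \<comment> \<open>Passing between \<open>h\<close> and a trigonometric approximation costs a
    factor 2 in each of the two windows.\<close>
  proof (rule that[of R "4 * K"])
    fix c s h
    assume ap: "\<And>\<epsilon>. \<epsilon> > 0 \<Longrightarrow> \<exists>F. finite F \<and> F \<subseteq> \<Lambda> \<and> (\<forall>k. norm (h k - trig_sum c F k) \<le> \<epsilon>)"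
    note hm [measurable] = trig_limit_measurable[OF ap]
    obtain B where hB: "\<And>k. norm (h k) \<le> B" using trig_limit_bounded[OF ap] by blast
    have mix: "window_energy r s f \<le> 2 * window_energy r s g + 2 * \<epsilon>\<^sup>2 * (\<integral>k. bumpr ((1 / r) *\<^sub>R (k - s)) \<partial>lborel)"
      if r: "r > 0" and [measurable]: "f \<in> borel_measurable borel" "g \<in> borel_measurable borel"
        and b: "\<And>k. norm (f k) \<le> Bf" "\<And>k. norm (g k) \<le> Bg" and d: "\<And>k. norm (f k - g k) \<le> \<epsilon>"
      for r s Bf Bg \<epsilon> and f g :: "'a \<Rightarrow> complex"
    proof -
      have "window_energy r s f \<le> (\<integral>k. 2 * (bumpr ((1 / r) *\<^sub>R (k - s)) * (norm (g k))\<^sup>2) + 2 * \<epsilon>\<^sup>2 * bumpr ((1 / r) *\<^sub>R (k - s)) \<partial>lborel)"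
        unfolding window_energy_def
      proof (rule integral_mono)
        show "integrable lborel (\<lambda>k. bumpr ((1 / r) *\<^sub>R (k - s)) * (norm (f k))\<^sup>2)"
          by (rule window_integrable[OF r _ b(1)]) measurable
        show "integrable lborel (\<lambda>k. 2 * (bumpr ((1 / r) *\<^sub>R (k - s)) * (norm (g k))\<^sup>2) + 2 * \<epsilon>\<^sup>2 * bumpr ((1 / r) *\<^sub>R (k - s)))"
          using r by (intro Bochner_Integration.integrable_add integrable_mult_right window_integrable[OF r _ b(2)] bumpr_scaled) auto
        fix k
        have "(norm (f k))\<^sup>2 \<le> (norm (g k) + \<epsilon>)\<^sup>2"
          using norm_triangle_sub[of "f k" "g k"] d[of k] by (intro power_mono) auto
        also have "\<dots> \<le> 2 * (norm (g k))\<^sup>2 + 2 * \<epsilon>\<^sup>2"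
          using zero_le_power2[of "norm (g k) - \<epsilon>"] by (simp add: power2_diff power2_sum)
        finally have "bumpr ((1 / r) *\<^sub>R (k - s)) * (norm (f k))\<^sup>2 \<le> bumpr ((1 / r) *\<^sub>R (k - s)) * (2 * (norm (g k))\<^sup>2 + 2 * \<epsilon>\<^sup>2)"
          by (rule mult_left_mono) auto
        then show "bumpr ((1 / r) *\<^sub>R (k - s)) * (norm (f k))\<^sup>2 \<le>
            2 * (bumpr ((1 / r) *\<^sub>R (k - s)) * (norm (g k))\<^sup>2) + 2 * \<epsilon>\<^sup>2 * bumpr ((1 / r) *\<^sub>R (k - s))"
          by (simp add: algebra_simps)
      qed
      also have "\<dots> = (\<integral>k. 2 * (bumpr ((1 / r) *\<^sub>R (k - s)) * (norm (g k))\<^sup>2) \<partial>lborel) + (\<integral>k. 2 * \<epsilon>\<^sup>2 * bumpr ((1 / r) *\<^sub>R (k - s)) \<partial>lborel)"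
        using r by (intro Bochner_Integration.integral_add integrable_mult_right window_integrable[OF r _ b(2)] bumpr_scaled) auto
      finally show ?thesis by (simp add: window_energy_def)
    qed
    let ?J = "\<lambda>r s. \<integral>k. bumpr ((1 / r) *\<^sub>R (k - s)) \<partial>(lborel :: 'a measure)"
    have J0: "?J r s \<ge> 0" for r s by (intro Bochner_Integration.integral_nonneg) auto
    define L where "L = 4 * K * ?J R 0 + 2 * ?J 1 s"
    have L: "L \<ge> 0" unfolding L_def using K J0 by (intro add_nonneg_nonneg mult_nonneg_nonneg) auto
    have "window_energy 1 s h \<le> 4 * K * window_energy R 0 h + \<epsilon>\<^sup>2 * L" if \<epsilon>: "\<epsilon> > 0" for \<epsilon>
    proof -
      obtain F where F: "finite F" "F \<subseteq> \<Lambda>" "\<And>k. norm (h k - trig_sum c F k) \<le> \<epsilon>" using ap[OF \<epsilon>] by blast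
      have F': "norm (trig_sum c F k - h k) \<le> \<epsilon>" for k using F(3)[of k] by (simp add: norm_minus_commute)
      have 1: "window_energy 1 s h \<le> 2 * window_energy 1 s (trig_sum c F) + 2 * \<epsilon>\<^sup>2 * ?J 1 s"
        by (rule mix[OF _ hm trig_sum_measurable hB norm_trig_sum_le F(3)]) simp
      have 2: "window_energy 1 s (trig_sum c F) \<le> K * window_energy R 0 (trig_sum c F)" by (rule cmp[OF F(1,2)])
      have "window_energy R 0 (trig_sum c F) \<le> 2 * window_energy R 0 h + 2 * \<epsilon>\<^sup>2 * ?J R 0"
        by (rule mix[OF _ trig_sum_measurable hm norm_trig_sum_le hB F']) (use R in simp)
      then have "K * window_energy R 0 (trig_sum c F) \<le> K * (2 * window_energy R 0 h + 2 * \<epsilon>\<^sup>2 * ?J R 0)"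
        using K by (rule mult_left_mono)
      moreover have "2 * (K * (2 * window_energy R 0 h + 2 * \<epsilon>\<^sup>2 * ?J R 0)) + 2 * \<epsilon>\<^sup>2 * ?J 1 s = 4 * K * window_energy R 0 h + \<epsilon>\<^sup>2 * L"
        by (simp add: L_def algebra_simps)
      ultimately show ?thesis using 1 2 by linarith
    qed note eps = this
    show "window_energy 1 s h \<le> 4 * K * window_energy R 0 h"
    proof (rule field_le_epsilon)
      fix \<eta> :: real assume \<eta>: "\<eta> > 0"
      \<comment> \<open>Solves \<epsilon>^2 L <= \<eta>; the denominator \<open>L + 1\<close> avoids
        division by 0.\<close>
      define \<epsilon> where "\<epsilon> = sqrt (\<eta> / (L + 1))"
      have "\<epsilon>\<^sup>2 * L \<le> \<eta>" using \<eta> L by (simp add: \<epsilon>_def divide_le_eq mult_left_mono field_simps)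
      moreover have "\<epsilon> > 0" using \<eta> L by (simp add: \<epsilon>_def)
      ultimately show "window_energy 1 s h \<le> 4 * K * window_energy R 0 h + \<eta>" using eps[of \<epsilon>] by linarith
    qed
  qed (use R K in auto)
qed


section \<open>Boundedness of the coefficients\<close>

text \<open>One finite set serves all families dominated by \<open>n\<close>. In
  \<open>blurred_approx\<close> this makes the approximation uniform in \<open>k\<close>.\<close>

lemma summable_finite_approx:
  fixes n :: "'a \<Rightarrow> real"
  assumes n: "n summable_on A" and \<epsilon>: "\<epsilon> > 0"
  shows "\<exists>F. finite F \<and> F \<subseteq> A \<and>
    (\<forall>f :: 'a \<Rightarrow> complex. (\<forall>x\<in>A. norm (f x) \<le> n x) \<longrightarrow> norm (infsum f A - sum f F) \<le> \<epsilon>)"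
proof -
  have "\<forall>\<^sub>F F in finite_subsets_at_top A. dist (sum n F) (infsum n A) < \<epsilon>"
    using infsum_tendsto[OF n] \<epsilon> by (rule tendstoD)
  then obtain F where F: "finite F" "F \<subseteq> A" "dist (sum n F) (infsum n A) < \<epsilon>"
    unfolding eventually_finite_subsets_at_top by blast
  have "norm (infsum f A - sum f F) \<le> \<epsilon>" if f: "\<And>x. x \<in> A \<Longrightarrow> norm (f x) \<le> n x" for f :: "'a \<Rightarrow> complex"
  proof -
    have nf: "(\<lambda>x. norm (f x)) summable_on A"
      by (rule Infinite_Sum.abs_summable_on_comparison_test'[OF n f])
    have sf: "f summable_on A" by (rule abs_summable_summable[OF nf])
    have "infsum f A - sum f F = infsum f (A - F)"
      using infsum_Diff[OF sf, of F] F by simp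
    also have "norm \<dots> \<le> infsum (\<lambda>x. norm (f x)) (A - F)"
      by (rule norm_infsum_bound) (rule summable_on_subset_banach[OF nf], auto)
    also have "\<dots> \<le> infsum n (A - F)"
      using f by (intro infsum_mono summable_on_subset_banach[OF nf] summable_on_subset_banach[OF n]) auto
    also have "\<dots> = infsum n A - sum n F" using infsum_Diff[OF n, of F] F by simp
    also have "\<dots> \<le> \<epsilon>" using F(3) by (simp add: dist_real_def)
    finally show ?thesis .
  qed
  then show ?thesis by (intro exI[of _ F] conjI allI impI F(1,2)) blast
qed

lemma infsum_dominated_tendsto:
  fixes f :: "nat \<Rightarrow> 'a \<Rightarrow> complex"
  assumes n: "n summable_on A"
    and le: "\<And>k x. x \<in> A \<Longrightarrow> norm (f k x) \<le> n x"
    and lim: "\<And>x. x \<in> A \<Longrightarrow> (\<lambda>k. f k x) \<longlonglongrightarrow> g x"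
  shows "(\<lambda>k. infsum (f k) A) \<longlonglongrightarrow> infsum g A"
proof (rule tendstoI)
  fix \<epsilon> :: real assume \<epsilon>: "\<epsilon> > 0"
  have gle: "norm (g x) \<le> n x" if "x \<in> A" for x
    by (rule Lim_norm_ubound[OF _ lim[OF that]]) (use le that in auto)
  obtain F where F: "finite F" "F \<subseteq> A"
    and ap: "\<And>f :: 'a \<Rightarrow> complex. (\<forall>x\<in>A. norm (f x) \<le> n x) \<Longrightarrow> norm (infsum f A - sum f F) \<le> \<epsilon> / 4"
    using summable_finite_approx[OF n, of "\<epsilon> / 4"] \<epsilon> by auto
  have "(\<lambda>k. sum (f k) F) \<longlonglongrightarrow> sum g F"
    using F by (intro tendsto_sum lim) auto
  then have "\<forall>\<^sub>F k in sequentially. dist (sum (f k) F) (sum g F) < \<epsilon> / 4"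
    using \<epsilon> by (intro tendstoD) auto
  then show "\<forall>\<^sub>F k in sequentially. dist (infsum (f k) A) (infsum g A) < \<epsilon>"
  proof eventually_elim
    fix k assume k: "dist (sum (f k) F) (sum g F) < \<epsilon> / 4"
    have 1: "dist (infsum (f k) A) (sum (f k) F) \<le> \<epsilon> / 4" using ap[of "f k"] le by (auto simp: dist_norm)
    have 2: "dist (infsum g A) (sum g F) \<le> \<epsilon> / 4" using ap[of g] gle by (auto simp: dist_norm)
    show "dist (infsum (f k) A) (infsum g A) < \<epsilon>"
      using dist_triangle[of "infsum (f k) A" "infsum g A" "sum (f k) F"]
        dist_triangle[of "sum (f k) F" "infsum g A" "sum g F"] 1 2 k \<epsilon> by (simp add: dist_commute)
  qed
qed

lemma infsum_only:
  fixes f :: "'a \<Rightarrow> complex"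
  assumes "y \<in> A" "\<And>x. x \<in> A \<Longrightarrow> x \<noteq> y \<Longrightarrow> f x = 0" shows "infsum f A = f y"
  using infsum_cong_neutral[of "{y}" A f f] assms by auto

lemma bumpr_0_pos: "bumpr 0 > 0"
  by (rule bumpr_pos) simp

lemma bump_affine_schwartz: "c \<noteq> 0 \<Longrightarrow> (\<lambda>x. bump (c *\<^sub>R (x - t))) \<in> schwartz"
  using schwartz_affine[OF bump_schwartz, of c "- (c *\<^sub>R t)"] by (simp add: scaleR_diff_right)

lemma bump_affine_Cc:
  fixes t :: "'a::euclidean_space"
  assumes "c > 0" shows "(\<lambda>x. bump (c *\<^sub>R (x - t))) \<in> Cc"
proof (rule CcI(1)[of _ "norm t + 1 / c"])
  show "continuous_on UNIV (\<lambda>x. bump (c *\<^sub>R (x - t)))"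
    using assms by (intro schwartzD(3) bump_affine_schwartz) auto
  fix x :: 'a assume "norm x > norm t + 1 / c"
  then have "norm (x - t) > 1 / c" using norm_triangle_sub[of x t] by linarith
  then have "norm (c *\<^sub>R (x - t)) \<ge> 1" using assms by (simp add: pos_divide_less_eq mult.commute)
  then show "bump (c *\<^sub>R (x - t)) = 0" by (simp add: bump_def bumpr_eq_0)
qed

text \<open>The measures themselves do not occur: on smooth functions in \<open>Cc\<close> they
  agree with their tempered extensions, and coefficient bounds and summation formulas are questions
  about the latter.\<close>

locale fourier_pair =
  fixes \<Lambda> S :: "'a::euclidean_space set" and a b :: "'a \<Rightarrow> complex" and T\<^sub>\<mu> T\<^sub>\<nu> :: "'a functional"
  assumes ud: "uniform_discrete \<Lambda>" and wud: "weakly_uniformly_discrete S"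
    and tempered: "tempered_distribution T\<^sub>\<mu>" "tempered_distribution T\<^sub>\<nu>"
    and T\<^sub>\<mu>_sum: "\<And>\<phi>. \<phi> \<in> Cc \<Longrightarrow> smooth \<phi> \<Longrightarrow> T\<^sub>\<mu> \<phi> = (\<Sum>\<^sub>\<infinity>x\<in>\<Lambda>. a x * \<phi> x)"
    and T\<^sub>\<nu>_sum: "\<And>\<phi>. \<phi> \<in> Cc \<Longrightarrow> smooth \<phi> \<Longrightarrow> T\<^sub>\<nu> \<phi> = (\<Sum>\<^sub>\<infinity>y\<in>S. b y * \<phi> y)"
    and T\<^sub>\<nu>_fourier: "\<And>\<phi>. \<phi> \<in> schwartz \<Longrightarrow> T\<^sub>\<nu> \<phi> = T\<^sub>\<mu> (fourier \<phi>)"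
begin

lemma wud\<^sub>\<Lambda>: "weakly_uniformly_discrete \<Lambda>"
  by (rule uniform_discrete_imp_weakly[OF ud])

lemma separation: "\<exists>e>0. \<forall>x\<in>\<Lambda>. \<forall>y\<in>\<Lambda>. x \<noteq> y \<longrightarrow> e \<le> norm (x - y)"
  using ud unfolding uniform_discrete_def by (metis dist_norm not_le)

text \<open>A bump whose radius is the separation of \<Lambda> and whose centre is \<open>t\<close>
  meets no other point of \<Lambda>.\<close>

lemma a_growth: "\<exists>M N. \<forall>x\<in>\<Lambda>. norm (a x) \<le> M * (1 + norm x) ^ N"
proof -
  obtain e where e: "e > 0" "\<And>x y. x \<in> \<Lambda> \<Longrightarrow> y \<in> \<Lambda> \<Longrightarrow> x \<noteq> y \<Longrightarrow> e \<le> norm (x - y)"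
    using separation by blast
  have "(\<lambda>x::'a. bump ((1/e) *\<^sub>R (x - 0))) \<in> schwartz" using e by (intro bump_affine_schwartz) auto
  then have "(\<lambda>x::'a. bump ((1/e) *\<^sub>R x)) \<in> schwartz" by simp
  from tempered_shift_bound[OF tempered(1) this] obtain C N where
    C: "\<And>t. norm (T\<^sub>\<mu> (\<lambda>x. bump ((1/e) *\<^sub>R (x - t)))) \<le> C * (1 + norm t) ^ N" by blast
  have "norm (a t) \<le> (C / bumpr (0::'a)) * (1 + norm t) ^ N" if t: "t \<in> \<Lambda>" for t
  proof -
    have "T\<^sub>\<mu> (\<lambda>x. bump ((1/e) *\<^sub>R (x - t))) = (\<Sum>\<^sub>\<infinity>x\<in>\<Lambda>. a x * bump ((1/e) *\<^sub>R (x - t)))"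
      using e by (intro T\<^sub>\<mu>_sum bump_affine_Cc schwartz_smooth bump_affine_schwartz) auto
    also have "\<dots> = a t * bump ((1/e) *\<^sub>R (t - t))"
    proof (rule infsum_only[OF t])
      fix x assume "x \<in> \<Lambda>" "x \<noteq> t"
      then have "norm ((1/e) *\<^sub>R (x - t)) \<ge> 1" using e(2)[of x t] e(1) t by simp
      then show "a x * bump ((1/e) *\<^sub>R (x - t)) = 0" by (simp add: bump_def bumpr_eq_0)
    qed
    finally have "norm (a t) * bumpr (0::'a) \<le> C * (1 + norm t) ^ N"
      using C[of t] by (simp add: norm_mult)
    then show ?thesis using bumpr_0_pos[where 'a='a] by (simp add: field_simps)
  qed
  then show ?thesis by blast
qed

lemma T\<^sub>\<mu>_schwartz:
  assumes "\<psi> \<in> schwartz"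
  shows "(\<lambda>x. norm (a x * \<psi> x)) summable_on \<Lambda>" "T\<^sub>\<mu> \<psi> = (\<Sum>\<^sub>\<infinity>x\<in>\<Lambda>. a x * \<psi> x)"
proof -
  obtain M N where "\<And>x. x \<in> \<Lambda> \<Longrightarrow> norm (a x) \<le> M * (1 + norm x) ^ N" using a_growth by blast
  note * = tempered_point_sum[OF wud\<^sub>\<Lambda> this tempered(1) T\<^sub>\<mu>_sum assms]
  show "(\<lambda>x. norm (a x * \<psi> x)) summable_on \<Lambda>" by (rule *(1))
  show "T\<^sub>\<mu> \<psi> = (\<Sum>\<^sub>\<infinity>x\<in>\<Lambda>. a x * \<psi> x)" by (rule *(2))
qed

text \<open>The distribution \<open>T\<^sub>\<nu>\<close> smoothed at scale 1/t. Only finitely many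
  terms are nonzero for each \<open>k\<close>, so the sum makes sense before anything is known about
  the growth of \<open>b\<close>.\<close>

definition blurred :: "real \<Rightarrow> 'a \<Rightarrow> complex" where
  "blurred t k = (\<Sum>\<^sub>\<infinity>y\<in>S. b y * bump (t *\<^sub>R (y - k)))"

text \<open>Moving the bump to \<open>k\<close> multiplies its transform by a character, so
  \<open>blurred t\<close> is an absolutely convergent trigonometric series over \<Lambda> with
  coefficients independent of \<open>k\<close>. This is the form \<open>window_comparison\<close>
  asks for.\<close>

lemma blurred_approx:
  assumes t: "t > 0"
  shows "\<exists>c. \<forall>\<epsilon>>0. \<exists>F. finite F \<and> F \<subseteq> \<Lambda> \<and> (\<forall>k. norm (blurred t k - trig_sum c F k) \<le> \<epsilon>)"
proof -
  define c where "c x = a x * ((1 / t ^ DIM('a)) *\<^sub>R fourier bump ((1/t) *\<^sub>R x))" for x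
  have \<psi>: "(\<lambda>x::'a. (1 / t ^ DIM('a)) *\<^sub>R fourier bump ((1/t) *\<^sub>R x)) \<in> schwartz"
  proof -
    have "(\<lambda>x::'a. fourier bump ((1/t) *\<^sub>R x + 0)) \<in> schwartz"
      using t by (intro schwartz_affine fourier_schwartz bump_schwartz) auto
    from schwartz_cmult[OF this, of "of_real (1 / t ^ DIM('a))"]
    show ?thesis by (simp add: scaleR_conv_of_real)
  qed
  have cs: "(\<lambda>x. norm (c x)) summable_on \<Lambda>"
    unfolding c_def by (rule T\<^sub>\<mu>_schwartz(1)[OF \<psi>])
  have eq: "blurred t k = (\<Sum>\<^sub>\<infinity>x\<in>\<Lambda>. c x * cis2 (- (k \<bullet> x)))" for k
  proof -
    have s: "(\<lambda>y. bump (t *\<^sub>R (y - k))) \<in> schwartz" using t by (intro bump_affine_schwartz) auto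
    have "blurred t k = T\<^sub>\<nu> (\<lambda>y. bump (t *\<^sub>R (y - k)))"
      unfolding blurred_def using t by (intro T\<^sub>\<nu>_sum[symmetric] bump_affine_Cc schwartz_smooth s)
    also have "\<dots> = T\<^sub>\<mu> (fourier (\<lambda>y. bump (t *\<^sub>R (y - k))))" by (rule T\<^sub>\<nu>_fourier[OF s])
    also have "\<dots> = (\<Sum>\<^sub>\<infinity>x\<in>\<Lambda>. a x * fourier (\<lambda>y. bump (t *\<^sub>R (y - k))) x)"
      by (rule T\<^sub>\<mu>_schwartz(2)[OF fourier_schwartz[OF s]])
    also have "\<dots> = (\<Sum>\<^sub>\<infinity>x\<in>\<Lambda>. c x * cis2 (- (k \<bullet> x)))"
      by (simp add: fourier_affine[OF schwartzD(5)[OF bump_schwartz] t] c_def divide_inverse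
          inner_commute scaleR_conv_of_real mult_ac)
    finally show ?thesis .
  qed
  have "\<exists>F. finite F \<and> F \<subseteq> \<Lambda> \<and> (\<forall>k. norm (blurred t k - trig_sum c F k) \<le> \<epsilon>)" if "\<epsilon> > 0" for \<epsilon>
  proof -
    obtain F where F: "finite F" "F \<subseteq> \<Lambda>"
      "\<And>f :: 'a \<Rightarrow> complex. (\<forall>x\<in>\<Lambda>. norm (f x) \<le> norm (c x)) \<Longrightarrow> norm (infsum f \<Lambda> - sum f F) \<le> \<epsilon>"
      using summable_finite_approx[OF cs \<open>\<epsilon> > 0\<close>] by blast
    have "norm (blurred t k - trig_sum c F k) \<le> \<epsilon>" for k
      unfolding eq trig_sum_def by (rule F(3)) (simp add: norm_mult)
    with F show ?thesis by blast
  qed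
  then show ?thesis by blast
qed

text \<open>The bound near the origin must hold for every \<open>t\<close>, since the scale is
  chosen only afterwards, in terms of the gap around \<open>y0\<close>.\<close>

lemma b_bounded: "\<exists>B\<ge>0. \<forall>y\<in>S. norm (b y) \<le> B"
proof -
  obtain R K where R: "R \<ge> 1" "K \<ge> 0" and cmp:
    "\<And>c s h. (\<And>\<epsilon>. \<epsilon> > 0 \<Longrightarrow> \<exists>F. finite F \<and> F \<subseteq> \<Lambda> \<and> (\<forall>k. norm (h k - trig_sum c F k) \<le> \<epsilon>)) \<Longrightarrow>
      window_energy 1 s h \<le> K * window_energy R 0 h"
    using window_comparison[OF ud] by metis
  \<comment> \<open>The window at the origin has radius \<open>R\<close> and the bumps have radius
    1/t <= 1, so no point outside this ball contributes, whatever \<open>t\<close> is.\<close>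
  define S0 where "S0 = S \<inter> cball 0 (R + 1)"
  have S0: "finite S0" unfolding S0_def by (rule wud_finite_cball[OF wud])
  define J where "J n = (\<integral>x. bumpr x ^ Suc n \<partial>(lborel :: 'a measure))" for n
  have J: "J n > 0" for n unfolding J_def by (rule integral_bumpr_pow_pos)
  define M where "M = (\<Sum>y\<in>S0. real (card S0) * (norm (b y))\<^sup>2)"
  have M: "M \<ge> 0" unfolding M_def by (intro sum_nonneg) auto
  have upper: "window_energy R 0 (blurred t) \<le> M * J 0 / t ^ DIM('a)" if t: "t \<ge> 1" for t
  proof -
    have "window_energy R 0 (blurred t) \<le>
       (\<integral>k. (\<Sum>y\<in>S0. real (card S0) * (norm (b y))\<^sup>2 * bumpr (t *\<^sub>R (k - y))) \<partial>lborel)"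
      unfolding window_energy_def
    proof (rule integral_mono')
      show "integrable lborel (\<lambda>k. \<Sum>y\<in>S0. real (card S0) * (norm (b y))\<^sup>2 * bumpr (t *\<^sub>R (k - y)))"
        using t by (intro Bochner_Integration.integrable_sum integrable_mult_right bumpr_scaled) auto
      show "0 \<le> (\<Sum>y\<in>S0. real (card S0) * (norm (b y))\<^sup>2 * bumpr (t *\<^sub>R (k - y)))" for k
        by (intro sum_nonneg) auto
      show "bumpr ((1 / R) *\<^sub>R (k - 0)) * (norm (blurred t k))\<^sup>2
          \<le> (\<Sum>y\<in>S0. real (card S0) * (norm (b y))\<^sup>2 * bumpr (t *\<^sub>R (k - y)))" for k
      proof (cases "norm k < R")
        case False
        then have "bumpr ((1 / R) *\<^sub>R (k - 0)) = 0" using R by (intro bumpr_eq_0) simp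
        then show ?thesis by (simp add: sum_nonneg)
      next
        case True
        have "blurred t k = (\<Sum>y\<in>S0. b y * bump (t *\<^sub>R (y - k)))"
          unfolding blurred_def infsum_finite[OF S0, symmetric]
        proof (rule infsum_cong_neutral)
          fix y assume "y \<in> S - S0"
          then have "norm y > R + 1" by (auto simp: S0_def)
          then have "norm (y - k) \<ge> 1" using True norm_triangle_sub[of y k] by linarith
          then have "norm (t *\<^sub>R (y - k)) \<ge> 1" using t mult_mono[of 1 t 1 "norm (y - k)"] by simp
          then show "b y * bump (t *\<^sub>R (y - k)) = 0" by (simp add: bump_def bumpr_eq_0)
        qed (auto simp: S0_def)
        then have "norm (blurred t k) \<le> (\<Sum>y\<in>S0. 1 * (norm (b y) * bumpr (t *\<^sub>R (k - y))))"
          using bumpr_minus[of "t *\<^sub>R (_ - k)"]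
          by (simp only:) (intro order_trans[OF norm_sum] sum_mono, simp add: norm_mult scaleR_diff_right bumpr_def inner_commute algebra_simps)
        then have "(norm (blurred t k))\<^sup>2 \<le> (\<Sum>y\<in>S0. 1 * (norm (b y) * bumpr (t *\<^sub>R (k - y))))\<^sup>2"
          by (rule power_mono) simp
        \<comment> \<open>Cauchy-Schwarz over the points of \<open>S0\<close>; their number is the
          factor \<open>card S0\<close> in \<open>M\<close>.\<close>
        also have "\<dots> \<le> (\<Sum>y\<in>S0. 1\<^sup>2) * (\<Sum>y\<in>S0. (norm (b y) * bumpr (t *\<^sub>R (k - y)))\<^sup>2)"
          by (rule Cauchy_Schwarz_ineq_sum)
        also have "\<dots> = (\<Sum>y\<in>S0. real (card S0) * (norm (b y))\<^sup>2 * (bumpr (t *\<^sub>R (k - y)))\<^sup>2)"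
          by (simp add: sum_distrib_left power_mult_distrib mult_ac)
        also have "\<dots> \<le> (\<Sum>y\<in>S0. real (card S0) * (norm (b y))\<^sup>2 * bumpr (t *\<^sub>R (k - y)))"
          using bumpr_le_1 by (intro sum_mono mult_left_mono) (auto simp: power2_eq_square intro!: mult_left_le)
        finally have "(norm (blurred t k))\<^sup>2 \<le> \<dots>" .
        moreover have "bumpr ((1 / R) *\<^sub>R (k - 0)) * (norm (blurred t k))\<^sup>2 \<le> 1 * (norm (blurred t k))\<^sup>2"
          by (intro mult_right_mono bumpr_le_1) auto
        ultimately show ?thesis by linarith
      qed
    qed
    also have "\<dots> = (\<Sum>y\<in>S0. real (card S0) * (norm (b y))\<^sup>2 * (\<integral>k. bumpr (t *\<^sub>R (k - y)) \<partial>lborel))"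
      using t by (subst Bochner_Integration.integral_sum) (auto intro!: integrable_mult_right bumpr_scaled)
    also have "\<dots> = M * J 0 / t ^ DIM('a)"
    proof -
      have "(\<integral>k. bumpr (t *\<^sub>R (k - y)) \<partial>lborel) = J 0 / t ^ DIM('a)" for y :: 'a
        using bumpr_scaled(2)[of t y 0] t by (simp add: J_def)
      then show ?thesis by (simp add: M_def sum_distrib_right sum_divide_distrib)
    qed
    finally show ?thesis .
  qed
  have "norm (b y0) \<le> sqrt (K * (M * J 0) / J 2)" if y0: "y0 \<in> S" for y0
  proof -
    obtain d where d: "d > 0" "\<And>y. y \<in> S \<inter> cball y0 1 \<Longrightarrow> y \<noteq> y0 \<Longrightarrow> d \<le> dist y0 y"
      using finite_set_avoid[OF wud_finite_cball(1)[OF wud, of y0 1], of y0] by blast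
    \<comment> \<open>All other points of \<open>S\<close> then have distance at least 2/t from
      \<open>y0\<close>, so their bumps of radius 1/t do not reach the bump at \<open>y0\<close>.
      The minimum with 1 accounts for points outside the unit ball and ensures t >= 1.\<close>
    define t where "t = 2 / min d 1"
    have t: "t \<ge> 1" "t > 0" using d by (auto simp: t_def)
    have sep: "2 / t \<le> norm (y - y0)" if "y \<in> S" "y \<noteq> y0" for y
    proof (cases "y \<in> cball y0 1")
      case True
      then have "d \<le> norm (y - y0)" using d(2)[of y] that by (simp add: dist_norm norm_minus_commute)
      then show ?thesis by (simp add: t_def)
    next
      case False
      then show ?thesis by (simp add: t_def dist_norm norm_minus_commute)
    qed
    obtain c where ap: "\<And>\<epsilon>. \<epsilon> > 0 \<Longrightarrow> \<exists>F. finite F \<and> F \<subseteq> \<Lambda> \<and> (\<forall>k. norm (blurred t k - trig_sum c F k) \<le> \<epsilon>)"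
      using blurred_approx[OF t(2)] by blast
    note [measurable] = trig_limit_measurable[OF ap]
    obtain Bh where Bh: "\<And>k. norm (blurred t k) \<le> Bh" using trig_limit_bounded[OF ap] by blast
    have "(norm (b y0))\<^sup>2 * (J 2 / t ^ DIM('a)) = (\<integral>k. (norm (b y0))\<^sup>2 * bumpr (t *\<^sub>R (k - y0)) ^ Suc 2 \<partial>lborel)"
      using bumpr_scaled(2)[OF t(2), of y0 2] by (simp add: J_def del: power_Suc)
    also have "\<dots> \<le> window_energy 1 y0 (blurred t)"
      unfolding window_energy_def
    proof (rule integral_mono')
      show "integrable lborel (\<lambda>k. bumpr ((1 / 1) *\<^sub>R (k - y0)) * (norm (blurred t k))\<^sup>2)"
        by (rule window_integrable[OF _ _ Bh]) auto
      show "0 \<le> bumpr ((1 / 1) *\<^sub>R (k - y0)) * (norm (blurred t k))\<^sup>2" for k by auto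
      show "(norm (b y0))\<^sup>2 * bumpr (t *\<^sub>R (k - y0)) ^ Suc 2 \<le> bumpr ((1 / 1) *\<^sub>R (k - y0)) * (norm (blurred t k))\<^sup>2" for k
      proof (cases "norm (t *\<^sub>R (k - y0)) < 1")
        case False
        then show ?thesis by (simp add: bumpr_eq_0)
      next
        case True
        then have k: "norm (k - y0) < 1 / t" using t by (simp add: pos_less_divide_eq mult.commute)
        have "blurred t k = b y0 * bump (t *\<^sub>R (y0 - k))"
          unfolding blurred_def
        proof (rule infsum_only[OF y0])
          fix y assume "y \<in> S" "y \<noteq> y0"
          then have "2 / t \<le> norm (y - y0)" by (rule sep)
          also have "\<dots> \<le> norm (y - k) + norm (k - y0)" using norm_triangle_ineq[of "y - k" "k - y0"] by simp
          finally have "1 / t \<le> norm (y - k)" using k by (simp add: field_simps)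
          then have "norm (t *\<^sub>R (y - k)) \<ge> 1" using t by (simp add: pos_divide_le_eq mult.commute)
          then show "b y * bump (t *\<^sub>R (y - k)) = 0" by (simp add: bump_def bumpr_eq_0)
        qed
        moreover have "bumpr (t *\<^sub>R (y0 - k)) = bumpr (t *\<^sub>R (k - y0))"
          using bumpr_minus[of "t *\<^sub>R (y0 - k)"] by (simp add: scaleR_diff_right)
        ultimately have n: "norm (blurred t k) = norm (b y0) * bumpr (t *\<^sub>R (k - y0))" by (simp add: norm_mult)
        \<comment> \<open>The radially decreasing window of radius 1 dominates the narrow bump,
          which raises the square of the bump to a cube with an explicitly scaled integral.\<close>
        have "bumpr (t *\<^sub>R (k - y0)) \<le> bumpr (k - y0)"
          using t mult_right_mono[of 1 t "norm (k - y0)"] by (intro bumpr_antimono) simp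
        then have "bumpr (t *\<^sub>R (k - y0)) * (norm (blurred t k))\<^sup>2 \<le> bumpr (k - y0) * (norm (blurred t k))\<^sup>2"
          by (rule mult_right_mono) simp
        then show ?thesis by (simp add: n power_mult_distrib power2_eq_square power3_eq_cube mult_ac)
      qed
    qed
    also have "\<dots> \<le> K * window_energy R 0 (blurred t)" by (rule cmp[OF ap])
    also have "\<dots> \<le> K * (M * J 0 / t ^ DIM('a))" by (intro mult_left_mono upper t R)
    \<comment> \<open>Both sides carried 1 / t ^ DIM('a); its cancellation frees the bound from the
      gap around \<open>y0\<close>.\<close>
    finally have "(norm (b y0))\<^sup>2 * J 2 \<le> K * (M * J 0)" using t by (simp add: field_simps)
    then have "(norm (b y0))\<^sup>2 \<le> K * (M * J 0) / J 2" using J[of 2] by (simp add: field_simps)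
    then show ?thesis by (rule real_le_rsqrt)
  qed
  moreover have "0 \<le> sqrt (K * (M * J 0) / J 2)"
    using R M less_imp_le[OF J] by (intro real_sqrt_ge_zero divide_nonneg_nonneg mult_nonneg_nonneg) auto
  ultimately show ?thesis by blast
qed

lemma T\<^sub>\<nu>_schwartz:
  assumes "\<psi> \<in> schwartz"
  shows "(\<lambda>x. norm (b x * \<psi> x)) summable_on S" "T\<^sub>\<nu> \<psi> = (\<Sum>\<^sub>\<infinity>x\<in>S. b x * \<psi> x)"
proof -
  obtain B where "\<And>y. y \<in> S \<Longrightarrow> norm (b y) \<le> B * (1 + norm y) ^ 0" using b_bounded by auto
  note * = tempered_point_sum[OF wud this tempered(2) T\<^sub>\<nu>_sum assms]
  show "(\<lambda>x. norm (b x * \<psi> x)) summable_on S" by (rule *(1))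
  show "T\<^sub>\<nu> \<psi> = (\<Sum>\<^sub>\<infinity>x\<in>S. b x * \<psi> x)" by (rule *(2))
qed

lemma poisson:
  assumes "\<psi> \<in> schwartz"
  shows "(\<Sum>\<^sub>\<infinity>y\<in>S. b y * \<psi> y) = (\<Sum>\<^sub>\<infinity>x\<in>\<Lambda>. a x * fourier \<psi> x)"
  using T\<^sub>\<nu>_schwartz(2)[OF assms] T\<^sub>\<mu>_schwartz(2)[OF fourier_schwartz[OF assms]] T\<^sub>\<nu>_fourier[OF assms] by simp

text \<open>A Gaussian of width 1/T around \<open>x0\<close> is the transform of a modulated
  Gaussian of width \<open>T\<close>, up to the factor \<open>T ^ DIM('a)\<close>. The sum over
  \<open>S\<close> is of the same order by \<open>wud_sum_weight\<close>, so the bound is uniform in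
  \<open>T\<close>, and large \<open>T\<close> leaves only the term at \<open>x0\<close>.\<close>

lemma a_bounded: "\<exists>B\<ge>0. \<forall>x\<in>\<Lambda>. norm (a x) \<le> B"
proof -
  obtain B where B: "B \<ge> 0" "\<And>y. y \<in> S \<Longrightarrow> norm (b y) \<le> B" using b_bounded by blast
  obtain D where D: "D \<ge> 0" "\<And>x. norm (gauss pi x) \<le> D * weight (x::'a)"
    using rapid_weight[OF gauss_rapid[of pi], of 0] by auto
  obtain C where C: "C \<ge> 0" "\<And>t T F. T \<ge> 1 \<Longrightarrow> finite F \<Longrightarrow> F \<subseteq> S \<Longrightarrow>
    (\<Sum>y\<in>F. weight ((1/T) *\<^sub>R (y - t))) \<le> C * T ^ DIM('a)" using wud_sum_weight[OF wud] by blast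
  obtain e where e: "e > 0" "\<And>x y. x \<in> \<Lambda> \<Longrightarrow> y \<in> \<Lambda> \<Longrightarrow> x \<noteq> y \<Longrightarrow> e \<le> norm (x - y)"
    using separation by blast
  have "norm (a x0) \<le> B * D * C" if x0: "x0 \<in> \<Lambda>" for x0
  proof -
    have bound: "norm (\<Sum>\<^sub>\<infinity>x\<in>\<Lambda>. a x * gauss pi (T *\<^sub>R (x - x0))) \<le> B * D * C" if T: "T \<ge> 1" for T
    proof -
      \<comment> \<open>The character centres the transform at \<open>x0\<close>; the dilation
        concentrates it at scale 1/T.\<close>
      define \<psi> where "\<psi> y = cis2 (y \<bullet> x0) * gauss pi ((1/T) *\<^sub>R (y - 0))" for y :: 'a
      have g: "(\<lambda>y::'a. gauss pi ((1/T) *\<^sub>R (y - 0))) \<in> schwartz"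
        using schwartz_affine[OF gauss_schwartz[OF pi_gt_zero], of "1/T" "0::'a"] T by simp
      have \<psi>: "\<psi> \<in> schwartz" unfolding \<psi>_def by (intro slow_mult_schwartz slow_cis2 g)
      have F: "fourier \<psi> x = of_real (T ^ DIM('a)) * gauss pi (T *\<^sub>R (x - x0))" for x
      proof -
        have "fourier \<psi> x = fourier (\<lambda>y. gauss pi ((1/T) *\<^sub>R (y - 0))) (x - x0)"
          unfolding fourier_cis2
        proof (rule Bochner_Integration.integral_cong[OF refl])
          fix y
          have "cis2 (- ((x - x0) \<bullet> y)) = cis2 (- (x \<bullet> y)) * cis2 (y \<bullet> x0)"
            by (simp add: cis2_add[symmetric] inner_diff_left inner_commute[of y])
          then show "cis2 (- (x \<bullet> y)) * \<psi> y = cis2 (- ((x - x0) \<bullet> y)) * gauss pi ((1/T) *\<^sub>R (y - 0))"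
            by (simp add: \<psi>_def)
        qed
        also have "\<dots> = of_real (T ^ DIM('a)) * gauss pi (T *\<^sub>R (x - x0))"
          using T fourier_affine[of "gauss pi" "1/T" "0::'a" "x - x0"] schwartzD(5)[OF gauss_schwartz[OF pi_gt_zero, where 'a='a]]
          by (simp add: fourier_gauss_pi scaleR_conv_of_real power_divide)
        finally show ?thesis .
      qed
      have pointwise: "norm (b y * \<psi> y) \<le> B * D * weight ((1/T) *\<^sub>R (y - 0))" if "y \<in> S" for y
        using mult_mono[OF B(2)[OF that] D(2)[of "(1/T) *\<^sub>R (y - 0)"]] B(1) by (simp add: \<psi>_def norm_mult)
      have "T ^ DIM('a) * norm (\<Sum>\<^sub>\<infinity>x\<in>\<Lambda>. a x * gauss pi (T *\<^sub>R (x - x0)))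
         = norm (of_real (T ^ DIM('a)) * (\<Sum>\<^sub>\<infinity>x\<in>\<Lambda>. a x * gauss pi (T *\<^sub>R (x - x0))))"
        using T by (simp add: norm_mult norm_power)
      also have "of_real (T ^ DIM('a)) * (\<Sum>\<^sub>\<infinity>x\<in>\<Lambda>. a x * gauss pi (T *\<^sub>R (x - x0))) = (\<Sum>\<^sub>\<infinity>x\<in>\<Lambda>. a x * fourier \<psi> x)"
        unfolding F by (subst infsum_cmult_right'[symmetric]) (simp add: mult_ac)
      also have "\<dots> = (\<Sum>\<^sub>\<infinity>y\<in>S. b y * \<psi> y)" by (rule poisson[OF \<psi>, symmetric])
      also have "norm \<dots> \<le> (\<Sum>\<^sub>\<infinity>y\<in>S. norm (b y * \<psi> y))"
        by (rule norm_infsum_bound[OF T\<^sub>\<nu>_schwartz(1)[OF \<psi>]])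
      also have "\<dots> \<le> (\<Sum>\<^sub>\<infinity>y\<in>S. B * D * weight ((1/T) *\<^sub>R (y - 0)))"
        by (intro infsum_mono T\<^sub>\<nu>_schwartz(1)[OF \<psi>] summable_on_cmult_right wud_summable_weight[OF wud T] pointwise)
      also have "\<dots> = B * D * (\<Sum>\<^sub>\<infinity>y\<in>S. weight ((1/T) *\<^sub>R (y - 0)))" by (rule infsum_cmult_right')
      also have "\<dots> \<le> B * D * (C * T ^ DIM('a))"
        by (intro mult_left_mono infsum_le_finite_sums wud_summable_weight[OF wud T] C(2)[OF T])
          (use B(1) D(1) in auto)
      finally have "T ^ DIM('a) * norm (\<Sum>\<^sub>\<infinity>x\<in>\<Lambda>. a x * gauss pi (T *\<^sub>R (x - x0))) \<le> T ^ DIM('a) * (B * D * C)"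
        by (simp add: mult_ac)
      then show ?thesis using T by simp
    qed
    define f where "f n x = a x * gauss pi (real (Suc n) *\<^sub>R (x - x0))" for n x
    have "(\<lambda>n. infsum (f n) \<Lambda>) \<longlonglongrightarrow> infsum (\<lambda>x. if x = x0 then a x0 else 0) \<Lambda>"
    proof (rule infsum_dominated_tendsto)
      \<comment> \<open>The undilated Gaussian majorises the whole sequence, and it is a Schwartz
        function, which gives the summability.\<close>
      have "(\<lambda>x. gauss pi (1 *\<^sub>R x + (- x0))) \<in> schwartz" by (intro schwartz_affine gauss_schwartz) auto
      then show "(\<lambda>x. norm (a x * gauss pi (1 *\<^sub>R x + (- x0)))) summable_on \<Lambda>" by (rule T\<^sub>\<mu>_schwartz(1))
      fix x assume x: "x \<in> \<Lambda>"
      have g: "gauss pi (real (Suc n) *\<^sub>R u) = of_real (exp (- (pi * (u \<bullet> u)) * (real (Suc n))\<^sup>2))" for n and u :: 'a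
        by (simp add: gauss_def power2_eq_square mult_ac)
      show "norm (f n x) \<le> norm (a x * gauss pi (1 *\<^sub>R x + (- x0)))" for n
      proof -
        have "(x - x0) \<bullet> (x - x0) * 1 \<le> (x - x0) \<bullet> (x - x0) * (real (Suc n))\<^sup>2"
          by (intro mult_left_mono one_le_power) auto
        then have "norm (gauss pi (real (Suc n) *\<^sub>R (x - x0))) \<le> norm (gauss pi (x - x0))"
          unfolding g by (simp add: gauss_def mult.assoc)
        then show ?thesis unfolding f_def norm_mult by (simp add: mult_left_mono)
      qed
      show "(\<lambda>n. f n x) \<longlonglongrightarrow> (if x = x0 then a x0 else 0)"
      proof (cases "x = x0")
        case True
        then show ?thesis by (simp add: f_def gauss_def)
      next
        case False
        define q where "q = exp (- (pi * ((x - x0) \<bullet> (x - x0))))"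
        have q: "0 < q" "q < 1" using False by (auto simp: q_def)
        have "norm (f n x) \<le> norm (a x) * q ^ Suc n" for n
        proof -
          have "norm (gauss pi (real (Suc n) *\<^sub>R (x - x0))) = q ^ (Suc n)\<^sup>2"
            unfolding g q_def by (simp add: exp_of_nat_mult[symmetric] mult.commute flip: of_nat_Suc)
          also have "\<dots> \<le> q ^ Suc n"
            using q by (intro power_decreasing) (auto simp: power2_eq_square)
          finally show ?thesis by (simp add: f_def norm_mult mult_left_mono del: power_Suc)
        qed
        moreover have "(\<lambda>n. norm (a x) * q ^ Suc n) \<longlonglongrightarrow> 0"
          using q by (intro tendsto_mult_right_zero LIMSEQ_Suc LIMSEQ_realpow_zero) auto
        ultimately have "(\<lambda>n. f n x) \<longlonglongrightarrow> 0"
          by (intro Lim_null_comparison[of "\<lambda>n. f n x" "\<lambda>n. norm (a x) * q ^ Suc n"]) (auto intro!: always_eventually)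
        then show ?thesis using False by simp
      qed
    qed
    then have "(\<lambda>n. infsum (f n) \<Lambda>) \<longlonglongrightarrow> a x0"
      by (simp add: infsum_only[OF x0, of "\<lambda>x. if x = x0 then a x0 else 0"])
    moreover have "norm (infsum (f n) \<Lambda>) \<le> B * D * C" for n
      using bound[of "real (Suc n)"] by (simp add: f_def[abs_def] del: of_nat_Suc)
    ultimately show ?thesis
      by (intro Lim_norm_ubound[of sequentially "\<lambda>n. infsum (f n) \<Lambda>"]) (auto intro!: always_eventually)
  qed
  moreover have "B * D * C \<ge> 0" using B(1) D(1) C(1) by simp
  ultimately show ?thesis by blast
qed

end


section \<open>From Schwartz functions to $C_c * C_c$\<close>

lemma Cc_add: "f \<in> Cc \<Longrightarrow> g \<in> Cc \<Longrightarrow> (\<lambda>x. f x + g x) \<in> (Cc :: ('a::euclidean_space \<Rightarrow> complex) set)"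
proof -
  assume f: "f \<in> Cc" and g: "g \<in> Cc"
  obtain r where r: "r > 0" "\<And>x. norm x > r \<Longrightarrow> f x = 0" using CcD(3)[OF f] by blast
  obtain s where s: "s > 0" "\<And>x. norm x > s \<Longrightarrow> g x = 0" using CcD(3)[OF g] by blast
  show ?thesis
    by (rule CcI(1)[of _ "r + s"]) (use r s CcD(1)[OF f] CcD(1)[OF g] in \<open>auto intro!: continuous_intros\<close>)
qed

lemma Cc_mult:
  fixes f :: "'a::euclidean_space \<Rightarrow> complex"
  assumes "f \<in> Cc" "continuous_on UNIV h" shows "(\<lambda>x. h x * f x) \<in> Cc"
proof -
  obtain r where r: "r > 0" "\<And>x. norm x > r \<Longrightarrow> f x = 0" using CcD(3)[OF assms(1)] by blast
  show ?thesis
    by (rule CcI(1)[of _ r]) (use r assms(2) CcD(1)[OF assms(1)] in \<open>auto intro!: continuous_intros\<close>)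
qed

lemma Cc_sum:
  fixes f :: "nat \<Rightarrow> 'a::euclidean_space \<Rightarrow> complex"
  assumes "\<And>i. i < n \<Longrightarrow> f i \<in> Cc" shows "(\<lambda>x. \<Sum>i<n. f i x) \<in> Cc"
  using assms
proof (induction n)
  case 0
  show ?case by (rule CcI(1)[of _ 0]) auto
next
  case (Suc n)
  then show ?case by (simp add: Cc_add)
qed

lemma Cc_reflect:
  fixes f :: "'a::euclidean_space \<Rightarrow> complex"
  assumes "f \<in> Cc" shows "(\<lambda>x. f (- x)) \<in> Cc"
proof -
  obtain r where r: "r > 0" "\<And>x. norm x > r \<Longrightarrow> f x = 0" using CcD(3)[OF assms] by blast
  have "continuous_on UNIV (\<lambda>x. f (- x))"
    by (rule continuous_on_compose2[OF CcD(1)[OF assms]]) (auto intro!: continuous_intros)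
  then show ?thesis by (rule CcI(1)[of _ r]) (simp add: r)
qed

text \<open>The dual of \<open>window_energy_upper\<close>: the sum of squares is the pairing of
  \<open>f\<close> with a trigonometric sum whose coefficients are the conjugated values of the
  transform, and the energy of that sum on the support of \<open>f\<close> is controlled by the sum
  of squares itself.\<close>

lemma fourier_Cc_bessel:
  fixes S :: "'a::euclidean_space set"
  assumes S: "weakly_uniformly_discrete S" and f: "f \<in> Cc"
  shows "(\<lambda>y. (norm (fourier f y))\<^sup>2) summable_on S"
proof -
  note [measurable] = CcD(2)[OF f]
  obtain r where r: "r > 0" "\<And>x. norm x > r \<Longrightarrow> f x = 0" using CcD(3)[OF f] by blast
  obtain B where B: "B > 0" "\<And>x. norm (f x) \<le> B" using Cc_bounded[OF f] by blast
  \<comment> \<open>On the support of \<open>f\<close> the argument of the window has norm at most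
    1/2, so the window is at least \<open>w\<close> there.\<close>
  define R where "R = max 1 (2 * r)"
  have R: "R \<ge> 1" "R > 0" "2 * r \<le> R" by (auto simp: R_def)
  obtain C where C: "C > 0" "\<And>F c s. finite F \<Longrightarrow> F \<subseteq> S \<Longrightarrow> window_energy R s (trig_sum c F) \<le> C * (\<Sum>x\<in>F. (norm (c x))\<^sup>2)"
    using window_energy_upper[OF S R(1)] by blast
  obtain u :: 'a where u: "norm u = 1/2" by (meson vector_choose_size zero_le_divide_1_iff zero_le_numeral)
  define w where "w = bumpr u"
  have w: "w > 0" unfolding w_def using u by (intro bumpr_pos) simp
  have wR: "w \<le> bumpr ((1/R) *\<^sub>R (x - 0))" if "norm x \<le> r" for x :: 'a
  proof -
    have "norm x * 2 \<le> R" using that R by linarith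
    then have "norm ((1/R) *\<^sub>R (x - 0)) \<le> 1/2" using R by (simp add: field_simps)
    then show ?thesis unfolding w_def by (intro bumpr_antimono) (simp add: u)
  qed
  have fi: "integrable lborel (\<lambda>x. (norm (f x))\<^sup>2)"
  proof (rule Bochner_Integration.integrable_bound)
    show "integrable lborel (\<lambda>x. B * norm (f x))" using rapid_measD(3)[OF Cc_rapid_meas[OF f]] by auto
    show "AE x in lborel. norm ((norm (f x))\<^sup>2) \<le> norm (B * norm (f x))"
      using B by (intro AE_I2) (simp add: power2_eq_square mult_right_mono)
  qed measurable
  define N where "N = (\<integral>x. (norm (f x))\<^sup>2 \<partial>lborel)"
  have "(\<Sum>y\<in>F. (norm (fourier f y))\<^sup>2) \<le> (C / w) * N" if F: "finite F" "F \<subseteq> S" for F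
  proof -
    define c where "c y = cnj (fourier f y)" for y
    define Q where "Q = (\<Sum>y\<in>F. (norm (fourier f y))\<^sup>2)"
    have Q: "Q = (\<Sum>y\<in>F. (norm (c y))\<^sup>2)" "Q \<ge> 0" unfolding Q_def c_def by (auto intro: sum_nonneg)
    \<comment> \<open>The parameter in t s <= (L/2) s^2 + t^2 / (2 L), tuned so that exactly Q/2
      appears on the right and can be subtracted.\<close>
    define L where "L = C / w"
    have L: "L > 0" using C w by (simp add: L_def)
    have "complex_of_real Q = (\<Sum>y\<in>F. c y * fourier f y)"
      unfolding Q_def c_def of_real_sum complex_norm_square by (simp add: mult.commute)
    also have "\<dots> = (\<Sum>y\<in>F. \<integral>x. c y * (cis2 (- (y \<bullet> x)) * f x) \<partial>lborel)"
      unfolding fourier_cis2 by (simp only: integral_mult_right_zero)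
    also have "\<dots> = (\<integral>x. (\<Sum>y\<in>F. c y * (cis2 (- (y \<bullet> x)) * f x)) \<partial>lborel)"
      using cis2_integrable[OF rapid_measD(3)[OF Cc_rapid_meas[OF f]], of "- _"]
      by (intro Bochner_Integration.integral_sum[symmetric] integrable_mult_right) (simp only: inner_minus_left)
    also have "\<dots> = (\<integral>x. trig_sum c F x * f x \<partial>lborel)"
      by (simp add: trig_sum_def sum_distrib_left sum_distrib_right inner_commute mult_ac)
    finally have "Q = norm (\<integral>x. trig_sum c F x * f x \<partial>lborel)"
      using Q(2) by (metis abs_of_nonneg norm_of_real)
    also have "\<dots> \<le> (\<integral>x. (L / 2) * (norm (f x))\<^sup>2 + (1 / (2 * L * w)) * (bumpr ((1/R) *\<^sub>R (x - 0)) * (norm (trig_sum c F x))\<^sup>2) \<partial>lborel)"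
    proof (rule integral_norm_le)
      show "integrable lborel (\<lambda>x. (L / 2) * (norm (f x))\<^sup>2 + (1 / (2 * L * w)) * (bumpr ((1/R) *\<^sub>R (x - 0)) * (norm (trig_sum c F x))\<^sup>2))"
        by (intro Bochner_Integration.integrable_add integrable_mult_right fi window_integrable[OF R(2) trig_sum_measurable norm_trig_sum_le])
      show "norm (trig_sum c F x * f x) \<le> (L / 2) * (norm (f x))\<^sup>2 + (1 / (2 * L * w)) * (bumpr ((1/R) *\<^sub>R (x - 0)) * (norm (trig_sum c F x))\<^sup>2)" for x
      proof (cases "norm x \<le> r")
        case False
        then show ?thesis using r(2)[of x] L w by simp
      next
        case True
        define s t where "s = norm (f x)" and "t = norm (trig_sum c F x)"
        have "2 * (L * s) * t \<le> (L * s)\<^sup>2 + t\<^sup>2"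
          using zero_le_power2[of "L * s - t"] by (simp add: power2_diff)
        then have "t * s \<le> (L / 2) * s\<^sup>2 + (1 / (2 * L)) * t\<^sup>2"
          using L by (simp add: field_simps power2_eq_square)
        also have "(1 / (2 * L)) * t\<^sup>2 = (1 / (2 * L * w)) * (w * t\<^sup>2)" using w by simp
        also have "\<dots> \<le> (1 / (2 * L * w)) * (bumpr ((1/R) *\<^sub>R (x - 0)) * t\<^sup>2)"
          using L w wR[OF True] by (intro mult_left_mono mult_right_mono) auto
        finally show ?thesis by (simp add: s_def t_def norm_mult)
      qed
    qed
    also have "\<dots> = (L / 2) * N + (1 / (2 * L * w)) * window_energy R 0 (trig_sum c F)"
    proof -
      have "integrable lborel (\<lambda>x. (L / 2) * (norm (f x))\<^sup>2)" by (intro integrable_mult_right fi)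
      moreover have "integrable lborel (\<lambda>x. (1 / (2 * L * w)) * (bumpr ((1/R) *\<^sub>R (x - 0)) * (norm (trig_sum c F x))\<^sup>2))"
        by (intro integrable_mult_right window_integrable[OF R(2) trig_sum_measurable norm_trig_sum_le])
      ultimately show ?thesis
        unfolding N_def window_energy_def
        by (simp only: Bochner_Integration.integral_add integral_mult_right_zero)
    qed
    also have "\<dots> \<le> (L / 2) * N + (1 / (2 * L * w)) * (C * Q)"
      using L w C(2)[OF F, of 0 c] Q by (intro add_left_mono mult_left_mono) auto
    also have "(1 / (2 * L * w)) * (C * Q) = Q / 2" using C w by (simp add: L_def)
    finally show ?thesis by (simp add: L_def Q_def)
  qed
  then show ?thesis
    by (intro nonneg_bdd_above_summable_on bdd_aboveI2[where M = "(C / w) * N"]) auto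
qed

lemma inv_fourier_Cc_bessel:
  fixes S :: "'a::euclidean_space set"
  assumes S: "weakly_uniformly_discrete S" and f: "f \<in> Cc"
  shows "(\<lambda>y. (norm (inv_fourier f y))\<^sup>2) summable_on S"
proof -
  have "inv_fourier f y = fourier (\<lambda>x. f (- x)) y" for y
    using inv_fourier_reflect[of "\<lambda>x. f (- x)" y] CcD(2)[OF Cc_reflect[OF f]] by simp
  then show ?thesis using fourier_Cc_bessel[OF S Cc_reflect[OF f]] by simp
qed

lemma summable_on_sum_lessThan:
  fixes f :: "nat \<Rightarrow> 'a \<Rightarrow> real"
  shows "(\<And>i. i < n \<Longrightarrow> f i summable_on A) \<Longrightarrow> (\<lambda>x. \<Sum>i<n. f i x) summable_on A"
  by (induction n) (auto intro: summable_on_add)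

lemma inv_fourier_convolve:
  assumes "f \<in> Cc" "g \<in> Cc"
  shows "inv_fourier (convolve f g) k = inv_fourier f k * inv_fourier g k"
  unfolding inv_fourier_def by (intro fourier_convolve rapid_measD Cc_rapid_meas assms)

text \<open>The transform of a convolution is a product of two square-summable families, hence
  absolutely summable. A single function in \<open>Cc\<close> would yield only square summability by
  \<open>fourier_Cc_bessel\<close>.\<close>

lemma K2D:
  fixes S :: "'a::euclidean_space set"
  assumes S: "weakly_uniformly_discrete S" and g: "g \<in> K2"
  shows "g \<in> Cc" "(\<lambda>y. norm (inv_fourier g y)) summable_on S"
proof -
  obtain n :: nat and c u v where geq: "g = (\<lambda>x. \<Sum>i<n. c i * convolve (u i) (v i) x)"
    and uv: "\<And>i. i < n \<Longrightarrow> u i \<in> Cc \<and> v i \<in> Cc"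
    using g unfolding K2_def by blast
  show gC: "g \<in> Cc" unfolding geq using uv by (intro Cc_sum Cc_mult convolve_Cc) auto
  have eq: "inv_fourier g y = (\<Sum>i<n. c i * (inv_fourier (u i) y * inv_fourier (v i) y))" for y
  proof -
    have "integrable lborel (\<lambda>x. cis2 (y \<bullet> x) * (c i * convolve (u i) (v i) x))" if "i < n" for i
      using uv[OF that] by (intro cis2_integrable rapid_measD(3) Cc_rapid_meas Cc_mult convolve_Cc) auto
    then have "inv_fourier g y = (\<Sum>i<n. \<integral>x. cis2 (y \<bullet> x) * (c i * convolve (u i) (v i) x) \<partial>lborel)"
      unfolding geq inv_fourier_cis2 sum_distrib_left by (intro Bochner_Integration.integral_sum) auto
    also have "\<dots> = (\<Sum>i<n. c i * inv_fourier (convolve (u i) (v i)) y)"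
      unfolding inv_fourier_cis2 by (simp add: mult.left_commute[of "cis2 _"])
    finally show ?thesis using uv by (simp add: inv_fourier_convolve)
  qed
  have "(\<lambda>y. \<Sum>i<n. norm (c i) * ((norm (inv_fourier (u i) y))\<^sup>2 + (norm (inv_fourier (v i) y))\<^sup>2)) summable_on S"
    by (rule summable_on_sum_lessThan, rule summable_on_cmult_right, rule summable_on_add;
        rule inv_fourier_Cc_bessel[OF S]; use uv in blast)
  then show "(\<lambda>y. norm (inv_fourier g y)) summable_on S"
  proof (rule Infinite_Sum.abs_summable_on_comparison_test')
    fix y
    have "norm (inv_fourier g y) \<le> (\<Sum>i<n. norm (c i) * (norm (inv_fourier (u i) y) * norm (inv_fourier (v i) y)))"
      unfolding eq by (rule order_trans[OF norm_sum]) (simp add: norm_mult)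
    also have "\<dots> \<le> (\<Sum>i<n. norm (c i) * ((norm (inv_fourier (u i) y))\<^sup>2 + (norm (inv_fourier (v i) y))\<^sup>2))"
    proof (intro sum_mono mult_left_mono)
      fix i
      show "norm (inv_fourier (u i) y) * norm (inv_fourier (v i) y) \<le> (norm (inv_fourier (u i) y))\<^sup>2 + (norm (inv_fourier (v i) y))\<^sup>2"
      proof -
        have "2 * (s * t) \<le> s\<^sup>2 + t\<^sup>2" for s t :: real
          using zero_le_power2[of "s - t"] by (simp add: power2_diff)
        from this[of "norm (inv_fourier (u i) y)" "norm (inv_fourier (v i) y)"]
          mult_nonneg_nonneg[OF norm_ge_zero[of "inv_fourier (u i) y"] norm_ge_zero[of "inv_fourier (v i) y"]]
        show ?thesis by linarith
      qed
    qed auto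
    finally show "norm (inv_fourier g y) \<le> (\<Sum>i<n. norm (c i) * ((norm (inv_fourier (u i) y))\<^sup>2 + (norm (inv_fourier (v i) y))\<^sup>2))" .
  qed
qed

section \<open>Gaussian mollification\<close>

lemma fourier_gauss:
  assumes c: "c > 0"
  shows "fourier (gauss (pi * c\<^sup>2)) x = (1 / c ^ DIM('a)) *\<^sub>R gauss (pi * (1 / c)\<^sup>2) (x :: 'a::euclidean_space)"
proof -
  have g: "gauss (pi * c\<^sup>2) = (\<lambda>y::'a. gauss pi (c *\<^sub>R (y - 0)))" for c
    by (simp add: fun_eq_iff gauss_def power2_eq_square mult_ac)
  have "fourier (gauss (pi * c\<^sup>2)) x = (1 / c ^ DIM('a)) *\<^sub>R (cis2 (- (x \<bullet> 0)) * fourier (gauss pi) (x /\<^sub>R c))"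
    unfolding g by (rule fourier_affine[OF schwartzD(5)[OF gauss_schwartz[OF pi_gt_zero]] c])
  also have "\<dots> = (1 / c ^ DIM('a)) *\<^sub>R gauss (pi * (1 / c)\<^sup>2) x"
  proof -
    have "gauss (pi * (1 / c)\<^sup>2) x = gauss pi (x /\<^sub>R c)"
      unfolding g[of "1/c"] by (simp add: divide_inverse)
    then show ?thesis by (simp add: fourier_gauss_pi)
  qed
  finally show ?thesis .
qed

text \<open>Fourier inversion for Gaussians, by using the explicit formula twice; evenness hides the
  reflection.\<close>

lemma fourier_fourier_gauss:
  assumes c: "c > 0"
  shows "fourier (fourier (gauss (pi * c\<^sup>2))) = (gauss (pi * c\<^sup>2) :: 'a::euclidean_space \<Rightarrow> complex)"
proof
  fix x :: 'a
  let ?m = "complex_of_real (1 / c ^ DIM('a))"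
  have "fourier (fourier (gauss (pi * c\<^sup>2))) x = (\<integral>y. ?m * (cis2 (- (x \<bullet> y)) * gauss (pi * (1 / c)\<^sup>2) y) \<partial>lborel)"
    unfolding fourier_cis2[of "fourier (gauss (pi * c\<^sup>2))"] fourier_gauss[OF c]
    by (simp add: scaleR_conv_of_real mult_ac)
  also have "\<dots> = ?m * fourier (gauss (pi * (1 / c)\<^sup>2)) x"
    unfolding fourier_cis2[of "gauss (pi * (1 / c)\<^sup>2)"] by (rule integral_mult_right_zero)
  also have "\<dots> = ?m * ((1 / (1 / c) ^ DIM('a)) *\<^sub>R gauss (pi * (1 / (1 / c))\<^sup>2) x)"
    using c by (subst fourier_gauss) auto
  also have "\<dots> = gauss (pi * c\<^sup>2) x" using c by (simp add: power_divide scaleR_conv_of_real flip: of_real_power)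
  finally show "fourier (fourier (gauss (pi * c\<^sup>2))) x = gauss (pi * c\<^sup>2) x" .
qed

text \<open>Rescaled to an average of g (x - \<epsilon> u) against a fixed Gaussian in
  \<open>u\<close>, the mollification converges by continuity of \<open>g\<close>. The bound is
  uniform in \<epsilon>, as dominated convergence over a discrete set requires.\<close>

lemma gauss_mollify:
  fixes g :: "'a::euclidean_space \<Rightarrow> complex"
  assumes g: "g \<in> Cc"
  shows "\<exists>C\<ge>0. \<forall>\<epsilon>\<in>{0<..1}. \<forall>x. norm (convolve g (fourier (gauss (pi * \<epsilon>\<^sup>2))) x) \<le> C * weight x"
    and "(\<lambda>n. convolve g (fourier (gauss (pi * (1 / real (Suc n))\<^sup>2))) x) \<longlonglongrightarrow> g x"
proof -
  note [measurable] = CcD(2)[OF g]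
  have [measurable]: "(gauss pi :: 'a \<Rightarrow> complex) \<in> borel_measurable borel" by (rule schwartzD) auto
  have eq: "convolve g (fourier (gauss (pi * \<epsilon>\<^sup>2))) x = (\<integral>u. g (x - \<epsilon> *\<^sub>R u) * gauss pi u \<partial>lborel)" if \<epsilon>: "\<epsilon> > 0" for \<epsilon> x
  proof -
    have "convolve g (fourier (gauss (pi * \<epsilon>\<^sup>2))) x = (\<integral>y. g y * ((1 / \<epsilon> ^ DIM('a)) *\<^sub>R gauss pi ((1/\<epsilon>) *\<^sub>R (x - y))) \<partial>lborel)"
      unfolding convolve_def fourier_gauss[OF \<epsilon>] by (simp add: gauss_def power2_eq_square mult_ac divide_inverse)
    also have "\<dots> = \<bar>- \<epsilon>\<bar> ^ DIM('a) *\<^sub>R (\<integral>u. g (x + (- \<epsilon>) *\<^sub>R u) * ((1 / \<epsilon> ^ DIM('a)) *\<^sub>R gauss pi ((1/\<epsilon>) *\<^sub>R (x - (x + (- \<epsilon>) *\<^sub>R u)))) \<partial>lborel)"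
      using \<epsilon> by (intro lborel_integral_affine[where c = "- \<epsilon>" and t = x]) auto
    also have "\<dots> = \<epsilon> ^ DIM('a) *\<^sub>R (\<integral>u. (1 / \<epsilon> ^ DIM('a)) *\<^sub>R (g (x - \<epsilon> *\<^sub>R u) * gauss pi u) \<partial>lborel)"
      using \<epsilon> by simp
    also have "\<dots> = (\<integral>u. g (x - \<epsilon> *\<^sub>R u) * gauss pi u \<partial>lborel)"
      using \<epsilon> by (simp only: integral_scaleR_right scaleR_scaleR) simp
    finally show ?thesis .
  qed
  obtain D where D: "D \<ge> 0" "\<And>x. norm (g x) \<le> D * weight x"
    using rapid_weight[OF Cc_rapid[OF g], of 0] by auto
  define I where "I = (\<integral>u. (1 + norm u) ^ (2 * DIM('a)) * norm (gauss pi u) \<partial>(lborel :: 'a measure))"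
  have gi: "integrable lborel (\<lambda>u::'a. (1 + norm u) ^ k * norm (gauss pi u))" for k
    by (intro rapid_measD schwartz_rapid_meas gauss_schwartz) auto
  have I: "I \<ge> 0" unfolding I_def by (intro Bochner_Integration.integral_nonneg) auto
  have "norm (convolve g (fourier (gauss (pi * \<epsilon>\<^sup>2))) x) \<le> (D * 2 ^ DIM('a) * I) * weight x" if \<epsilon>: "0 < \<epsilon>" "\<epsilon> \<le> 1" for \<epsilon> x
  proof -
    have "norm (\<integral>u. g (x - \<epsilon> *\<^sub>R u) * gauss pi u \<partial>lborel) \<le> (\<integral>u. (D * 2 ^ DIM('a) * weight x) * ((1 + norm u) ^ (2 * DIM('a)) * norm (gauss pi u)) \<partial>(lborel :: 'a measure))"
    proof (rule integral_norm_le)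
      show "integrable lborel (\<lambda>u::'a. (D * 2 ^ DIM('a) * weight x) * ((1 + norm u) ^ (2 * DIM('a)) * norm (gauss pi u)))"
        by (intro integrable_mult_right gi)
      show "norm (g (x - \<epsilon> *\<^sub>R u) * gauss pi u) \<le> (D * 2 ^ DIM('a) * weight x) * ((1 + norm u) ^ (2 * DIM('a)) * norm (gauss pi u))" for u
      proof -
        \<comment> \<open>For \<epsilon> <= 1 the shift \<epsilon> u is no larger than
          \<open>u\<close>, so Peetre's inequality yields a bound free of \<epsilon>.\<close>
        have "weight u \<le> weight (\<epsilon> *\<^sub>R u)"
          using weight_scale[of "1 / \<epsilon>" "\<epsilon> *\<^sub>R u"] \<epsilon> by simp
        then have "weight (x - \<epsilon> *\<^sub>R u) * weight u \<le> weight (x - \<epsilon> *\<^sub>R u) * weight (\<epsilon> *\<^sub>R u)" by (intro mult_left_mono) auto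
        also have "\<dots> \<le> 2 ^ DIM('a) * weight x"
          using weight_peetre[of x "- (\<epsilon> *\<^sub>R u)"] by simp
        finally have 1: "weight (x - \<epsilon> *\<^sub>R u) * weight u \<le> 2 ^ DIM('a) * weight x" .
        have "weight (x - \<epsilon> *\<^sub>R u) * 1 \<le> weight (x - \<epsilon> *\<^sub>R u) * ((1 + norm u) ^ (2 * DIM('a)) * weight u)"
          by (intro mult_left_mono weight_lower) auto
        also have "\<dots> = (1 + norm u) ^ (2 * DIM('a)) * (weight (x - \<epsilon> *\<^sub>R u) * weight u)" by simp
        also have "\<dots> \<le> (1 + norm u) ^ (2 * DIM('a)) * (2 ^ DIM('a) * weight x)"
          by (intro mult_left_mono 1) auto
        finally have "norm (g (x - \<epsilon> *\<^sub>R u)) \<le> D * ((1 + norm u) ^ (2 * DIM('a)) * (2 ^ DIM('a) * weight x))"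
          using D(2)[of "x - \<epsilon> *\<^sub>R u"] D(1) by (smt (verit) mult_left_mono mult.right_neutral)
        then have "norm (g (x - \<epsilon> *\<^sub>R u)) * norm (gauss pi u) \<le> D * ((1 + norm u) ^ (2 * DIM('a)) * (2 ^ DIM('a) * weight x)) * norm (gauss pi u)"
          by (rule mult_right_mono) auto
        then show ?thesis by (simp add: norm_mult mult_ac)
      qed
    qed
    also have "\<dots> = (D * 2 ^ DIM('a) * I) * weight x" by (simp add: I_def)
    finally show ?thesis using eq[OF \<epsilon>(1)] by simp
  qed
  moreover have "D * 2 ^ DIM('a) * I \<ge> 0" using D(1) I by simp
  ultimately show "\<exists>C\<ge>0. \<forall>\<epsilon>\<in>{0<..1}. \<forall>x. norm (convolve g (fourier (gauss (pi * \<epsilon>\<^sup>2))) x) \<le> C * weight x"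
    by (intro exI[of _ "D * 2 ^ DIM('a) * I"]) auto
  have lim: "(\<lambda>n. \<integral>u. g (x - (1 / real (Suc n)) *\<^sub>R u) * gauss pi u \<partial>lborel) \<longlonglongrightarrow> (\<integral>u. g x * gauss pi u \<partial>(lborel :: 'a measure))"
  proof (rule integral_dominated_convergence[where w = "\<lambda>u. D * norm (gauss pi u)"])
    show "integrable lborel (\<lambda>u::'a. D * norm (gauss pi u))" using gi[of 0] by (intro integrable_mult_right) simp
    show "AE u in lborel. (\<lambda>n. g (x - (1 / real (Suc n)) *\<^sub>R u) * gauss pi u) \<longlonglongrightarrow> g x * gauss pi u"
    proof (rule AE_I2)
      fix u :: 'a
      have "(\<lambda>n. x - (1 / real (Suc n)) *\<^sub>R u) \<longlonglongrightarrow> x - 0 *\<^sub>R u"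
        unfolding inverse_eq_divide[symmetric] by (intro tendsto_intros LIMSEQ_inverse_real_of_nat)
      then have "(\<lambda>n. g (x - (1 / real (Suc n)) *\<^sub>R u)) \<longlonglongrightarrow> g x"
        by (intro continuous_on_tendsto_compose[OF CcD(1)[OF g]]) auto
      then show "(\<lambda>n. g (x - (1 / real (Suc n)) *\<^sub>R u) * gauss pi u) \<longlonglongrightarrow> g x * gauss pi u"
        by (intro tendsto_intros)
    qed
    show "AE u in lborel. norm (g (x - (1 / real (Suc n)) *\<^sub>R u) * gauss pi u) \<le> D * norm (gauss pi u)" for n
    proof (rule AE_I2)
      fix u :: 'a
      have "norm (g z) \<le> D" for z using D(2)[of z] mult_left_mono[OF weight_le_1[of z] D(1)] by simp
      then show "norm (g (x - (1 / real (Suc n)) *\<^sub>R u) * gauss pi u) \<le> D * norm (gauss pi u)"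
        unfolding norm_mult by (intro mult_right_mono) auto
    qed
  qed measurable
  have val: "(\<integral>u. g x * gauss pi u \<partial>(lborel :: 'a measure)) = g x"
  proof -
    have "(\<integral>u. gauss pi u \<partial>(lborel :: 'a measure)) = fourier (gauss pi) (0 :: 'a)" by (simp add: fourier_cis2)
    then show ?thesis by (simp add: fourier_gauss_pi gauss_def)
  qed
  have "convolve g (fourier (gauss (pi * (1 / real (Suc n))\<^sup>2))) x
      = (\<integral>u. g (x - (1 / real (Suc n)) *\<^sub>R u) * gauss pi u \<partial>lborel)" for n
    by (rule eq) simp
  then show "(\<lambda>n. convolve g (fourier (gauss (pi * (1 / real (Suc n))\<^sup>2))) x) \<longlonglongrightarrow> g x"
    using lim unfolding val by (simp only:)
qed

text \<open>The limit passage shared by the transforms of \<mu> and \<nu>. The left sums are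
  dominated by a multiple of \<open>weight\<close>, the right ones by the summable values of
  \<open>inv_fourier g\<close>.\<close>

lemma transform_identity:
  fixes A B :: "'a::euclidean_space set"
  assumes A: "weakly_uniformly_discrete A"
    and p: "\<And>x. x \<in> A \<Longrightarrow> norm (p x) \<le> M" and q: "\<And>y. y \<in> B \<Longrightarrow> norm (q y) \<le> M"
    and g: "g \<in> Cc" "(\<lambda>y. norm (inv_fourier g y)) summable_on B"
    and eq: "\<And>\<epsilon>. \<epsilon> > 0 \<Longrightarrow> (\<Sum>\<^sub>\<infinity>x\<in>A. p x * convolve g (fourier (gauss (pi * \<epsilon>\<^sup>2))) x)
      = (\<Sum>\<^sub>\<infinity>y\<in>B. q y * (inv_fourier g y * gauss (pi * \<epsilon>\<^sup>2) y))"
  shows "(\<Sum>\<^sub>\<infinity>x\<in>A. p x * g x) = (\<Sum>\<^sub>\<infinity>y\<in>B. q y * inv_fourier g y)"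
proof -
  define \<epsilon> where "\<epsilon> n = 1 / real (Suc n)" for n
  have \<epsilon>: "\<epsilon> n > 0" "\<epsilon> n \<le> 1" for n by (auto simp: \<epsilon>_def)
  obtain C where C: "C \<ge> 0" "\<And>\<epsilon> x. 0 < \<epsilon> \<Longrightarrow> \<epsilon> \<le> 1 \<Longrightarrow> norm (convolve g (fourier (gauss (pi * \<epsilon>\<^sup>2))) x) \<le> C * weight x"
    using gauss_mollify(1)[OF g(1)] by auto
  have "(\<lambda>n. \<Sum>\<^sub>\<infinity>x\<in>A. p x * convolve g (fourier (gauss (pi * (\<epsilon> n)\<^sup>2))) x) \<longlonglongrightarrow> (\<Sum>\<^sub>\<infinity>x\<in>A. p x * g x)"
  proof (rule infsum_dominated_tendsto)
    show "(\<lambda>x. \<bar>M\<bar> * (C * weight x)) summable_on A"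
      using wud_summable_weight[OF A, of 1 0] by (intro summable_on_cmult_right) auto
    show "norm (p x * convolve g (fourier (gauss (pi * (\<epsilon> n)\<^sup>2))) x) \<le> \<bar>M\<bar> * (C * weight x)" if "x \<in> A" for n x
      unfolding norm_mult using p[OF that] C(2)[OF \<epsilon>, of n x] by (intro mult_mono) auto
    show "(\<lambda>n. p x * convolve g (fourier (gauss (pi * (\<epsilon> n)\<^sup>2))) x) \<longlonglongrightarrow> p x * g x" for x
      unfolding \<epsilon>_def by (intro tendsto_intros gauss_mollify(2) g)
  qed
  moreover have "(\<lambda>n. \<Sum>\<^sub>\<infinity>y\<in>B. q y * (inv_fourier g y * gauss (pi * (\<epsilon> n)\<^sup>2) y)) \<longlonglongrightarrow> (\<Sum>\<^sub>\<infinity>y\<in>B. q y * inv_fourier g y)"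
  proof (rule infsum_dominated_tendsto)
    show "(\<lambda>y. \<bar>M\<bar> * norm (inv_fourier g y)) summable_on B" by (intro summable_on_cmult_right g)
    show "norm (q y * (inv_fourier g y * gauss (pi * (\<epsilon> n)\<^sup>2) y)) \<le> \<bar>M\<bar> * norm (inv_fourier g y)" if "y \<in> B" for n y
    proof -
      have "norm (inv_fourier g y * gauss (pi * (\<epsilon> n)\<^sup>2) y) \<le> norm (inv_fourier g y)"
        unfolding norm_mult by (intro mult_left_le) (auto simp: gauss_def)
      then show ?thesis unfolding norm_mult[of "q y"] using q[OF that] by (intro mult_mono) auto
    qed
    have "(\<lambda>n. gauss (pi * (\<epsilon> n)\<^sup>2) y) \<longlonglongrightarrow> complex_of_real (exp (- (pi * 0\<^sup>2) * (y \<bullet> y)))" for y :: 'a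
      unfolding gauss_def \<epsilon>_def inverse_eq_divide[symmetric] by (intro tendsto_intros LIMSEQ_inverse_real_of_nat)
    then have "(\<lambda>n. q y * (inv_fourier g y * gauss (pi * (\<epsilon> n)\<^sup>2) y)) \<longlonglongrightarrow> q y * (inv_fourier g y * 1)" for y
      by (intro tendsto_intros) simp
    then show "(\<lambda>n. q y * (inv_fourier g y * gauss (pi * (\<epsilon> n)\<^sup>2) y)) \<longlonglongrightarrow> q y * inv_fourier g y" for y by simp
  qed
  ultimately show ?thesis using LIMSEQ_unique by (simp add: eq \<epsilon>)
qed

context fourier_pair
begin

lemma mollified_schwartz:
  fixes g :: "'a \<Rightarrow> complex"
  assumes g: "g \<in> Cc" and \<epsilon>: "\<epsilon> > 0"
  shows "(\<lambda>y. inv_fourier g y * gauss (pi * \<epsilon>\<^sup>2) y) \<in> schwartz"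
    and "convolve g (fourier (gauss (pi * \<epsilon>\<^sup>2))) = fourier (\<lambda>y. inv_fourier g y * gauss (pi * \<epsilon>\<^sup>2) y)"
proof -
  have gs: "(gauss (pi * \<epsilon>\<^sup>2) :: 'a \<Rightarrow> complex) \<in> schwartz" using \<epsilon> by (intro gauss_schwartz) simp
  show "(\<lambda>y. inv_fourier g y * gauss (pi * \<epsilon>\<^sup>2) y) \<in> schwartz"
    by (intro slow_mult_schwartz inv_fourier_slow Cc_rapid_meas g gs)
  show "convolve g (fourier (gauss (pi * \<epsilon>\<^sup>2))) = fourier (\<lambda>y. inv_fourier g y * gauss (pi * \<epsilon>\<^sup>2) y)"
    by (intro ext fourier_mult_inv_fourier[symmetric] rapid_measD(3)[OF Cc_rapid_meas[OF g]] rapid_measD(3)[OF schwartz_rapid_meas[OF gs]])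
qed

lemma a_identity:
  assumes g: "g \<in> K2"
  shows "(\<Sum>\<^sub>\<infinity>x\<in>\<Lambda>. a x * g x) = (\<Sum>\<^sub>\<infinity>y\<in>S. b y * inv_fourier g y)"
proof -
  obtain M1 where M1: "M1 \<ge> 0" "\<And>x. x \<in> \<Lambda> \<Longrightarrow> norm (a x) \<le> M1" using a_bounded by blast
  obtain M2 where M2: "M2 \<ge> 0" "\<And>y. y \<in> S \<Longrightarrow> norm (b y) \<le> M2" using b_bounded by blast
  show ?thesis
  proof (rule transform_identity[OF wud\<^sub>\<Lambda>])
    \<comment> \<open>\<open>transform_identity\<close> takes one common bound for both families,
      and the sum of the two bounds serves.\<close>
    show "norm (a x) \<le> M1 + M2" if "x \<in> \<Lambda>" for x using M1(2)[OF that] M2(1) by linarith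
    show "norm (b y) \<le> M1 + M2" if "y \<in> S" for y using M2(2)[OF that] M1(1) by linarith
    fix \<epsilon> :: real assume \<epsilon>: "\<epsilon> > 0"
    show "(\<Sum>\<^sub>\<infinity>x\<in>\<Lambda>. a x * convolve g (fourier (gauss (pi * \<epsilon>\<^sup>2))) x)
      = (\<Sum>\<^sub>\<infinity>y\<in>S. b y * (inv_fourier g y * gauss (pi * \<epsilon>\<^sup>2) y))"
      using mollified_schwartz[OF K2D(1)[OF wud g] \<epsilon>] poisson by simp
  qed (use K2D[OF wud g] in auto)
qed

text \<open>Here \<open>poisson\<close> is applied to the mollified \<open>g\<close> itself. Its
  transform is evaluated on \<Lambda>, and a value of \<open>fourier\<close> at \<open>x\<close> is
  one of \<open>inv_fourier\<close> at \<open>- x\<close>, which is where the reflection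
  arises.\<close>

lemma b_identity:
  assumes g: "g \<in> K2"
  shows "(\<Sum>\<^sub>\<infinity>y\<in>S. b y * g y) = (\<Sum>\<^sub>\<infinity>x\<in>uminus ` \<Lambda>. a (- x) * inv_fourier g x)"
proof -
  obtain M1 where M1: "M1 \<ge> 0" "\<And>x. x \<in> \<Lambda> \<Longrightarrow> norm (a x) \<le> M1" using a_bounded by blast
  obtain M2 where M2: "M2 \<ge> 0" "\<And>y. y \<in> S \<Longrightarrow> norm (b y) \<le> M2" using b_bounded by blast
  have gC: "g \<in> Cc" by (rule K2D(1)[OF wud g])
  have re: "(\<Sum>\<^sub>\<infinity>x\<in>uminus ` \<Lambda>. h x) = (\<Sum>\<^sub>\<infinity>x\<in>\<Lambda>. h (- x))" for h :: "'a \<Rightarrow> complex"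
    by (subst infsum_reindex) (auto simp: inj_on_def o_def)
  show ?thesis
  proof (rule transform_identity[OF wud])
    show "norm (b y) \<le> M1 + M2" if "y \<in> S" for y using M2(2)[OF that] M1(1) by linarith
    show "norm (a (- x)) \<le> M1 + M2" if "x \<in> uminus ` \<Lambda>" for x
      using that M1(2)[of "- x"] M2(1) by auto
    show "g \<in> Cc" by (rule gC)
    have "(\<lambda>x. norm (inv_fourier g (- x))) summable_on \<Lambda>"
    proof -
      have "uniform_discrete (uminus ` \<Lambda>)"
        using ud unfolding uniform_discrete_def by (auto simp: dist_minus)
      from K2D(2)[OF uniform_discrete_imp_weakly[OF this] g] show ?thesis
        by (subst (asm) summable_on_reindex) (auto simp: inj_on_def o_def)
    qed
    then show "(\<lambda>y. norm (inv_fourier g y)) summable_on uminus ` \<Lambda>"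
      by (subst summable_on_reindex) (auto simp: inj_on_def o_def)
    fix \<epsilon> :: real assume \<epsilon>: "\<epsilon> > 0"
    have gs: "(gauss (pi * \<epsilon>\<^sup>2) :: 'a \<Rightarrow> complex) \<in> schwartz" using \<epsilon> by (intro gauss_schwartz) simp
    have s: "convolve g (fourier (gauss (pi * \<epsilon>\<^sup>2))) \<in> schwartz"
      unfolding mollified_schwartz(2)[OF gC \<epsilon>] by (intro fourier_schwartz mollified_schwartz(1) gC \<epsilon>)
    have "fourier (convolve g (fourier (gauss (pi * \<epsilon>\<^sup>2)))) x = fourier g x * gauss (pi * \<epsilon>\<^sup>2) x" for x
      using fourier_convolve[OF rapid_measD(3)[OF Cc_rapid_meas[OF gC]] rapid_measD(3)[OF schwartz_rapid_meas[OF fourier_schwartz[OF gs]]]]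
      by (simp add: fourier_fourier_gauss[OF \<epsilon>])
    then show "(\<Sum>\<^sub>\<infinity>y\<in>S. b y * convolve g (fourier (gauss (pi * \<epsilon>\<^sup>2))) y)
      = (\<Sum>\<^sub>\<infinity>x\<in>uminus ` \<Lambda>. a (- x) * (inv_fourier g x * gauss (pi * \<epsilon>\<^sup>2) x))"
      using poisson[OF s] by (simp add: re inv_fourier_def gauss_def)
  qed
qed

end


section \<open>Discrete measures and their variation\<close>

lemma wud_subset_closed:
  fixes A :: "'a::euclidean_space set"
  assumes "weakly_uniformly_discrete A" "B \<subseteq> A" shows "closed B"
  unfolding closed_limpt
proof (intro allI impI)
  fix x assume "x islimpt B"
  then have "infinite (B \<inter> cball x 1)" by (simp add: islimpt_eq_infinite_cball)
  moreover have "finite (B \<inter> cball x 1)"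
    by (rule finite_subset[OF _ wud_finite_cball(1)[OF assms(1), of x 1]]) (use assms(2) in auto)
  ultimately show "x \<in> B" by simp
qed

lemma point_sum_finite:
  fixes f :: "'a::euclidean_space \<Rightarrow> complex"
  assumes A: "weakly_uniformly_discrete A" and "\<And>x. norm x > r \<Longrightarrow> f x = 0"
  shows "(\<Sum>\<^sub>\<infinity>x\<in>A. p x * f x) = (\<Sum>x\<in>A \<inter> cball 0 r. p x * f x)"
  unfolding infsum_finite[OF wud_finite_cball(1)[OF A], symmetric]
  by (rule infsum_cong_neutral) (use assms(2) in auto)

lemma radon_measure_point_sum:
  fixes A :: "'a::euclidean_space set"
  assumes A: "weakly_uniformly_discrete A"
  shows "radon_measure (\<lambda>f. \<Sum>\<^sub>\<infinity>x\<in>A. p x * f x)"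
  unfolding radon_measure_def
proof (intro conjI ballI allI impI)
  fix f g :: "'a \<Rightarrow> complex" assume f: "f \<in> Cc" and g: "g \<in> Cc"
  obtain r where r: "r > 0" "\<And>x. norm x > r \<Longrightarrow> f x = 0" using CcD(3)[OF f] by blast
  obtain s where s: "s > 0" "\<And>x. norm x > s \<Longrightarrow> g x = 0" using CcD(3)[OF g] by blast
  have "f x = 0 \<and> g x = 0" if "norm x > r + s" for x using that r s by auto
  then show "(\<Sum>\<^sub>\<infinity>x\<in>A. p x * (f x + g x)) = (\<Sum>\<^sub>\<infinity>x\<in>A. p x * f x) + (\<Sum>\<^sub>\<infinity>x\<in>A. p x * g x)"
    using point_sum_finite[OF A, of "r + s" f p] point_sum_finite[OF A, of "r + s" g p]
      point_sum_finite[OF A, of "r + s" "\<lambda>x. f x + g x" p] by (simp add: distrib_left sum.distrib)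
next
  fix f :: "'a \<Rightarrow> complex" and c assume "f \<in> Cc"
  show "(\<Sum>\<^sub>\<infinity>x\<in>A. p x * (c * f x)) = c * (\<Sum>\<^sub>\<infinity>x\<in>A. p x * f x)"
    by (subst infsum_cmult_right'[symmetric]) (simp add: mult_ac)
next
  fix K :: "'a set" assume "compact K"
  then obtain r where r: "\<And>x. x \<in> K \<Longrightarrow> norm x \<le> r" by (meson bounded_iff compact_imp_bounded)
  show "\<exists>C. \<forall>f\<in>Cc. tsupport f \<subseteq> K \<longrightarrow> norm (\<Sum>\<^sub>\<infinity>x\<in>A. p x * f x) \<le> C * (SUP x. norm (f x))"
  proof (intro exI ballI impI)
    fix f :: "'a \<Rightarrow> complex" assume f: "f \<in> Cc" and K: "tsupport f \<subseteq> K"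
    have z: "f x = 0" if "norm x > r" for x
    proof (rule ccontr)
      assume "f x \<noteq> 0"
      then have "x \<in> tsupport f" unfolding tsupport_def by (simp add: closure_subset[THEN subsetD])
      with K r that show False by force
    qed
    obtain B where B: "\<And>x. norm (f x) \<le> B" using Cc_bounded[OF f] by blast
    have "norm (\<Sum>\<^sub>\<infinity>x\<in>A. p x * f x) = norm (\<Sum>x\<in>A \<inter> cball 0 r. p x * f x)"
      using point_sum_finite[OF A, of r f p] z by simp
    also have "\<dots> \<le> (\<Sum>x\<in>A \<inter> cball 0 r. norm (p x) * (SUP x. norm (f x)))"
    proof (rule order_trans[OF norm_sum sum_mono])
      fix x
      have "norm (f x) \<le> (SUP x. norm (f x))"
        by (rule cSUP_upper) (auto intro: bdd_aboveI2 B)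
      then show "norm (p x * f x) \<le> norm (p x) * (SUP x. norm (f x))"
        unfolding norm_mult by (intro mult_left_mono) auto
    qed
    finally show "norm (\<Sum>\<^sub>\<infinity>x\<in>A. p x * f x) \<le> (\<Sum>x\<in>A \<inter> cball 0 r. norm (p x)) * (SUP x. norm (f x))"
      by (simp add: sum_distrib_right)
  qed
qed

text \<open>The measure that puts mass |p x| on each point of \<open>A\<close>. Pushing forward
  along the identity only replaces the sigma-algebra of all subsets of \<open>A\<close> by the Borel
  sets.\<close>

definition weighted_points :: "'a::euclidean_space set \<Rightarrow> ('a \<Rightarrow> complex) \<Rightarrow> 'a measure" where
  "weighted_points A p = distr (density (count_space A) (\<lambda>x. ennreal (norm (p x)))) borel (\<lambda>x. x)"

lemma sets_weighted_points [simp, measurable_cong]: "sets (weighted_points A p) = sets borel"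
  and space_weighted_points [simp]: "space (weighted_points A p) = UNIV"
  by (simp_all add: weighted_points_def)

lemma nn_integral_weighted_points:
  assumes [measurable]: "h \<in> borel_measurable borel"
  shows "(\<integral>\<^sup>+x. h x \<partial>weighted_points A p) = (\<integral>\<^sup>+x. ennreal (norm (p x)) * h x \<partial>count_space A)"
  unfolding weighted_points_def by (simp add: nn_integral_distr nn_integral_density)

lemma emeasure_weighted_points:
  assumes "X \<in> sets borel"
  shows "emeasure (weighted_points A p) X = (\<integral>\<^sup>+x. ennreal (norm (p x)) * indicator X x \<partial>count_space A)"
  using nn_integral_weighted_points[of "indicator X" A p] assms by simp

lemma emeasure_weighted_points_finite:
  assumes "X \<in> sets borel" "finite (A \<inter> X)"
  shows "emeasure (weighted_points A p) X = ennreal (\<Sum>x\<in>A \<inter> X. norm (p x))"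
proof -
  have "emeasure (weighted_points A p) X = (\<Sum>x\<in>A \<inter> X. ennreal (norm (p x)) * indicator X x)"
    unfolding emeasure_weighted_points[OF assms(1)]
    by (rule nn_integral_count_space'[OF assms(2)]) auto
  also have "\<dots> = (\<Sum>x\<in>A \<inter> X. ennreal (norm (p x)))" by (intro sum.cong) auto
  finally show ?thesis by (simp add: sum_ennreal)
qed

text \<open>Disjoint tents around the finitely many points of \<open>A\<close> in
  \<open>U \<inter> cball 0 r\<close>, each multiplied by the phase that makes \<open>p y\<close>
  positive, exhaust the variation there.\<close>

lemma ex_Cc_sign:
  fixes A U :: "'a::euclidean_space set"
  assumes A: "weakly_uniformly_discrete A" and U: "open U"
  shows "\<exists>f\<in>Cc. tsupport f \<subseteq> U \<and> (\<forall>x. norm (f x) \<le> 1) \<and>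
    (\<Sum>\<^sub>\<infinity>x\<in>A. p x * f x) = of_real (\<Sum>x\<in>A \<inter> (U \<inter> cball 0 r). norm (p x))"
proof -
  define F where "F = A \<inter> (U \<inter> cball 0 r)"
  have F: "finite F" unfolding F_def
    by (rule finite_subset[OF _ wud_finite_cball(1)[OF A, of 0 r]]) auto
  have "\<exists>d>0. d \<le> 1 \<and> cball y d \<subseteq> U \<and> (\<forall>x\<in>A. x \<noteq> y \<longrightarrow> d \<le> dist y x)" if "y \<in> F" for y
  proof -
    obtain d1 where d1: "d1 > 0" "\<And>x. x \<in> A \<inter> cball y 1 \<Longrightarrow> x \<noteq> y \<Longrightarrow> d1 \<le> dist y x"
      using finite_set_avoid[OF wud_finite_cball(1)[OF A, of y 1], of y] by blast
    have "y \<in> U" using that by (simp add: F_def)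
    then obtain d2 where d2: "d2 > 0" "cball y d2 \<subseteq> U"
      using open_contains_cball_eq[OF U] by blast
    have "cball y (min 1 (min d1 d2)) \<subseteq> U" using d2 by auto
    moreover have "min 1 (min d1 d2) \<le> dist y x" if "x \<in> A" "x \<noteq> y" for x
      using d1(2)[of x] that by (cases "dist y x \<le> 1") auto
    ultimately show ?thesis using d1(1) d2(1) by (intro exI[of _ "min 1 (min d1 d2)"]) auto
  qed
  then obtain d where d: "\<And>y. y \<in> F \<Longrightarrow> d y > 0 \<and> d y \<le> 1 \<and> cball y (d y) \<subseteq> U \<and> (\<forall>x\<in>A. x \<noteq> y \<longrightarrow> d y \<le> dist y x)"
    by metis
  \<comment> \<open>Halving the least \<open>d y\<close> keeps the tents inside \<open>U\<close>,
    disjoint where nonzero, and away from the other points of \<open>A\<close>. The inserted 1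
    covers the case of no points.\<close>
  define e where "e = Min (insert 1 (d ` F)) / 2"
  have e: "e > 0" "\<And>y. y \<in> F \<Longrightarrow> 2 * e \<le> d y"
    using d F by (auto simp: e_def)
  define tent where "tent y x = max 0 (1 - dist y x / e)" for y x :: 'a
  have tent: "0 \<le> tent y x" "tent y x \<le> 1" "tent y y = 1" "dist y x \<ge> e \<Longrightarrow> tent y x = 0" for y x
    using e(1) by (auto simp: tent_def)
  \<comment> \<open>The conjugate phase of \<open>p y\<close>; 0 is an arbitrary value where
    \<open>p y\<close> vanishes.\<close>
  define sg where "sg y = (if p y = 0 then 0 else cnj (p y) / of_real (norm (p y)))" for y
  have sg: "norm (sg y) \<le> 1" "p y * sg y = of_real (norm (p y))" for y
    using complex_norm_square[of "p y"] by (auto simp: sg_def norm_divide power2_eq_square field_simps)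
  define f where "f x = (\<Sum>y\<in>F. sg y * of_real (tent y x))" for x
  have f_near: "f x = sg y * of_real (tent y x)" if y: "y \<in> F" "dist y x < e" for x y
  proof -
    have "tent z x = 0" if "z \<in> F" "z \<noteq> y" for z
    proof (rule tent)
      have "2 * e \<le> d y" by (rule e(2)[OF y(1)])
      also have "d y \<le> dist y z" using d[OF y(1)] that by (auto simp: F_def)
      also have "dist y z \<le> dist y x + dist z x" by (metis dist_commute dist_triangle)
      finally show "e \<le> dist z x" using y(2) by simp
    qed
    then have "f x = (\<Sum>z\<in>{y}. sg z * of_real (tent z x))"
      unfolding f_def using F y(1) by (intro sum.mono_neutral_right) auto
    then show ?thesis by simp
  qed
  have f_far: "f x = 0" if "\<And>y. y \<in> F \<Longrightarrow> e \<le> dist y x" for x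
    unfolding f_def using that tent(4) by (intro sum.neutral) auto
  have cont: "continuous_on UNIV f"
    unfolding f_def[abs_def] tent_def using e(1) by (intro continuous_intros) auto
  have sub: "{x. f x \<noteq> 0} \<subseteq> (\<Union>y\<in>F. cball y e)"
  proof
    fix x assume "x \<in> {x. f x \<noteq> 0}"
    then obtain y where "y \<in> F" "dist y x < e" using f_far[of x] by (auto simp: not_le[symmetric])
    then show "x \<in> (\<Union>y\<in>F. cball y e)" by (auto intro!: bexI[of _ y])
  qed
  have "compact (\<Union>y\<in>F. cball y e)" using F by (intro compact_UN) auto
  moreover have supp: "tsupport f \<subseteq> (\<Union>y\<in>F. cball y e)"
    unfolding tsupport_def using sub by (intro closure_minimal) (auto intro: compact_imp_closed calculation)
  ultimately have "compact (tsupport f)"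
    by (metis closed_closure compact_Int_closed inf.absorb_iff2 tsupport_def)
  with cont have fC: "f \<in> Cc" by (simp add: Cc_def)
  have "cball y e \<subseteq> U" if "y \<in> F" for y
  proof -
    have "cball y e \<subseteq> cball y (d y)" using e(1) e(2)[OF that] by auto
    with d[OF that] show ?thesis by blast
  qed
  with supp have "tsupport f \<subseteq> U" by blast
  moreover have "norm (f x) \<le> 1" for x
  proof (cases "\<exists>y\<in>F. dist y x < e")
    case True
    then obtain y where "y \<in> F" "dist y x < e" by blast
    then have "norm (f x) = norm (sg y) * tent y x" using tent(1)[of y x] by (simp add: f_near norm_mult)
    also have "\<dots> \<le> 1 * 1" using sg tent by (intro mult_mono) auto
    finally show ?thesis by simp
  qed (use f_far[of x] in force)
  moreover have "(\<Sum>\<^sub>\<infinity>x\<in>A. p x * f x) = of_real (\<Sum>x\<in>F. norm (p x))"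
  proof -
    have "(\<Sum>\<^sub>\<infinity>x\<in>A. p x * f x) = (\<Sum>\<^sub>\<infinity>x\<in>F. p x * sg x)"
    proof (rule infsum_cong_neutral)
      fix x assume x: "x \<in> A - F"
      have "e \<le> dist y x" if "y \<in> F" for y
      proof -
        have "2 * e \<le> d y" by (rule e(2)[OF that])
        also have "d y \<le> dist y x" using d[OF that] x that by auto
        finally show ?thesis using e(1) by simp
      qed
      then show "p x * f x = 0" by (simp add: f_far)
    next
      fix x assume "x \<in> A \<inter> F"
      then show "p x * f x = p x * sg x" using f_near[of x x] e(1) tent(3)[of x] by simp
    qed (auto simp: F_def)
    then show ?thesis using F by (simp add: sg)
  qed
  ultimately show ?thesis using fC unfolding F_def by blast
qed

text \<open>The lower bound exhausts \<open>U\<close> by balls, because \<open>U\<close> may contain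
  infinitely many points of \<open>A\<close> and have infinite mass, while \<open>ex_Cc_sign\<close>
  handles finitely many at a time.\<close>

lemma variation_open_point_sum:
  fixes A U :: "'a::euclidean_space set"
  assumes A: "weakly_uniformly_discrete A" and m: "\<And>f. f \<in> Cc \<Longrightarrow> m f = (\<Sum>\<^sub>\<infinity>x\<in>A. p x * f x)"
    and U: "open U"
  shows "variation_open m U = emeasure (weighted_points A p) U"
proof (rule antisym)
  show "variation_open m U \<le> emeasure (weighted_points A p) U"
    unfolding variation_open_def
  proof (rule SUP_least)
    fix f assume "f \<in> {f \<in> Cc. tsupport f \<subseteq> U \<and> (\<forall>x. norm (f x) \<le> 1)}"
    then have f: "f \<in> Cc" "tsupport f \<subseteq> U" "\<And>x. norm (f x) \<le> 1" by auto
    obtain r where r: "\<And>x. norm x > r \<Longrightarrow> f x = 0" using CcD(3)[OF f(1)] by blast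
    have fin: "finite (A \<inter> (U \<inter> cball 0 r))"
      by (rule finite_subset[OF _ wud_finite_cball(1)[OF A, of 0 r]]) auto
    have z: "f x = 0" if "x \<notin> U" for x
      using that f(2) closure_subset[of "{x. f x \<noteq> 0}"] by (auto simp: tsupport_def)
    have "m f = (\<Sum>x\<in>A \<inter> (U \<inter> cball 0 r). p x * f x)"
      unfolding m[OF f(1)] infsum_finite[OF fin, symmetric]
      by (rule infsum_cong_neutral) (use r z in force)+
    also have "norm \<dots> \<le> (\<Sum>x\<in>A \<inter> (U \<inter> cball 0 r). norm (p x))"
      by (rule order_trans[OF norm_sum sum_mono]) (auto simp: norm_mult intro!: mult_left_le f(3))
    finally have "ennreal (norm (m f)) \<le> emeasure (weighted_points A p) (U \<inter> cball 0 r)"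
      using U fin by (subst emeasure_weighted_points_finite) (auto intro: ennreal_leI)
    also have "\<dots> \<le> emeasure (weighted_points A p) U"
      using U by (intro emeasure_mono) auto
    finally show "ennreal (norm (m f)) \<le> emeasure (weighted_points A p) U" .
  qed
  have "emeasure (weighted_points A p) U = emeasure (weighted_points A p) (\<Union>n. U \<inter> cball 0 (real n))"
  proof -
    have "(\<Union>n. U \<inter> cball 0 (real n)) = U" using real_arch_simple by auto
    then show ?thesis by simp
  qed
  also have "\<dots> = (SUP n. emeasure (weighted_points A p) (U \<inter> cball 0 (real n)))"
    using U by (intro SUP_emeasure_incseq[symmetric]) (auto simp: incseq_def)
  also have "\<dots> \<le> variation_open m U"
  proof (rule SUP_least)
    fix n
    have fin: "finite (A \<inter> (U \<inter> cball 0 (real n)))"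
      by (rule finite_subset[OF _ wud_finite_cball(1)[OF A, of 0 "real n"]]) auto
    obtain f where f: "f \<in> Cc" "tsupport f \<subseteq> U" "\<And>x. norm (f x) \<le> 1"
      "(\<Sum>\<^sub>\<infinity>x\<in>A. p x * f x) = of_real (\<Sum>x\<in>A \<inter> (U \<inter> cball 0 (real n)). norm (p x))"
      using ex_Cc_sign[OF A U, of p "real n"] by blast
    have "emeasure (weighted_points A p) (U \<inter> cball 0 (real n)) = ennreal (norm (m f))"
      using U fin by (subst emeasure_weighted_points_finite) (simp_all only: m[OF f(1)] f(4) norm_of_real, auto simp: sum_nonneg)
    also have "\<dots> \<le> variation_open m U"
      unfolding variation_open_def by (rule SUP_upper) (use f in auto)
    finally show "emeasure (weighted_points A p) (U \<inter> cball 0 (real n)) \<le> variation_open m U" .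
  qed
  finally show "emeasure (weighted_points A p) U \<le> variation_open m U" .
qed

text \<open>The infimum in the outer regular extension is attained: the complement of
  \<open>A - X\<close> is open, as subsets of \<open>A\<close> are closed, and contains exactly the
  same points of \<open>A\<close> as \<open>X\<close>.\<close>

lemma variation_point_sum:
  fixes A :: "'a::euclidean_space set"
  assumes A: "weakly_uniformly_discrete A" and m: "\<And>f. f \<in> Cc \<Longrightarrow> m f = (\<Sum>\<^sub>\<infinity>x\<in>A. p x * f x)"
  shows "variation m = weighted_points A p"
proof -
  let ?W = "weighted_points A p"
  have "(INF U\<in>{U. open U \<and> X \<subseteq> U}. variation_open m U) = emeasure ?W X" if X: "X \<in> sets borel" for X
  proof (rule antisym)
    let ?U = "- (A - X)"
    have U: "open ?U" by (intro open_Compl wud_subset_closed[OF A]) auto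
    have "(INF U\<in>{U. open U \<and> X \<subseteq> U}. variation_open m U) \<le> variation_open m ?U"
      by (rule INF_lower) (use U in auto)
    also have "\<dots> = emeasure ?W ?U" by (rule variation_open_point_sum[OF A m U])
    also have "\<dots> = emeasure ?W X"
      using U X by (subst (1 2) emeasure_weighted_points) (auto intro!: nn_integral_cong simp: indicator_def)
    finally show "(INF U\<in>{U. open U \<and> X \<subseteq> U}. variation_open m U) \<le> emeasure ?W X" .
    show "emeasure ?W X \<le> (INF U\<in>{U. open U \<and> X \<subseteq> U}. variation_open m U)"
    proof (rule INF_greatest)
      fix U assume "U \<in> {U. open U \<and> X \<subseteq> U}"
      then show "emeasure ?W X \<le> variation_open m U"
        by (auto simp: variation_open_point_sum[OF A m] intro!: emeasure_mono)
    qed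
  qed
  then have "variation m = measure_of UNIV (sets borel) (emeasure ?W)"
    unfolding variation_def
    by (intro measure_of_eq) (auto simp: sets.sigma_sets_eq[of "borel :: 'a measure", simplified])
  also have "\<dots> = ?W" using measure_of_of_measure[of ?W] by simp
  finally show ?thesis .
qed

section \<open>Translation boundedness and integration against point measures\<close>

lemma translation_bounded_point_sum:
  fixes A :: "'a::euclidean_space set"
  assumes A: "weakly_uniformly_discrete A" and m: "\<And>f. f \<in> Cc \<Longrightarrow> m f = (\<Sum>\<^sub>\<infinity>x\<in>A. p x * f x)"
    and p: "\<And>x. x \<in> A \<Longrightarrow> norm (p x) \<le> M" and M: "M \<ge> 0"
  shows "translation_bounded m"
proof -
  have v: "variation m = weighted_points A p" by (rule variation_point_sum[OF A m])
  show ?thesis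
    unfolding translation_bounded_def v
  proof (intro allI impI)
    fix E :: "'a set" assume E: "compact E"
    obtain n where n: "\<And>x. finite (A \<inter> (+) x ` E)" "\<And>x. card (A \<inter> (+) x ` E) \<le> n"
      using A E unfolding weakly_uniformly_discrete_def by meson
    have "emeasure (weighted_points A p) ((+) x ` E) \<le> ennreal (M * n)" for x
    proof -
      have "compact ((+) x ` E)" using E by (rule compact_translation)
      then have b: "(+) x ` E \<in> sets borel" by (intro borel_closed compact_imp_closed)
      have "(\<Sum>y\<in>A \<inter> (+) x ` E. norm (p y)) \<le> of_nat (card (A \<inter> (+) x ` E)) * M"
        using p by (intro sum_bounded_above) auto
      also have "\<dots> \<le> of_nat n * M" using n(2)[of x] M by (intro mult_right_mono) auto
      finally show ?thesis
        unfolding emeasure_weighted_points_finite[OF b n(1)] by (intro ennreal_leI) (simp add: mult.commute)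
    qed
    then have "(SUP x. emeasure (weighted_points A p) ((+) x ` E)) \<le> ennreal (M * n)" by (rule SUP_least)
    also have "\<dots> < \<infinity>" by simp
    finally show "(SUP x. emeasure (weighted_points A p) ((+) x ` E)) < \<infinity>" .
  qed
qed

lemma nn_integral_norm_weighted_points:
  assumes [measurable]: "h \<in> borel_measurable borel" and "(\<lambda>x. norm (p x * h x)) summable_on A"
  shows "(\<integral>\<^sup>+x. ennreal (norm (h x :: complex)) \<partial>weighted_points A p) = ennreal (\<Sum>\<^sub>\<infinity>x\<in>A. norm (p x * h x))"
proof -
  have s: "integrable (count_space A) (\<lambda>x. norm (p x * h x))"
    using assms(2) abs_summable_equivalent[of "\<lambda>x. norm (p x * h x)" A]
    unfolding Infinite_Set_Sum.abs_summable_on_def by simp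
  have "(\<integral>\<^sup>+x. ennreal (norm (h x)) \<partial>weighted_points A p) = (\<integral>\<^sup>+x. ennreal (norm (p x * h x)) \<partial>count_space A)"
    by (subst nn_integral_weighted_points) (auto simp: norm_mult ennreal_mult)
  also have "\<dots> = ennreal (integral\<^sup>L (count_space A) (\<lambda>x. norm (p x * h x)))"
    using s by (intro nn_integral_eq_integral) auto
  also have "integral\<^sup>L (count_space A) (\<lambda>x. norm (p x * h x)) = (\<Sum>\<^sub>\<infinity>x\<in>A. norm (p x * h x))"
    using infsetsum_infsum[unfolded Infinite_Set_Sum.abs_summable_on_def, OF s] by (simp add: infsetsum_def)
  finally show ?thesis .
qed

text \<open>The functions \<open>cutoff n * h\<close> approximate \<open>h\<close> from
  \<open>Cc\<close>. Since the cutoffs are bounded by \<open>exp 1\<close>, one summable majorant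
  gives both the L1 convergence and the convergence of the values of \<open>m\<close>.\<close>

lemma has_radon_integral_point_sum:
  fixes A :: "'a::euclidean_space set"
  assumes A: "weakly_uniformly_discrete A" and m: "\<And>f. f \<in> Cc \<Longrightarrow> m f = (\<Sum>\<^sub>\<infinity>x\<in>A. p x * f x)"
    and h: "continuous_on UNIV h" and s: "(\<lambda>x. norm (p x * h x)) summable_on A"
  shows "has_radon_integral m h (\<Sum>\<^sub>\<infinity>x\<in>A. p x * h x)"
proof -
  have v: "variation m = weighted_points A p" by (rule variation_point_sum[OF A m])
  have [measurable]: "h \<in> borel_measurable borel" using h by (rule borel_measurable_continuous_onI)
  have int: "integrable (weighted_points A p) h"
    unfolding integrable_iff_bounded nn_integral_norm_weighted_points[OF \<open>h \<in> borel_measurable borel\<close> s] by simp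
  define f where "f n x = cutoff n x * h x" for n x
  have cc: "continuous_on UNIV (cutoff n :: 'a \<Rightarrow> complex)" for n by (rule schwartzD(3)[OF cutoff_schwartz])
  have fC: "f n \<in> Cc" for n
    unfolding f_def by (rule CcI(1)[of _ "Suc n"]) (use cc h in \<open>auto intro!: continuous_intros simp: cutoff_eq_0\<close>)
  then have mf: "m (f n) = (\<Sum>\<^sub>\<infinity>x\<in>A. p x * f n x)" for n by (rule m)
  have cb: "norm (cutoff n x) \<le> exp 1" for n and x :: 'a
    using bumpr_le_1[of "(1 / real (Suc n)) *\<^sub>R x"] by (simp add: cutoff_def norm_mult)
  have cl: "(\<lambda>n. cutoff n x) \<longlonglongrightarrow> 1" for x :: 'a
  proof -
    obtain C where "\<And>n (x :: 'a). norm (cutoff n x - 1) \<le> C * (1 + norm x) / Suc n"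
      using small_familyD[OF small_family_cutoff] by blast
    then show ?thesis by (rule LIMSEQ_norm_le_inverse)
  qed
  have ph: "(\<lambda>x. (1 + exp 1) * norm (p x * h x)) summable_on A" by (rule summable_on_cmult_right[OF s])
  have fl: "(\<lambda>n. f n x) \<longlonglongrightarrow> h x" for x
    using tendsto_mult[OF cl[of x] tendsto_const[of "h x"]] by (simp add: f_def)
  have fb: "norm (f n x) \<le> exp 1 * norm (h x)" for n x
    unfolding f_def norm_mult by (intro mult_right_mono cb) auto
  have lim: "(\<lambda>n. m (f n)) \<longlonglongrightarrow> (\<Sum>\<^sub>\<infinity>x\<in>A. p x * h x)"
    unfolding mf
  proof (rule infsum_dominated_tendsto[OF ph])
    show "norm (p x * f n x) \<le> (1 + exp 1) * norm (p x * h x)" for n x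
    proof -
      have "norm (p x) * norm (f n x) \<le> norm (p x) * ((1 + exp 1) * norm (h x))"
        using fb[of n x] by (intro mult_left_mono) (auto simp: distrib_right intro: add_increasing)
      then show ?thesis by (simp add: norm_mult mult_ac)
    qed
    show "(\<lambda>n. p x * f n x) \<longlonglongrightarrow> p x * h x" for x by (intro tendsto_intros fl)
  qed
  have db: "norm (p x * (h x - f n x)) \<le> (1 + exp 1) * norm (p x * h x)" for n x
  proof -
    have "norm (h x - f n x) \<le> (1 + exp 1) * norm (h x)"
      using norm_triangle_ineq4[of "h x" "f n x"] fb[of n x] by (simp add: distrib_right)
    then have "norm (p x) * norm (h x - f n x) \<le> norm (p x) * ((1 + exp 1) * norm (h x))"
      by (rule mult_left_mono) auto
    then show ?thesis by (simp add: norm_mult mult_ac)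
  qed
  have ds: "(\<lambda>x. norm (p x * (h x - f n x))) summable_on A" for n
    by (rule Infinite_Sum.abs_summable_on_comparison_test'[OF ph db])
  have fm [measurable]: "f n \<in> borel_measurable borel" for n
    unfolding f_def using cc h by (intro borel_measurable_continuous_onI continuous_intros)
  \<comment> \<open>The norms are cast to complex numbers because
    \<open>infsum_dominated_tendsto\<close> is stated for complex families.\<close>
  have "(\<lambda>n. \<Sum>\<^sub>\<infinity>x\<in>A. complex_of_real (norm (p x * (h x - f n x)))) \<longlonglongrightarrow> (\<Sum>\<^sub>\<infinity>x\<in>A. 0)"
  proof (rule infsum_dominated_tendsto[OF ph])
    show "norm (complex_of_real (norm (p x * (h x - f n x)))) \<le> (1 + exp 1) * norm (p x * h x)" for n x
      using db[of x n] by simp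
    have "(\<lambda>n. complex_of_real (norm (p x * (h x - f n x)))) \<longlonglongrightarrow> of_real (norm (p x * (h x - h x)))" for x
      by (intro tendsto_intros fl)
    then show "(\<lambda>n. complex_of_real (norm (p x * (h x - f n x)))) \<longlonglongrightarrow> 0" for x by simp
  qed
  moreover have "(\<Sum>\<^sub>\<infinity>x\<in>A. complex_of_real (norm (p x * (h x - f n x)))) = of_real (\<Sum>\<^sub>\<infinity>x\<in>A. norm (p x * (h x - f n x)))" for n
    by (rule infsumI[OF has_sum_bounded_linear[OF bounded_linear_of_real has_sum_infsum[OF ds]]])
  ultimately have "(\<lambda>n. complex_of_real (\<Sum>\<^sub>\<infinity>x\<in>A. norm (p x * (h x - f n x)))) \<longlonglongrightarrow> of_real 0" by simp
  then have "(\<lambda>n. \<Sum>\<^sub>\<infinity>x\<in>A. norm (p x * (h x - f n x))) \<longlonglongrightarrow> 0" by (simp only: tendsto_of_real_iff)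
  then have "(\<lambda>n. ennreal (\<Sum>\<^sub>\<infinity>x\<in>A. norm (p x * (h x - f n x)))) \<longlonglongrightarrow> ennreal 0" by (rule tendsto_ennrealI)
  moreover have "(\<integral>\<^sup>+x. ennreal (norm (h x - f n x)) \<partial>weighted_points A p) = ennreal (\<Sum>\<^sub>\<infinity>x\<in>A. norm (p x * (h x - f n x)))" for n
    by (rule nn_integral_norm_weighted_points[OF _ ds]) measurable
  ultimately have "(\<lambda>n. \<integral>\<^sup>+x. ennreal (norm (h x - f n x)) \<partial>weighted_points A p) \<longlonglongrightarrow> 0" by simp
  with int fC lim show ?thesis unfolding has_radon_integral_def v by blast
qed

lemma has_measure_fourier_point_sum:
  fixes A B :: "'a::euclidean_space set"
  assumes B: "weakly_uniformly_discrete B"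
    and radon: "radon_measure m" "radon_measure n"
    and m: "\<And>f. f \<in> Cc \<Longrightarrow> m f = (\<Sum>\<^sub>\<infinity>x\<in>A. p x * f x)"
    and n: "\<And>f. f \<in> Cc \<Longrightarrow> n f = (\<Sum>\<^sub>\<infinity>y\<in>B. q y * f y)"
    and q: "\<And>y. y \<in> B \<Longrightarrow> norm (q y) \<le> M"
    and eq: "\<And>g. g \<in> K2 \<Longrightarrow> (\<Sum>\<^sub>\<infinity>x\<in>A. p x * g x) = (\<Sum>\<^sub>\<infinity>y\<in>B. q y * inv_fourier g y)"
  shows "has_measure_fourier m n"
proof -
  have *: "has_radon_integral n (inv_fourier g) (m g)" if g: "g \<in> K2" for g
  proof -
    have gC: "g \<in> Cc" by (rule K2D(1)[OF B g])
    have "continuous_on UNIV (inv_fourier g)" by (rule smooth_withD(3)[OF inv_fourier_slow[OF Cc_rapid_meas[OF gC]]])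
    moreover have "(\<lambda>y. norm (q y * inv_fourier g y)) summable_on B"
    proof (rule Infinite_Sum.abs_summable_on_comparison_test')
      show "(\<lambda>y. M * norm (inv_fourier g y)) summable_on B"
        by (rule summable_on_cmult_right[OF K2D(2)[OF B g]])
      show "norm (q y * inv_fourier g y) \<le> M * norm (inv_fourier g y)" if "y \<in> B" for y
        unfolding norm_mult by (intro mult_right_mono q that) auto
    qed
    ultimately show ?thesis
      using has_radon_integral_point_sum[OF B n] eq[OF g] m[OF gC] by metis
  qed
  then show ?thesis using radon unfolding has_measure_fourier_def has_radon_integral_def by blast
qed

theorem lemma6p3:
  fixes \<Lambda> S :: "'a::euclidean_space set"
    and a b :: "'a \<Rightarrow> complex"
    and \<mu> \<nu> T\<^sub>\<mu> T\<^sub>\<nu> :: "'a functional"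
  assumes "uniform_discrete \<Lambda>"
    and "weakly_uniformly_discrete S"
    and "radon_measure \<mu>"
    and "radon_measure \<nu>"
    and "\<And>f. f \<in> Cc \<Longrightarrow> \<mu> f = (\<Sum>\<^sub>\<infinity>x\<in>\<Lambda>. a x * f x)"
    and "\<And>f. f \<in> Cc \<Longrightarrow> \<nu> f = (\<Sum>\<^sub>\<infinity>y\<in>S. b y * f y)"
    and "tempered_extension \<mu> T\<^sub>\<mu>"
    and "tempered_extension \<nu> T\<^sub>\<nu>"
    and "has_distr_fourier T\<^sub>\<mu> T\<^sub>\<nu>"
  shows "translation_bounded \<mu> \<and> translation_bounded \<nu> \<and>
    fourier_transformable \<mu> \<and> fourier_transformable \<nu> \<and>
    has_measure_fourier \<mu> \<nu>"
proof -
  interpret fourier_pair \<Lambda> S a b T\<^sub>\<mu> T\<^sub>\<nu>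
    by unfold_locales (use assms in \<open>auto simp: tempered_extension_def has_distr_fourier_def\<close>)
  obtain M1 where M1: "M1 \<ge> 0" "\<And>x. x \<in> \<Lambda> \<Longrightarrow> norm (a x) \<le> M1" using a_bounded by blast
  obtain M2 where M2: "M2 \<ge> 0" "\<And>y. y \<in> S \<Longrightarrow> norm (b y) \<le> M2" using b_bounded by blast
  have "translation_bounded \<mu>" by (rule translation_bounded_point_sum[OF wud\<^sub>\<Lambda> assms(5) M1(2,1)])
  moreover have "translation_bounded \<nu>" by (rule translation_bounded_point_sum[OF wud assms(6) M2(2,1)])
  moreover have \<mu>\<nu>: "has_measure_fourier \<mu> \<nu>"
    by (rule has_measure_fourier_point_sum[OF wud assms(3,4,5,6) M2(2) a_identity])
  \<comment> \<open>The transform of \<nu> is \<mu> reflected at the origin, again a point sum with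
    bounded coefficients over a uniformly discrete set.\<close>
  moreover have "has_measure_fourier \<nu> (\<lambda>f. \<Sum>\<^sub>\<infinity>x\<in>uminus ` \<Lambda>. a (- x) * f x)"
  proof (rule has_measure_fourier_point_sum[OF _ assms(4) _ assms(6) refl _ b_identity])
    have "uniform_discrete (uminus ` \<Lambda>)"
      using ud unfolding uniform_discrete_def by (auto simp: dist_minus)
    then show "weakly_uniformly_discrete (uminus ` \<Lambda>)" by (rule uniform_discrete_imp_weakly)
    then show "radon_measure (\<lambda>f. \<Sum>\<^sub>\<infinity>x\<in>uminus ` \<Lambda>. a (- x) * f x)" by (rule radon_measure_point_sum)
    show "norm (a (- x)) \<le> M1" if "x \<in> uminus ` \<Lambda>" for x using that M1(2)[of "- x"] by auto
  qed
  ultimately show ?thesis unfolding fourier_transformable_def by blast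
qed

end
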